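(* Let $(w,F)\in C^2(\overline R)\times\mathbb R$, with $w$ of finite $C^2$ norm, be a solution of the height equation such that $w>0$ in $R\cup T$, $F>F_{\mathrm{cr}}$, and $w,Dw,D^2w\to0$ uniformly as $q\to-\infty$ (or as $q\to+\infty$). Then there exists $q_*\in\mathbb R$ such that $q\mapsto w(q,\cdot)$ is even about $q=q_*$ and $$\pm w_q>0\quad\text{for }\pm(q_*-q)>0,\ -1<p\le0.$$
   Context: Fix $\alpha\in(0,1)$, $\rho\in C^{2+\alpha}([-1,0])$ with $\rho>0$, $\rho_p\le0$, and $H\in C^{3+\alpha}([-1,0])$ with $H(-1)=0$, $H(0)=1$, $H_p>0$. Let $R=\mathbb R\times(-1,0)$ (coordinates $(q,p)$), $T=\mathbb R\times\{0\}$, $B=\mathbb R\times\{-1\}$. For $F>0$, $(w,F)$ solves the height equation if $h=H+w$ satisfies $\big(-\frac{1+h_q^2}{2h_p^2}+\frac1{2H_p^2}\big)_p+\big(\frac{h_q}{h_p}\big)_q-\frac1{F^2}\rho_p(h-H)=0$ in $R$, $\frac{1+h_q^2}{2h_p^2}-\frac1{2H_p^2}+\frac1{F^2}\rho(h-1)=0$ on $T$, $h=0$ on $B$, and $0<\inf_R(H_p+w_p)<\infty$. $\mu_{\mathrm{cr}}$ is the smallest positive $\mu$ for which $(\phi_p/H_p^3)_p-\mu\rho_p\phi=0$ on $(-1,0)$, $\phi(-1)=0$, $-\phi_p(0)/H_p(0)^3+\mu\rho(0)\phi(0)=0$ has a nontrivial solution, and $F_{\mathrm{cr}}=\mu_{\mathrm{cr}}^{-1/2}$.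 *)

theory Defs
  imports "HOL-Analysis.Analysis"
begin

definition strip :: "(real \<times> real) set" where
  "strip = {z. -1 \<le> snd z \<and> snd z \<le> 0}"

definition C_k_alpha :: "nat \<Rightarrow> real \<Rightarrow> (real \<Rightarrow> real) \<Rightarrow> bool" where
  "C_k_alpha k \<alpha> f \<longleftrightarrow> (\<exists>D :: nat \<Rightarrow> real \<Rightarrow> real.
     (\<forall>x\<in>{-1..0}. D 0 x = f x) \<and>
     (\<forall>j<k. \<forall>x\<in>{-1..0}. (D j has_real_derivative D (Suc j) x) (at x within {-1..0})) \<and>
     continuous_on {-1..0} (D k) \<and>
     (\<exists>C. \<forall>x\<in>{-1..0}. \<forall>y\<in>{-1..0}. \<bar>D k x - D k y\<bar> \<le> C * \<bar>x - y\<bar> powr \<alpha>))"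

definition C2_strip ::
  "(real \<Rightarrow> real \<Rightarrow> real) \<Rightarrow> (real \<Rightarrow> real \<Rightarrow> real) \<Rightarrow> (real \<Rightarrow> real \<Rightarrow> real) \<Rightarrow>
   (real \<Rightarrow> real \<Rightarrow> real) \<Rightarrow> (real \<Rightarrow> real \<Rightarrow> real) \<Rightarrow> (real \<Rightarrow> real \<Rightarrow> real) \<Rightarrow>
   (real \<Rightarrow> real \<Rightarrow> real) \<Rightarrow> bool" where
  "C2_strip w wq wp wqq wqp wpq wpp \<longleftrightarrow>
     (\<forall>z\<in>strip.
        ((\<lambda>y. w (fst y) (snd y)) has_derivative
           (\<lambda>d. wq (fst z) (snd z) * fst d + wp (fst z) (snd z) * snd d)) (at z within strip) \<and>
        ((\<lambda>y. wq (fst y) (snd y)) has_derivative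
           (\<lambda>d. wqq (fst z) (snd z) * fst d + wqp (fst z) (snd z) * snd d)) (at z within strip) \<and>
        ((\<lambda>y. wp (fst y) (snd y)) has_derivative
           (\<lambda>d. wpq (fst z) (snd z) * fst d + wpp (fst z) (snd z) * snd d)) (at z within strip)) \<and>
     (\<forall>g\<in>{w, wq, wp, wqq, wqp, wpq, wpp}. continuous_on strip (\<lambda>y. g (fst y) (snd y)))"

definition C2_bounded ::
  "(real \<Rightarrow> real \<Rightarrow> real) list \<Rightarrow> bool" where
  "C2_bounded gs \<longleftrightarrow> (\<forall>g\<in>set gs. \<exists>M. \<forall>z\<in>strip. \<bar>g (fst z) (snd z)\<bar> \<le> M)"

definition has_eigensolution ::
  "(real \<Rightarrow> real) \<Rightarrow> (real \<Rightarrow> real) \<Rightarrow> (real \<Rightarrow> real) \<Rightarrow> real \<Rightarrow> bool" where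
  "has_eigensolution Hp \<rho> \<rho>p \<mu> \<longleftrightarrow> (\<exists>\<phi> \<phi>p :: real \<Rightarrow> real.
     (\<forall>x\<in>{-1..0}. (\<phi> has_real_derivative \<phi>p x) (at x within {-1..0})) \<and>
     continuous_on {-1..0} \<phi>p \<and>
     (\<forall>x\<in>{-1<..<0}. \<exists>g. ((\<lambda>y. \<phi>p y / Hp y ^ 3) has_real_derivative g) (at x) \<and>
                         g - \<mu> * \<rho>p x * \<phi> x = 0) \<and>
     \<phi> (-1) = 0 \<and>
     - \<phi>p 0 / Hp 0 ^ 3 + \<mu> * \<rho> 0 * \<phi> 0 = 0 \<and>
     (\<exists>x\<in>{-1..0}. \<phi> x \<noteq> 0))"

text \<open>The height equation for (w,F), h = H + w, with the given partial derivatives of w.\<close>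
definition height_eq ::
  "(real \<Rightarrow> real) \<Rightarrow> (real \<Rightarrow> real) \<Rightarrow> (real \<Rightarrow> real) \<Rightarrow> (real \<Rightarrow> real) \<Rightarrow>
   (real \<Rightarrow> real \<Rightarrow> real) \<Rightarrow> (real \<Rightarrow> real \<Rightarrow> real) \<Rightarrow> (real \<Rightarrow> real \<Rightarrow> real) \<Rightarrow> real \<Rightarrow> bool" where
  "height_eq H Hp \<rho> \<rho>p w wq wp F \<longleftrightarrow>
     F > 0 \<and>
     (\<forall>q p. -1 < p \<and> p < 0 \<longrightarrow>
        (\<exists>A B.
          ((\<lambda>p'. - (1 + (wq q p')\<^sup>2) / (2 * (Hp p' + wp q p')\<^sup>2) + 1 / (2 * (Hp p')\<^sup>2))
              has_real_derivative A) (at p) \<and>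
          ((\<lambda>q'. wq q' p / (Hp p + wp q' p)) has_real_derivative B) (at q) \<and>
          A + B - (1 / F\<^sup>2) * \<rho>p p * ((H p + w q p) - H p) = 0)) \<and>
     (\<forall>q. (1 + (wq q 0)\<^sup>2) / (2 * (Hp 0 + wp q 0)\<^sup>2) - 1 / (2 * (Hp 0)\<^sup>2)
           + (1 / F\<^sup>2) * \<rho> 0 * ((H 0 + w q 0) - 1) = 0) \<and>
     (\<forall>q. H (-1) + w q (-1) = 0) \<and>
     (\<exists>c>0. \<forall>q p. -1 < p \<and> p < 0 \<longrightarrow> c \<le> Hp p + wp q p)"

definition decays_left :: "(real \<Rightarrow> real \<Rightarrow> real) list \<Rightarrow> bool" where
  "decays_left gs \<longleftrightarrow> (\<forall>\<epsilon>>0. \<exists>M. \<forall>q p. q \<le> M \<and> -1 \<le> p \<and> p \<le> 0 \<longrightarrow>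
       (\<forall>g\<in>set gs. \<bar>g q p\<bar> < \<epsilon>))"

definition decays_right :: "(real \<Rightarrow> real \<Rightarrow> real) list \<Rightarrow> bool" where
  "decays_right gs \<longleftrightarrow> (\<forall>\<epsilon>>0. \<exists>M. \<forall>q p. q \<ge> M \<and> -1 \<le> p \<and> p \<le> 0 \<longrightarrow>
       (\<forall>g\<in>set gs. \<bar>g q p\<bar> < \<epsilon>))"

end

theory Submission
  imports Defs
begin

text \<open>The proof is by moving planes. In nondivergence form the height equation is a quasilinear
  elliptic equation with a nonlinear oblique condition on the top, and it is invariant under
  reflections and translations in \<open>q\<close>. Supercriticality provides a positive strict supersolution of the
  problem linearized at the trivial flow: shooting from the bed, the profile cannot lose positivity
  before an eigenvalue is met. Dividing differences of solutions by (perturbations of) this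
  supersolution excludes negative minima where \<open>w\<close> is small and in narrow regions near the bed and
  near the reflection line; elsewhere the strong maximum principle applies. So the plane moves until
  \<open>w\<close> is symmetric or forever. In the latter case \<open>w\<close> is a front, whose downstream limit is a
  conjugate laminar flow, and conservation of the flow force rules that out. Strict monotonicity
  follows from the strong maximum principle for the difference quotients in \<open>q\<close>, so neither the Hopf
  lemma nor Serrin's corner lemma is needed.\<close>

section \<open>Jets on the strip\<close>

text \<open>The zeroth-order terms have the wrong sign for the maximum principle: in the interior
  because \<open>\<rho>p\<close> is nonpositive, at the surface because \<rho> is positive. At a
  negative minimum of a difference they must be beaten by a supersolution; where the difference is
  nonnegative the same terms help, so the barrier argument needs no spectral input. No coefficients
  are averaged along segments: if \<open>w1 - w2 - \<theta>\<close> has an interior minimum, the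
  first derivatives of \<open>w1\<close> are those of \<open>w2 + \<theta>\<close>, and subtracting
  the equations there leaves an inequality free of the second derivatives of \<open>w1\<close>. This
  requires only twice differentiable functions and bounds that all reflected and translated copies
  of the wave share. The order of choices shapes the supersolution: the corrections near the
  reflection line depend on its lower bound \<open>b\<close> and its surface bound \<open>U\<close>,
  and the concavity demanded near the bed depends on those corrections; hence \<open>b\<close> and
  \<open>U\<close> must be fixed before the strength \<open>N\<close> of the bottom layer.\<close>

lemma local_min_second_derivative:
  fixes g g' :: "real \<Rightarrow> real"
  assumes "e > 0"
    and g: "\<And>t. \<bar>t\<bar> < e \<Longrightarrow> (g has_real_derivative g' t) (at t)"
    and g': "(g' has_real_derivative D) (at 0)"
    and min: "\<And>t. \<bar>t\<bar> < e \<Longrightarrow> g 0 \<le> g t"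
  shows "g' 0 = 0" "D \<ge> 0"
proof -
  show g0: "g' 0 = 0"
    using DERIV_local_min[of g "g' 0" 0 e] g[of 0] min \<open>e > 0\<close> by auto
  show "D \<ge> 0"
  proof (rule ccontr)
    assume "\<not> D \<ge> 0"
    then obtain d where d: "d > 0" "\<And>h. h > 0 \<Longrightarrow> h < d \<Longrightarrow> g' (0 + h) < g' 0"
      using DERIV_neg_dec_right[OF g'] by auto
    define t where "t = min d e / 2"
    have t: "0 < t" "t < d" "t < e" using d(1) \<open>e > 0\<close> by (auto simp: t_def)
    obtain \<xi> where \<xi>: "0 < \<xi>" "\<xi> < t" "g t - g 0 = (t - 0) * g' \<xi>"
      using MVT2[of 0 t g g'] t g by force
    have "g' \<xi> < 0" using d(2)[of \<xi>] \<xi> t g0 by simp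
    then have "g t < g 0" using \<xi>(3) t(1) mult_pos_neg[of t "g' \<xi>"] by simp
    then show False using min[of t] t by simp
  qed
qed

text \<open>The derivative clauses of \<open>C2_strip\<close> without the continuity clauses, so
  that sums and explicit product functions are handled alike. The two mixed derivatives stay
  separate; at a minimum only their sum matters.\<close>

definition jet2 ::
  "(real \<Rightarrow> real \<Rightarrow> real) \<Rightarrow> (real \<Rightarrow> real \<Rightarrow> real) \<Rightarrow> (real \<Rightarrow> real \<Rightarrow> real) \<Rightarrow>
   (real \<Rightarrow> real \<Rightarrow> real) \<Rightarrow> (real \<Rightarrow> real \<Rightarrow> real) \<Rightarrow> (real \<Rightarrow> real \<Rightarrow> real) \<Rightarrow>
   (real \<Rightarrow> real \<Rightarrow> real) \<Rightarrow> bool" where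
  "jet2 f fq fp fqq fqp fpq fpp \<longleftrightarrow>
     (\<forall>z\<in>strip.
        ((\<lambda>y. f (fst y) (snd y)) has_derivative
           (\<lambda>d. fq (fst z) (snd z) * fst d + fp (fst z) (snd z) * snd d)) (at z within strip) \<and>
        ((\<lambda>y. fq (fst y) (snd y)) has_derivative
           (\<lambda>d. fqq (fst z) (snd z) * fst d + fqp (fst z) (snd z) * snd d)) (at z within strip) \<and>
        ((\<lambda>y. fp (fst y) (snd y)) has_derivative
           (\<lambda>d. fpq (fst z) (snd z) * fst d + fpp (fst z) (snd z) * snd d)) (at z within strip))"

lemma C2_strip_jet2: "C2_strip f fq fp fqq fqp fpq fpp \<Longrightarrow> jet2 f fq fp fqq fqp fpq fpp"
  by (simp add: C2_strip_def jet2_def)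

lemma has_derivative_plane_add:
  fixes f g :: "real \<times> real \<Rightarrow> real"
  assumes "(f has_derivative (\<lambda>d. a * fst d + b * snd d)) F"
    and "(g has_derivative (\<lambda>d. a' * fst d + b' * snd d)) F"
  shows "((\<lambda>y. f y + g y) has_derivative (\<lambda>d. (a + a') * fst d + (b + b') * snd d)) F"
  using has_derivative_add[OF assms] by (rule has_derivative_eq_rhs) (simp add: algebra_simps)

lemma has_derivative_plane_cmult:
  fixes f :: "real \<times> real \<Rightarrow> real"
  assumes "(f has_derivative (\<lambda>d. a * fst d + b * snd d)) F"
  shows "((\<lambda>y. k * f y) has_derivative (\<lambda>d. (k * a) * fst d + (k * b) * snd d)) F"
  using has_derivative_mult_right[OF assms, of k] by (rule has_derivative_eq_rhs) (simp add: algebra_simps)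

lemma jet2_add:
  assumes "jet2 f fq fp fqq fqp fpq fpp" "jet2 g gq gp gqq gqp gpq gpp"
  shows "jet2 (\<lambda>q p. f q p + g q p) (\<lambda>q p. fq q p + gq q p) (\<lambda>q p. fp q p + gp q p)
    (\<lambda>q p. fqq q p + gqq q p) (\<lambda>q p. fqp q p + gqp q p) (\<lambda>q p. fpq q p + gpq q p)
    (\<lambda>q p. fpp q p + gpp q p)"
  unfolding jet2_def
  by (intro ballI conjI has_derivative_plane_add) (use assms in \<open>simp_all add: jet2_def\<close>)

lemma jet2_cmult:
  assumes "jet2 f fq fp fqq fqp fpq fpp"
  shows "jet2 (\<lambda>q p. k * f q p) (\<lambda>q p. k * fq q p) (\<lambda>q p. k * fp q p)
    (\<lambda>q p. k * fqq q p) (\<lambda>q p. k * fqp q p) (\<lambda>q p. k * fpq q p) (\<lambda>q p. k * fpp q p)"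
  unfolding jet2_def
  by (intro ballI conjI has_derivative_plane_cmult) (use assms in \<open>simp_all add: jet2_def\<close>)

lemma jet2_diff:
  assumes "jet2 f fq fp fqq fqp fpq fpp" "jet2 g gq gp gqq gqp gpq gpp"
  shows "jet2 (\<lambda>q p. f q p - g q p) (\<lambda>q p. fq q p - gq q p) (\<lambda>q p. fp q p - gp q p)
    (\<lambda>q p. fqq q p - gqq q p) (\<lambda>q p. fqp q p - gqp q p) (\<lambda>q p. fpq q p - gpq q p)
    (\<lambda>q p. fpp q p - gpp q p)"
  using jet2_add[OF assms(1) jet2_cmult[OF assms(2), of "-1"]] by simp

lemma has_derivative_product_strip:
  fixes A B :: "real \<Rightarrow> real"
  assumes "(A has_real_derivative A') (at (fst z))"
    and "(B has_real_derivative B') (at (snd z) within {-1..0})"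
  shows "((\<lambda>y. A (fst y) * B (snd y)) has_derivative
          (\<lambda>d. (A' * B (snd z)) * fst d + (A (fst z) * B') * snd d)) (at z within strip)"
proof -
  have A: "((\<lambda>y. A (fst y)) has_derivative (\<lambda>d. A' * fst d)) (at z within strip)"
    by (rule has_derivative_compose[where g = A and g' = "\<lambda>x. A' * x"])
      (use assms(1) in \<open>auto simp: has_field_derivative_def intro: derivative_eq_intros\<close>)
  have B: "((\<lambda>y. B (snd y)) has_derivative (\<lambda>d. B' * snd d)) (at z within strip)"
  proof (rule has_derivative_in_compose[where g = B and g' = "\<lambda>x. B' * x"])
    show "(snd has_derivative snd) (at z within strip)"
      by (auto intro: derivative_eq_intros)
    have "snd ` strip \<subseteq> {-1..0}" by (auto simp: strip_def)
    then show "(B has_derivative (\<lambda>x. B' * x)) (at (snd z) within snd ` strip)"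
      using assms(2) has_derivative_subset by (auto simp: has_field_derivative_def)
  qed
  show ?thesis
    by (rule has_derivative_eq_rhs, rule has_derivative_mult[OF A B])
      (auto simp: algebra_simps)
qed

lemma jet2_product:
  fixes A A' A'' B B' B'' :: "real \<Rightarrow> real"
  assumes A: "\<And>q. (A has_real_derivative A' q) (at q)"
    and A': "\<And>q. (A' has_real_derivative A'' q) (at q)"
    and B: "\<And>p. p \<in> {-1..0} \<Longrightarrow> (B has_real_derivative B' p) (at p within {-1..0})"
    and B': "\<And>p. p \<in> {-1..0} \<Longrightarrow> (B' has_real_derivative B'' p) (at p within {-1..0})"
  shows "jet2 (\<lambda>q p. A q * B p) (\<lambda>q p. A' q * B p) (\<lambda>q p. A q * B' p)
    (\<lambda>q p. A'' q * B p) (\<lambda>q p. A' q * B' p) (\<lambda>q p. A' q * B' p) (\<lambda>q p. A q * B'' p)"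
  unfolding jet2_def
  by (intro ballI conjI has_derivative_product_strip A A' B B') (auto simp: strip_def)

section \<open>Partial derivatives and necessary conditions at minima\<close>

lemma at_within_strip_interior:
  assumes "-1 < snd z" "snd z < 0"
  shows "at z within strip = at z"
proof (rule at_within_open_subset)
  show "z \<in> {z. -1 < snd z \<and> snd z < 0}" using assms by simp
  have "{z :: real \<times> real. -1 < snd z \<and> snd z < 0} = snd -` {-1<..<0}" by auto
  then show "open {z :: real \<times> real. -1 < snd z \<and> snd z < 0}"
    by (simp add: open_vimage_snd)
qed (auto simp: strip_def)

lemma strip_derivative_line:
  fixes f :: "real \<Rightarrow> real \<Rightarrow> real"
  assumes "((\<lambda>y. f (fst y) (snd y)) has_derivative (\<lambda>d. a * fst d + b * snd d))
             (at (q + t * d1, p + t * d2) within strip)"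
    and "-1 < p + t * d2" "p + t * d2 < 0"
  shows "((\<lambda>t. f (q + t * d1) (p + t * d2)) has_real_derivative a * d1 + b * d2) (at t)"
proof -
  have 1: "((\<lambda>y. f (fst y) (snd y)) has_derivative (\<lambda>d. a * fst d + b * snd d))
             (at (q + t * d1, p + t * d2))"
    using assms at_within_strip_interior[of "(q + t * d1, p + t * d2)"] by simp
  have 2: "((\<lambda>t. (q + t * d1, p + t * d2)) has_derivative (\<lambda>s. (s * d1, s * d2))) (at t)"
    by (auto intro!: derivative_eq_intros)
  show ?thesis
    unfolding has_field_derivative_def
    using has_derivative_compose[OF 2 1] by (auto simp: algebra_simps elim!: has_derivative_eq_rhs)
qed

lemma strip_derivative_q:
  fixes f :: "real \<Rightarrow> real \<Rightarrow> real"
  assumes "((\<lambda>y. f (fst y) (snd y)) has_derivative (\<lambda>d. a * fst d + b * snd d))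
             (at (q, p) within strip)"
    and "-1 \<le> p" "p \<le> 0"
  shows "((\<lambda>t. f t p) has_real_derivative a) (at q)"
proof -
  have 2: "((\<lambda>t. (t, p)) has_derivative (\<lambda>s. (s, 0))) (at q)"
    by (auto intro!: derivative_eq_intros)
  have "(\<lambda>t. (t, p)) ` UNIV \<subseteq> strip" using assms by (auto simp: strip_def)
  then have 1: "((\<lambda>y. f (fst y) (snd y)) has_derivative (\<lambda>d. a * fst d + b * snd d))
             (at (q, p) within (\<lambda>t. (t, p)) ` UNIV)"
    using assms(1) has_derivative_subset by blast
  show ?thesis
    unfolding has_field_derivative_def
    using has_derivative_in_compose[OF 2 1] by (auto elim!: has_derivative_eq_rhs)
qed

lemma strip_derivative_p:
  fixes f :: "real \<Rightarrow> real \<Rightarrow> real"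
  assumes "((\<lambda>y. f (fst y) (snd y)) has_derivative (\<lambda>d. a * fst d + b * snd d))
             (at (q, p) within strip)"
  shows "((\<lambda>t. f q t) has_real_derivative b) (at p within {-1..0})"
proof -
  have 2: "((\<lambda>t. (q, t)) has_derivative (\<lambda>s. (0, s))) (at p within {-1..0})"
    by (auto intro!: derivative_eq_intros)
  have "(\<lambda>t. (q, t)) ` {-1..0} \<subseteq> strip" by (auto simp: strip_def)
  then have 1: "((\<lambda>y. f (fst y) (snd y)) has_derivative (\<lambda>d. a * fst d + b * snd d))
             (at (q, p) within (\<lambda>t. (q, t)) ` {-1..0})"
    using assms(1) has_derivative_subset by blast
  show ?thesis
    unfolding has_field_derivative_def
    using has_derivative_in_compose[OF 2 1] by (auto elim!: has_derivative_eq_rhs)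
qed

lemma jet2_partials:
  assumes "jet2 f fq fp fqq fqp fpq fpp" "-1 \<le> p" "p \<le> 0"
  shows "((\<lambda>t. f t p) has_real_derivative fq q p) (at q)"
    "((\<lambda>t. fq t p) has_real_derivative fqq q p) (at q)"
    "((\<lambda>t. fp t p) has_real_derivative fpq q p) (at q)"
    "((\<lambda>t. f q t) has_real_derivative fp q p) (at p within {-1..0})"
    "((\<lambda>t. fq q t) has_real_derivative fqp q p) (at p within {-1..0})"
    "((\<lambda>t. fp q t) has_real_derivative fpp q p) (at p within {-1..0})"
proof -
  have z: "(q, p) \<in> strip" using assms by (simp add: strip_def)
  note d = assms(1)[unfolded jet2_def, rule_format, OF z, simplified]
  show "((\<lambda>t. f t p) has_real_derivative fq q p) (at q)"
    "((\<lambda>t. fq t p) has_real_derivative fqq q p) (at q)"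
    "((\<lambda>t. fp t p) has_real_derivative fpq q p) (at q)"
    "((\<lambda>t. f q t) has_real_derivative fp q p) (at p within {-1..0})"
    "((\<lambda>t. fq q t) has_real_derivative fqp q p) (at p within {-1..0})"
    "((\<lambda>t. fp q t) has_real_derivative fpp q p) (at p within {-1..0})"
    using d assms strip_derivative_q strip_derivative_p by blast+
qed

text \<open>Restriction to the segment through \<open>(q, p)\<close> with direction
  \<open>(d1, d2)\<close> reduces this to one variable. The last conclusion tests the Hessian in one
  direction; two suitable directions will recover the elliptic operator.\<close>

lemma jet2_min_interior:
  assumes j: "jet2 f fq fp fqq fqp fpq fpp" and p: "-1 < p" "p < 0" and "e > 0"
    and min: "\<And>q' p'. \<bar>q' - q\<bar> < e \<Longrightarrow> \<bar>p' - p\<bar> < e \<Longrightarrow> -1 \<le> p' \<Longrightarrow> p' \<le> 0 \<Longrightarrow> f q p \<le> f q' p'"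
  shows "fq q p = 0" "fp q p = 0"
    "fqq q p * d1\<^sup>2 + (fqp q p + fpq q p) * d1 * d2 + fpp q p * d2\<^sup>2 \<ge> 0"
proof -
  have main: "fq q p * d1 + fp q p * d2 = 0 \<and>
      fqq q p * d1\<^sup>2 + (fqp q p + fpq q p) * d1 * d2 + fpp q p * d2\<^sup>2 \<ge> 0" for d1 d2
  proof -
    \<comment> \<open>Small enough that the segment stays in the box where minimality holds and in
      the open strip; the \<open>+ 1\<close> covers the zero direction.\<close>
    define s where "s = min e (min (p + 1) (- p)) / (\<bar>d1\<bar> + \<bar>d2\<bar> + 1)"
    have "s > 0" using p \<open>e > 0\<close> by (simp add: s_def)
    have small: "\<bar>t * d1\<bar> < e \<and> \<bar>t * d2\<bar> < e \<and> -1 < p + t * d2 \<and> p + t * d2 < 0" if "\<bar>t\<bar> < s" for t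
    proof -
      have "\<bar>t\<bar> * (\<bar>d1\<bar> + \<bar>d2\<bar> + 1) < min e (min (p + 1) (- p))"
        using that by (simp add: s_def pos_less_divide_eq)
      moreover have "\<bar>t * d1\<bar> \<le> \<bar>t\<bar> * (\<bar>d1\<bar> + \<bar>d2\<bar> + 1)" "\<bar>t * d2\<bar> \<le> \<bar>t\<bar> * (\<bar>d1\<bar> + \<bar>d2\<bar> + 1)"
        by (auto simp: abs_mult mult_left_mono)
      ultimately show ?thesis by (simp only: min_less_iff_conj) (simp add: abs_less_iff; linarith)
    qed
    have line: "((\<lambda>t. f (q + t * d1) (p + t * d2)) has_real_derivative
        fq (q + t * d1) (p + t * d2) * d1 + fp (q + t * d1) (p + t * d2) * d2) (at t)"
      if "\<bar>t\<bar> < s" for t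
    proof -
      have "(q + t * d1, p + t * d2) \<in> strip" using small[OF that] by (simp add: strip_def)
      then show ?thesis
        using j small[OF that] by (intro strip_derivative_line) (auto simp: jet2_def)
    qed
    have "(q, p) \<in> strip" using p by (simp add: strip_def)
    then have dq: "((\<lambda>t. fq (q + t * d1) (p + t * d2)) has_real_derivative
        fqq q p * d1 + fqp q p * d2) (at 0)"
      and dp: "((\<lambda>t. fp (q + t * d1) (p + t * d2)) has_real_derivative
        fpq q p * d1 + fpp q p * d2) (at 0)"
      using j p by (auto intro!: strip_derivative_line simp: jet2_def)
    have "((\<lambda>t. fq (q + t * d1) (p + t * d2) * d1 + fp (q + t * d1) (p + t * d2) * d2)
        has_real_derivative (fqq q p * d1 + fqp q p * d2) * d1 + (fpq q p * d1 + fpp q p * d2) * d2)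
        (at 0)"
      by (intro derivative_intros DERIV_add DERIV_cmult_right dq dp)
    note m = local_min_second_derivative[OF \<open>s > 0\<close> line this]
    have "f (q + 0 * d1) (p + 0 * d2) \<le> f (q + t * d1) (p + t * d2)" if "\<bar>t\<bar> < s" for t
      using min small[OF that] by simp
    from m[OF _ this] show ?thesis by (auto simp: algebra_simps power2_eq_square)
  qed
  from main[of 1 0] show "fq q p = 0" by simp
  from main[of 0 1] show "fp q p = 0" by simp
  from main show "fqq q p * d1\<^sup>2 + (fqp q p + fpq q p) * d1 * d2 + fpp q p * d2\<^sup>2 \<ge> 0" by blast
qed

text \<open>At the surface only points below are available, so stationarity survives in
  \<open>q\<close>, while in \<open>p\<close> just a sign remains.\<close>

lemma jet2_min_top:
  assumes j: "jet2 f fq fp fqq fqp fpq fpp" and "e > 0"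
    and min: "\<And>q' p'. \<bar>q' - q\<bar> < e \<Longrightarrow> \<bar>p'\<bar> < e \<Longrightarrow> -1 \<le> p' \<Longrightarrow> p' \<le> 0 \<Longrightarrow> f q 0 \<le> f q' p'"
  shows "fq q 0 = 0" "fp q 0 \<le> 0"
proof -
  note d = jet2_partials[OF j, of 0 q]
  show "fq q 0 = 0"
    using DERIV_local_min[of "\<lambda>t. f t 0" "fq q 0" q e] d(1) min \<open>e > 0\<close> by auto
  show "fp q 0 \<le> 0"
  proof (rule ccontr)
    assume "\<not> fp q 0 \<le> 0"
    then obtain d where dd: "d > 0"
      "\<And>h. h > 0 \<Longrightarrow> 0 - h \<in> {-1..0} \<Longrightarrow> h < d \<Longrightarrow> f q (0 - h) < f q 0"
      using has_real_derivative_pos_inc_left[of "\<lambda>t. f q t" "fp q 0" 0 "{-1..0}"] d(4) by auto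
    define h where "h = min (min d e) 1 / 2"
    have "h > 0" "h < d" "h < e" "h \<le> 1" using dd(1) \<open>e > 0\<close> by (auto simp: h_def)
    then show False using dd(2)[of h] min[of q "-h"] \<open>e > 0\<close> by auto
  qed
qed

section \<open>Touching solutions from below\<close>

text \<open>\<open>\<mu>\<close> stands for \<open>1 / F^2\<close>; of \<rho> only the surface value
  \<open>\<rho>0\<close> and the derivative \<open>\<rho>p\<close> enter. One constant
  \<open>M\<close> bounds the coefficients and, in \<open>hsol\<close>, all derivatives, and
  \<open>c\<close> bounds \<open>Hp + wp\<close> from below, so that estimates need not refer to a
  particular pair of solutions.\<close>

locale height_problem =
  fixes Hp Hpp \<rho>p :: "real \<Rightarrow> real" and \<rho>0 \<mu> M c :: real
  assumes Hp_deriv: "x \<in> {-1..0} \<Longrightarrow> (Hp has_real_derivative Hpp x) (at x within {-1..0})"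
    and Hpp_cont: "continuous_on {-1..0} Hpp"
    and \<rho>p_cont: "continuous_on {-1..0} \<rho>p"
    and Hp_pos: "x \<in> {-1..0} \<Longrightarrow> Hp x > 0"
    and \<rho>p_le: "x \<in> {-1..0} \<Longrightarrow> \<rho>p x \<le> 0"
    and \<rho>0_pos: "\<rho>0 > 0"
    and \<mu>_pos: "\<mu> > 0"
    and c_pos: "c > 0"
    and M_ge: "M \<ge> 1"
    and Hpp_bound: "x \<in> {-1..0} \<Longrightarrow> \<bar>Hpp x\<bar> \<le> M"
    and ratio_bound: "x \<in> {-1..0} \<Longrightarrow> \<bar>Hpp x / Hp x ^ 3\<bar> \<le> M"
    and \<rho>p_bound: "x \<in> {-1..0} \<Longrightarrow> \<bar>\<mu> * \<rho>p x\<bar> \<le> M"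
begin

text \<open>The height equation with all derivatives carried out and multiplied by
  \<open>(Hp + wp) ^ 3\<close>. The bounds belong to the predicate so that reflected and translated
  copies of a wave satisfy it with the same \<open>M\<close> and \<open>c\<close>.\<close>

definition hsol ::
  "(real \<Rightarrow> real \<Rightarrow> real) \<Rightarrow> (real \<Rightarrow> real \<Rightarrow> real) \<Rightarrow> (real \<Rightarrow> real \<Rightarrow> real) \<Rightarrow>
   (real \<Rightarrow> real \<Rightarrow> real) \<Rightarrow> (real \<Rightarrow> real \<Rightarrow> real) \<Rightarrow> (real \<Rightarrow> real \<Rightarrow> real) \<Rightarrow>
   (real \<Rightarrow> real \<Rightarrow> real) \<Rightarrow> bool" where
  "hsol w wq wp wqq wqp wpq wpp \<longleftrightarrow>
     C2_strip w wq wp wqq wqp wpq wpp \<and>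
     (\<forall>q p. -1 \<le> p \<and> p \<le> 0 \<longrightarrow>
        \<bar>w q p\<bar> \<le> M \<and> \<bar>wq q p\<bar> \<le> M \<and> \<bar>wp q p\<bar> \<le> M \<and>
        \<bar>wqq q p\<bar> \<le> M \<and> \<bar>wqp q p\<bar> \<le> M \<and> \<bar>wpq q p\<bar> \<le> M \<and> \<bar>wpp q p\<bar> \<le> M \<and>
        c \<le> Hp p + wp q p \<and> Hp p + wp q p \<le> M) \<and>
     (\<forall>q p. -1 < p \<and> p < 0 \<longrightarrow>
        (Hp p + wp q p)\<^sup>2 * wqq q p - (Hp p + wp q p) * wq q p * (wqp q p + wpq q p)
        + (1 + (wq q p)\<^sup>2) * (Hpp p + wpp q p)
        - (Hp p + wp q p) ^ 3 * (Hpp p / Hp p ^ 3 + \<mu> * \<rho>p p * w q p) = 0) \<and>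
     (\<forall>q. (1 + (wq q 0)\<^sup>2) / (2 * (Hp 0 + wp q 0)\<^sup>2) - 1 / (2 * (Hp 0)\<^sup>2) + \<mu> * \<rho>0 * w q 0 = 0) \<and>
     (\<forall>q. w q (-1) = 0)"

lemma hsol_jet2: "hsol w wq wp wqq wqp wpq wpp \<Longrightarrow> jet2 w wq wp wqq wqp wpq wpp"
  by (simp add: hsol_def C2_strip_jet2)

lemma hsol_bounds:
  assumes "hsol w wq wp wqq wqp wpq wpp" "-1 \<le> p" "p \<le> 0"
  shows "\<bar>w q p\<bar> \<le> M" "\<bar>wq q p\<bar> \<le> M" "\<bar>wp q p\<bar> \<le> M" "\<bar>wqq q p\<bar> \<le> M" "\<bar>wqp q p\<bar> \<le> M"
    "\<bar>wpq q p\<bar> \<le> M" "\<bar>wpp q p\<bar> \<le> M" "c \<le> Hp p + wp q p" "Hp p + wp q p \<le> M"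
  using assms by (auto simp: hsol_def)

lemma hsol_cont:
  assumes "hsol w wq wp wqq wqp wpq wpp"
  shows "continuous_on strip (\<lambda>y. w (fst y) (snd y))" "continuous_on strip (\<lambda>y. wq (fst y) (snd y))"
    "continuous_on strip (\<lambda>y. wp (fst y) (snd y))" "continuous_on strip (\<lambda>y. wqq (fst y) (snd y))"
    "continuous_on strip (\<lambda>y. wqp (fst y) (snd y))" "continuous_on strip (\<lambda>y. wpq (fst y) (snd y))"
    "continuous_on strip (\<lambda>y. wpp (fst y) (snd y))"
  using assms by (auto simp: hsol_def C2_strip_def)

text \<open>The difference of the equations for two solutions with the second derivatives of the
  first one replaced by \<open>T\<close>; the quadratic part carries the coefficients of the first solution,
  all remaining second derivatives are those of the second one.\<close>

definition defect :: "real \<Rightarrow> real \<Rightarrow> real \<Rightarrow> real \<Rightarrow> real \<Rightarrow> real \<Rightarrow> real \<Rightarrow> real \<Rightarrow>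
    real \<Rightarrow> real \<Rightarrow> real \<Rightarrow> real \<Rightarrow> real \<Rightarrow> real" where
  "defect p x1 y1 x2 y2 Tqq Tqp Tpp A B C u1 u2 =
     x1\<^sup>2 * Tqq - x1 * y1 * Tqp + (1 + y1\<^sup>2) * Tpp
     + (x1\<^sup>2 - x2\<^sup>2) * A - (x1 * y1 - x2 * y2) * B + (y1\<^sup>2 - y2\<^sup>2) * (Hpp p + C)
     - (x1 ^ 3 - x2 ^ 3) * (Hpp p / Hp p ^ 3) - \<mu> * \<rho>p p * (x1 ^ 3 * u1 - x2 ^ 3 * u2)"

text \<open>The second-order part is a sum of two squares of directions: the Hessian form at
  \<open>(x1, - y1)\<close> plus that at \<open>(0, 1)\<close>, both nonnegative at a minimum.
  \<open>defect\<close> plus these two values is exactly the difference of the two equations, hence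
  zero.\<close>

lemma touch_interior:
  assumes s1: "hsol w1 w1q w1p w1qq w1qp w1pq w1pp"
    and s2: "hsol w2 w2q w2p w2qq w2qp w2pq w2pp"
    and j: "jet2 \<theta> \<theta>q \<theta>p \<theta>qq \<theta>qp \<theta>pq \<theta>pp"
    and p: "-1 < p" "p < 0" and e: "e > 0"
    and min: "\<And>q' p'. \<bar>q' - q\<bar> < e \<Longrightarrow> \<bar>p' - p\<bar> < e \<Longrightarrow> -1 \<le> p' \<Longrightarrow> p' \<le> 0 \<Longrightarrow>
        w1 q p - w2 q p - \<theta> q p \<le> w1 q' p' - w2 q' p' - \<theta> q' p'"
  shows "w1q q p = w2q q p + \<theta>q q p" "w1p q p = w2p q p + \<theta>p q p"
    "defect p (Hp p + w1p q p) (w1q q p) (Hp p + w2p q p) (w2q q p)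
       (\<theta>qq q p) (\<theta>qp q p + \<theta>pq q p) (\<theta>pp q p)
       (w2qq q p) (w2qp q p + w2pq q p) (w2pp q p) (w1 q p) (w2 q p) \<le> 0"
proof -
  note J = jet2_diff[OF jet2_diff[OF hsol_jet2[OF s1] hsol_jet2[OF s2]] j]
  note m = jet2_min_interior[OF J p e min]
  show "w1q q p = w2q q p + \<theta>q q p" "w1p q p = w2p q p + \<theta>p q p"
    using m(1,2) by auto
  define x1 y1 x2 y2 where "x1 = Hp p + w1p q p" and "y1 = w1q q p"
    and "x2 = Hp p + w2p q p" and "y2 = w2q q p"
  have e1: "x1\<^sup>2 * w1qq q p - x1 * y1 * (w1qp q p + w1pq q p) + (1 + y1\<^sup>2) * (Hpp p + w1pp q p)
        - x1 ^ 3 * (Hpp p / Hp p ^ 3 + \<mu> * \<rho>p p * w1 q p) = 0"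
    using s1 p by (simp add: hsol_def x1_def y1_def)
  have e2: "x2\<^sup>2 * w2qq q p - x2 * y2 * (w2qp q p + w2pq q p) + (1 + y2\<^sup>2) * (Hpp p + w2pp q p)
        - x2 ^ 3 * (Hpp p / Hp p ^ 3 + \<mu> * \<rho>p p * w2 q p) = 0"
    using s2 p by (simp add: hsol_def x2_def y2_def)
  note Q = m(3)[where ?d1.0 = x1 and ?d2.0 = "- y1"] m(3)[where ?d1.0 = 0 and ?d2.0 = 1]
  have "defect p x1 y1 x2 y2 (\<theta>qq q p) (\<theta>qp q p + \<theta>pq q p) (\<theta>pp q p)
       (w2qq q p) (w2qp q p + w2pq q p) (w2pp q p) (w1 q p) (w2 q p)
     + (((w1qq q p - w2qq q p - \<theta>qq q p) * x1\<^sup>2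
          + (w1qp q p - w2qp q p - \<theta>qp q p + (w1pq q p - w2pq q p - \<theta>pq q p)) * x1 * (- y1)
          + (w1pp q p - w2pp q p - \<theta>pp q p) * (- y1)\<^sup>2) + (w1pp q p - w2pp q p - \<theta>pp q p))
     = (x1\<^sup>2 * w1qq q p - x1 * y1 * (w1qp q p + w1pq q p) + (1 + y1\<^sup>2) * (Hpp p + w1pp q p)
        - x1 ^ 3 * (Hpp p / Hp p ^ 3 + \<mu> * \<rho>p p * w1 q p))
     - (x2\<^sup>2 * w2qq q p - x2 * y2 * (w2qp q p + w2pq q p) + (1 + y2\<^sup>2) * (Hpp p + w2pp q p)
        - x2 ^ 3 * (Hpp p / Hp p ^ 3 + \<mu> * \<rho>p p * w2 q p))"
    unfolding defect_def by algebra
  then have "defect p x1 y1 x2 y2 (\<theta>qq q p) (\<theta>qp q p + \<theta>pq q p) (\<theta>pp q p)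
       (w2qq q p) (w2qp q p + w2pq q p) (w2pp q p) (w1 q p) (w2 q p) \<le> 0"
    using e1 e2 Q(1) Q(2)[simplified] by linarith
  then show "defect p (Hp p + w1p q p) (w1q q p) (Hp p + w2p q p) (w2q q p)
       (\<theta>qq q p) (\<theta>qp q p + \<theta>pq q p) (\<theta>pp q p)
       (w2qq q p) (w2qp q p + w2pq q p) (w2pp q p) (w1 q p) (w2 q p) \<le> 0"
    by (simp only: x1_def y1_def x2_def y2_def)
qed

text \<open>The minimum gives only \<open>w1p \<le> w2p + \<theta>p\<close>, but the surface
  expression decreases in \<open>h_p\<close>, so \<open>w1p\<close> can be replaced in the
  favourable direction. The bound by \<open>c\<close> keeps the new denominator away from
  zero.\<close>

lemma touch_top:
  assumes s1: "hsol w1 w1q w1p w1qq w1qp w1pq w1pp"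
    and s2: "hsol w2 w2q w2p w2qq w2qp w2pq w2pp"
    and j: "jet2 \<theta> \<theta>q \<theta>p \<theta>qq \<theta>qp \<theta>pq \<theta>pp"
    and e: "e > 0"
    and min: "\<And>q' p'. \<bar>q' - q\<bar> < e \<Longrightarrow> \<bar>p'\<bar> < e \<Longrightarrow> -1 \<le> p' \<Longrightarrow> p' \<le> 0 \<Longrightarrow>
        w1 q 0 - w2 q 0 - \<theta> q 0 \<le> w1 q' p' - w2 q' p' - \<theta> q' p'"
  shows "w1q q 0 = w2q q 0 + \<theta>q q 0" "c \<le> Hp 0 + w2p q 0 + \<theta>p q 0"
    "(1 + (w1q q 0)\<^sup>2) / (2 * (Hp 0 + w2p q 0 + \<theta>p q 0)\<^sup>2) - (1 + (w2q q 0)\<^sup>2) / (2 * (Hp 0 + w2p q 0)\<^sup>2)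
       + \<mu> * \<rho>0 * (w1 q 0 - w2 q 0) \<le> 0"
proof -
  note J = jet2_diff[OF jet2_diff[OF hsol_jet2[OF s1] hsol_jet2[OF s2]] j]
  note m = jet2_min_top[OF J e min]
  show "w1q q 0 = w2q q 0 + \<theta>q q 0" using m(1) by auto
  have b: "c \<le> Hp 0 + w1p q 0" using hsol_bounds(8)[OF s1, of 0 q] by simp
  then show "c \<le> Hp 0 + w2p q 0 + \<theta>p q 0" using m(2) by auto
  have "(1 + (w1q q 0)\<^sup>2) / (2 * (Hp 0 + w2p q 0 + \<theta>p q 0)\<^sup>2) \<le> (1 + (w1q q 0)\<^sup>2) / (2 * (Hp 0 + w1p q 0)\<^sup>2)"
    using m(2) b c_pos by (intro divide_left_mono mult_left_mono power_mono mult_pos_pos) auto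
  moreover have "(1 + (w1q q 0)\<^sup>2) / (2 * (Hp 0 + w1p q 0)\<^sup>2) - 1 / (2 * (Hp 0)\<^sup>2) + \<mu> * \<rho>0 * w1 q 0 = 0"
    "(1 + (w2q q 0)\<^sup>2) / (2 * (Hp 0 + w2p q 0)\<^sup>2) - 1 / (2 * (Hp 0)\<^sup>2) + \<mu> * \<rho>0 * w2 q 0 = 0"
    using s1 s2 by (auto simp: hsol_def)
  ultimately show "(1 + (w1q q 0)\<^sup>2) / (2 * (Hp 0 + w2p q 0 + \<theta>p q 0)\<^sup>2) - (1 + (w2q q 0)\<^sup>2) / (2 * (Hp 0 + w2p q 0)\<^sup>2)
       + \<mu> * \<rho>0 * (w1 q 0 - w2 q 0) \<le> 0"
    by (simp add: algebra_simps)
qed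

text \<open>If \<theta> does not increase towards the surface, its normal derivative contributes a
  definite positive amount and its tangential derivative an error. The factor
  \<open>1 / (2 * M ^ 3)\<close> comes from \<open>x \<le> X \<le> M\<close>, the factor
  \<open>M / c\<^sup>2\<close> from \<open>|y + Y| \<le> 2 * M\<close> and
  \<open>x \<ge> c\<close>.\<close>

lemma touch_top_sign:
  assumes s1: "hsol w1 w1q w1p w1qq w1qp w1pq w1pp"
    and s2: "hsol w2 w2q w2p w2qq w2qp w2pq w2pp"
    and j: "jet2 \<theta> \<theta>q \<theta>p \<theta>qq \<theta>qp \<theta>pq \<theta>pp"
    and e: "e > 0"
    and min: "\<And>q' p'. \<bar>q' - q\<bar> < e \<Longrightarrow> \<bar>p'\<bar> < e \<Longrightarrow> -1 \<le> p' \<Longrightarrow> p' \<le> 0 \<Longrightarrow>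
        w1 q 0 - w2 q 0 - \<theta> q 0 \<le> w1 q' p' - w2 q' p' - \<theta> q' p'"
    and neg: "\<theta>p q 0 \<le> 0"
  shows "- \<theta>p q 0 / (2 * M ^ 3) - \<bar>\<theta>q q 0\<bar> * (M / c\<^sup>2) + \<mu> * \<rho>0 * (w1 q 0 - w2 q 0) \<le> 0"
proof -
  note t = touch_top[OF s1 s2 j e min]
  define X Y x y where "X = Hp 0 + w2p q 0" and "Y = w2q q 0" and "x = X + \<theta>p q 0" and "y = w1q q 0"
  have b: "c \<le> X" "X \<le> M" "\<bar>Y\<bar> \<le> M" "\<bar>y\<bar> \<le> M"
    using hsol_bounds(2,8,9)[OF s2, of 0 q] hsol_bounds(2)[OF s1, of 0 q] by (simp_all add: X_def Y_def y_def)
  have x: "c \<le> x" "x \<le> X" "y = Y + \<theta>q q 0" using t neg by (auto simp: x_def X_def y_def Y_def)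
  have I: "(1 + y\<^sup>2) / (2 * x\<^sup>2) - (1 + Y\<^sup>2) / (2 * X\<^sup>2) + \<mu> * \<rho>0 * (w1 q 0 - w2 q 0) \<le> 0"
    using t(3) by (simp add: x_def X_def y_def Y_def)
  have pos: "x > 0" "X > 0" using x b c_pos by auto
  have split: "(1 + y\<^sup>2) / (2 * x\<^sup>2) - (1 + Y\<^sup>2) / (2 * X\<^sup>2)
      = (y - Y) * (y + Y) / (2 * x\<^sup>2) + (X - x) * ((1 + Y\<^sup>2) * (X + x) / (2 * x\<^sup>2 * X\<^sup>2))"
    using pos by (simp add: field_simps power2_eq_square)
  have "\<bar>(y - Y) * (y + Y) / (2 * x\<^sup>2)\<bar> = \<bar>\<theta>q q 0\<bar> * (\<bar>y + Y\<bar> / (2 * x\<^sup>2))"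
    using x pos by (simp add: abs_mult)
  also have "\<dots> \<le> \<bar>\<theta>q q 0\<bar> * (2 * M / (2 * c\<^sup>2))"
    using b x c_pos M_ge by (intro mult_left_mono frac_le power_mono mult_pos_pos) auto
  finally have 1: "\<bar>(y - Y) * (y + Y) / (2 * x\<^sup>2)\<bar> \<le> \<bar>\<theta>q q 0\<bar> * (M / c\<^sup>2)" by simp
  have "1 / (2 * M ^ 3) \<le> 1 / (2 * X ^ 3)"
    using b pos by (intro frac_le mult_left_mono power_mono) auto
  also have "\<dots> = 1 * X / (2 * X\<^sup>2 * X\<^sup>2)"
    using pos by (simp add: field_simps power2_eq_square power3_eq_cube)
  also have "\<dots> \<le> (1 + Y\<^sup>2) * (X + x) / (2 * x\<^sup>2 * X\<^sup>2)"
    using pos x by (intro frac_le mult_mono mult_pos_pos power_mono) auto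
  finally have "(X - x) * (1 / (2 * M ^ 3)) \<le> (X - x) * ((1 + Y\<^sup>2) * (X + x) / (2 * x\<^sup>2 * X\<^sup>2))"
    using x by (intro mult_left_mono) auto
  then have 2: "- \<theta>p q 0 / (2 * M ^ 3) \<le> (X - x) * ((1 + Y\<^sup>2) * (X + x) / (2 * x\<^sup>2 * X\<^sup>2))"
    by (simp add: x_def)
  show ?thesis using I split 1 2 by linarith
qed

text \<open>The 10 is the total weight of \<open>|x1 - x2|\<close>: 2 and 2 from the terms with
  \<open>A\<close> and \<open>B\<close>, 3 from the term with \<open>Hpp / Hp ^ 3\<close>, 3 from
  the density term; the other two groups need less. Only the negative part of \<open>u1 - u2\<close>
  is charged, since \<open>- \<mu> * \<rho>p p\<close> is nonnegative.\<close>

lemma defect_lower: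
  assumes p: "p \<in> {-1..0}"
    and b: "0 \<le> x1" "x1 \<le> M" "0 \<le> x2" "x2 \<le> M" "\<bar>y1\<bar> \<le> M" "\<bar>y2\<bar> \<le> M"
      "\<bar>A\<bar> \<le> M" "\<bar>B\<bar> \<le> 2 * M" "\<bar>C\<bar> \<le> M" "\<bar>u2\<bar> \<le> M"
  shows "x1\<^sup>2 * Tqq - x1 * y1 * Tqp + (1 + y1\<^sup>2) * Tpp
      - 10 * M ^ 4 * (\<bar>x1 - x2\<bar> + \<bar>y1 - y2\<bar> + max 0 (u2 - u1))
      \<le> defect p x1 y1 x2 y2 Tqq Tqp Tpp A B C u1 u2"
proof -
  define dx dy where "dx = \<bar>x1 - x2\<bar>" and "dy = \<bar>y1 - y2\<bar>"
  have dx0: "dx \<ge> 0" "dy \<ge> 0" by (auto simp: dx_def dy_def)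
  have M0: "M \<ge> 0" using M_ge by simp
  have pw: "M\<^sup>2 \<le> M ^ 4" "M ^ 3 \<le> M ^ 4" using M_ge by (auto intro: power_increasing)
  have a1: "\<bar>(x1\<^sup>2 - x2\<^sup>2) * A\<bar> \<le> 2 * M ^ 4 * dx"
  proof -
    have "\<bar>(x1\<^sup>2 - x2\<^sup>2) * A\<bar> = dx * (\<bar>x1 + x2\<bar> * \<bar>A\<bar>)"
      by (simp add: dx_def power2_eq_square square_diff_square_factored abs_mult mult_ac)
    also have "\<dots> \<le> dx * ((2 * M) * M)"
      using b dx0 M0 by (intro mult_left_mono mult_mono) auto
    also have "\<dots> \<le> dx * (2 * M ^ 4)"
      using pw dx0 by (intro mult_left_mono) (auto simp: power2_eq_square)
    finally show ?thesis by (simp add: mult_ac)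
  qed
  have a2: "\<bar>(x1 * y1 - x2 * y2) * B\<bar> \<le> 2 * M ^ 4 * (dx + dy)"
  proof -
    have "x1 * y1 - x2 * y2 = (x1 - x2) * y1 + x2 * (y1 - y2)" by (simp add: algebra_simps)
    then have "\<bar>x1 * y1 - x2 * y2\<bar> \<le> dx * \<bar>y1\<bar> + \<bar>x2\<bar> * dy"
      unfolding dx_def dy_def abs_mult[symmetric] by (metis abs_triangle_ineq)
    also have "\<dots> \<le> dx * M + M * dy"
      using b dx0 by (intro add_mono mult_left_mono mult_right_mono) auto
    finally have "\<bar>x1 * y1 - x2 * y2\<bar> * \<bar>B\<bar> \<le> (dx * M + M * dy) * (2 * M)"
      using b dx0 M0 by (intro mult_mono) auto
    also have "\<dots> = 2 * (dx + dy) * M\<^sup>2" by (simp add: algebra_simps power2_eq_square)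
    also have "\<dots> \<le> 2 * (dx + dy) * M ^ 4" using pw dx0 by (intro mult_left_mono) auto
    finally show ?thesis unfolding abs_mult[of _ B] by (simp add: algebra_simps)
  qed
  have a3: "\<bar>(y1\<^sup>2 - y2\<^sup>2) * (Hpp p + C)\<bar> \<le> 4 * M ^ 4 * dy"
  proof -
    have "\<bar>(y1\<^sup>2 - y2\<^sup>2) * (Hpp p + C)\<bar> = dy * (\<bar>y1 + y2\<bar> * \<bar>Hpp p + C\<bar>)"
      by (simp add: dy_def power2_eq_square square_diff_square_factored abs_mult mult_ac)
    also have "\<dots> \<le> dy * ((2 * M) * (2 * M))"
      using b dx0 M0 Hpp_bound[OF p] by (intro mult_left_mono mult_mono) auto
    also have "\<dots> \<le> dy * (4 * M ^ 4)"
      using pw dx0 by (intro mult_left_mono) (auto simp: power2_eq_square)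
    finally show ?thesis by (simp add: mult_ac)
  qed
  have cube: "\<bar>x1 ^ 3 - x2 ^ 3\<bar> \<le> 3 * M\<^sup>2 * dx"
  proof -
    have "x1 ^ 3 - x2 ^ 3 = (x1 - x2) * (x1 * x1 + x1 * x2 + x2 * x2)"
      by (simp add: algebra_simps power3_eq_cube)
    then have "\<bar>x1 ^ 3 - x2 ^ 3\<bar> = dx * (x1 * x1 + x1 * x2 + x2 * x2)"
      using b by (simp add: dx_def abs_mult)
    also have "\<dots> \<le> dx * (M * M + M * M + M * M)"
      using b dx0 M0 by (intro mult_left_mono add_mono mult_mono) auto
    finally show ?thesis by (simp add: power2_eq_square mult_ac)
  qed
  have a4: "\<bar>(x1 ^ 3 - x2 ^ 3) * (Hpp p / Hp p ^ 3)\<bar> \<le> 3 * M ^ 4 * dx"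
  proof -
    have "\<bar>(x1 ^ 3 - x2 ^ 3) * (Hpp p / Hp p ^ 3)\<bar> \<le> (3 * M\<^sup>2 * dx) * M"
      unfolding abs_mult[of "x1 ^ 3 - x2 ^ 3"] using cube ratio_bound[OF p] M0 dx0
      by (intro mult_mono) auto
    also have "\<dots> = 3 * dx * M ^ 3" by (simp add: power2_eq_square power3_eq_cube)
    also have "\<dots> \<le> 3 * dx * M ^ 4" using pw dx0 by (intro mult_left_mono) auto
    finally show ?thesis by (simp add: mult_ac)
  qed
  have a5: "\<bar>\<mu> * \<rho>p p * ((x1 ^ 3 - x2 ^ 3) * u2)\<bar> \<le> 3 * M ^ 4 * dx"
  proof -
    have "\<bar>\<mu> * \<rho>p p * ((x1 ^ 3 - x2 ^ 3) * u2)\<bar> \<le> M * ((3 * M\<^sup>2 * dx) * M)"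
      unfolding abs_mult[of "\<mu> * \<rho>p p"] abs_mult[of _ u2] using M0 dx0
      by (intro mult_mono cube \<rho>p_bound[OF p] b(10)) simp_all
    also have "\<dots> = 3 * M ^ 4 * dx" by (simp add: power2_eq_square power4_eq_xxxx)
    finally show ?thesis .
  qed
  have a6: "- \<mu> * \<rho>p p * (x1 ^ 3 * (u1 - u2)) \<ge> - (M ^ 4 * max 0 (u2 - u1))"
  proof (cases "u1 \<ge> u2")
    case True
    then have "\<mu> * (- \<rho>p p) * (x1 ^ 3 * (u1 - u2)) \<ge> 0"
      using \<rho>p_le[OF p] \<mu>_pos b by (intro mult_nonneg_nonneg) auto
    then show ?thesis using True by simp
  next
    case False
    have "\<bar>\<mu> * \<rho>p p * (x1 ^ 3 * (u1 - u2))\<bar> \<le> M * (M ^ 3 * \<bar>u1 - u2\<bar>)"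
      unfolding abs_mult[of "\<mu> * \<rho>p p"] abs_mult[of "x1 ^ 3"] using \<rho>p_bound[OF p] b M0
      by (intro mult_mono power_mono) (auto simp: power_mono)
    then show ?thesis using False by (auto simp: max_def power3_eq_cube power4_eq_xxxx mult_ac)
  qed
  define X Y Z where "X = M ^ 4 * dx" and "Y = M ^ 4 * dy" and "Z = M ^ 4 * max 0 (u2 - u1)"
  have nn: "Y \<ge> 0" "Z \<ge> 0" using M0 dx0 by (auto simp: Y_def Z_def)
  define t0 t1 t2 t3 t4 t5 t6 where "t0 = x1\<^sup>2 * Tqq - x1 * y1 * Tqp + (1 + y1\<^sup>2) * Tpp"
    and "t1 = (x1\<^sup>2 - x2\<^sup>2) * A" and "t2 = (x1 * y1 - x2 * y2) * B" and "t3 = (y1\<^sup>2 - y2\<^sup>2) * (Hpp p + C)"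
    and "t4 = (x1 ^ 3 - x2 ^ 3) * (Hpp p / Hp p ^ 3)" and "t5 = \<mu> * \<rho>p p * ((x1 ^ 3 - x2 ^ 3) * u2)"
    and "t6 = - \<mu> * \<rho>p p * (x1 ^ 3 * (u1 - u2))"
  have "- (2 * X) \<le> t1" "t2 \<le> 2 * X + 2 * Y" "- (4 * Y) \<le> t3" "t4 \<le> 3 * X" "t5 \<le> 3 * X" "- Z \<le> t6"
    using abs_le_D2[OF a1] abs_le_D1[OF a2] abs_le_D2[OF a3] abs_le_D1[OF a4] abs_le_D1[OF a5] a6
    unfolding t1_def t2_def t3_def t4_def t5_def t6_def X_def Y_def Z_def
    by (simp_all only: distrib_left mult.assoc)
  then have "t0 - (10 * X + 10 * Y + 10 * Z) \<le> t0 + t1 - t2 + t3 - t4 - t5 + t6"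
    using nn by linarith
  also have "t0 + t1 - t2 + t3 - t4 - t5 + t6 = defect p x1 y1 x2 y2 Tqq Tqp Tpp A B C u1 u2"
    by (simp add: defect_def t0_def t1_def t2_def t3_def t4_def t5_def t6_def algebra_simps)
  also have "10 * X + 10 * Y + 10 * Z = 10 * M ^ 4 * (dx + dy + max 0 (u2 - u1))"
    by (simp only: X_def Y_def Z_def distrib_left mult.assoc)
  finally show ?thesis unfolding t0_def dx_def dy_def .
qed

lemma hsol_defect_lower:
  assumes s1: "hsol w1 w1q w1p w1qq w1qp w1pq w1pp" and s2: "hsol w2 w2q w2p w2qq w2qp w2pq w2pp"
    and p: "-1 \<le> p" "p \<le> 0"
  shows "(Hp p + w1p q p)\<^sup>2 * Tqq - (Hp p + w1p q p) * w1q q p * Tqp + (1 + (w1q q p)\<^sup>2) * Tpp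
      - 10 * M ^ 4 * (\<bar>(Hp p + w1p q p) - (Hp p + w2p q p)\<bar> + \<bar>w1q q p - w2q q p\<bar> + max 0 (w2 q p - w1 q p))
      \<le> defect p (Hp p + w1p q p) (w1q q p) (Hp p + w2p q p) (w2q q p) Tqq Tqp Tpp
          (w2qq q p) (w2qp q p + w2pq q p) (w2pp q p) (w1 q p) (w2 q p)"
proof (rule defect_lower)
  note b1 = hsol_bounds[OF s1 p, of q] and b2 = hsol_bounds[OF s2 p, of q]
  show "p \<in> {-1..0}" using p by simp
  show "0 \<le> Hp p + w1p q p" "0 \<le> Hp p + w2p q p" using b1(8) b2(8) c_pos by linarith+
  show "\<bar>w2qp q p + w2pq q p\<bar> \<le> 2 * M" using b2(5,6) by linarith
qed (fact hsol_bounds[OF s1 p] hsol_bounds[OF s2 p])+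

text \<open>The form equals \<open>(x * a - y * b)^2 + b^2\<close>, and \<open>x \<ge> c\<close>
  then recovers \<open>a\<close> from the first square.\<close>

lemma ellipticity:
  "\<exists>\<kappa>>0. \<forall>x y a b. c \<le> x \<longrightarrow> \<bar>y\<bar> \<le> M \<longrightarrow>
     \<kappa> * (a\<^sup>2 + b\<^sup>2) \<le> x\<^sup>2 * a\<^sup>2 - x * y * (2 * (a * b)) + (1 + y\<^sup>2) * b\<^sup>2"
proof -
  define L where "L = 2 * M\<^sup>2 / c\<^sup>2 + 1 + 2 / c\<^sup>2"
  have L: "L > 0" using c_pos by (simp add: L_def add_nonneg_pos)
  have "1 / L * (a\<^sup>2 + b\<^sup>2) \<le> x\<^sup>2 * a\<^sup>2 - x * y * (2 * (a * b)) + (1 + y\<^sup>2) * b\<^sup>2"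
    if x: "c \<le> x" and y: "\<bar>y\<bar> \<le> M" for x y a b
  proof -
    define s where "s = x * a - y * b"
    have "(x * a)\<^sup>2 \<le> 2 * s\<^sup>2 + 2 * (y * b)\<^sup>2"
      using sum_squares_bound[of s "y * b"] by (simp add: s_def algebra_simps power2_eq_square)
    also have "\<dots> \<le> 2 * s\<^sup>2 + 2 * (M\<^sup>2 * b\<^sup>2)"
      unfolding power_mult_distrib using y by (intro add_mono mult_left_mono mult_right_mono) (auto simp: abs_le_square_iff[symmetric])
    finally have 1: "(x * a)\<^sup>2 \<le> 2 * s\<^sup>2 + 2 * M\<^sup>2 * b\<^sup>2" by simp
    have "c\<^sup>2 * a\<^sup>2 \<le> (x * a)\<^sup>2"
      unfolding power_mult_distrib using x c_pos by (intro mult_right_mono power_mono) auto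
    with 1 have "a\<^sup>2 \<le> (2 * s\<^sup>2 + 2 * M\<^sup>2 * b\<^sup>2) / c\<^sup>2"
      using c_pos by (simp add: pos_le_divide_eq mult.commute)
    then have "a\<^sup>2 + b\<^sup>2 \<le> 2 / c\<^sup>2 * s\<^sup>2 + (2 * M\<^sup>2 / c\<^sup>2 + 1) * b\<^sup>2"
      by (simp add: add_divide_distrib algebra_simps)
    also have "\<dots> \<le> L * s\<^sup>2 + L * b\<^sup>2"
      using c_pos by (intro add_mono mult_right_mono) (auto simp: L_def)
    finally have "1 / L * (a\<^sup>2 + b\<^sup>2) \<le> s\<^sup>2 + b\<^sup>2"
      using L by (simp add: field_simps)
    also have "\<dots> = x\<^sup>2 * a\<^sup>2 - x * y * (2 * (a * b)) + (1 + y\<^sup>2) * b\<^sup>2"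
      by (simp add: s_def algebra_simps power2_eq_square)
    finally show ?thesis .
  qed
  then show ?thesis using L by (intro exI[of _ "1 / L"]) auto
qed

end

section \<open>Barriers and the strong maximum principle\<close>

lemma strip_neighbourhood:
  fixes p q :: real
  assumes "q < L" "(q - c1)\<^sup>2 + (p - c2)\<^sup>2 < R2"
  shows "\<exists>e>0. \<forall>q' p'. \<bar>q' - q\<bar> < e \<longrightarrow> \<bar>p' - p\<bar> < e \<longrightarrow>
           (q' - c1)\<^sup>2 + (p' - c2)\<^sup>2 < R2 \<and> q' < L"
proof -
  let ?U = "{z :: real \<times> real. (fst z - c1)\<^sup>2 + (snd z - c2)\<^sup>2 < R2 \<and> fst z < L}"
  have "open ?U"
    by (intro open_Collect_conj open_Collect_less continuous_intros)
  moreover have "(q, p) \<in> ?U" using assms by simp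
  ultimately obtain e where e: "e > 0" "ball (q, p) e \<subseteq> ?U"
    by (meson open_contains_ball)
  have "(q' - c1)\<^sup>2 + (p' - c2)\<^sup>2 < R2 \<and> q' < L" if "\<bar>q' - q\<bar> < e / 2" "\<bar>p' - p\<bar> < e / 2" for q' p'
  proof -
    have "dist (q, p) (q', p') \<le> \<bar>q' - q\<bar> + \<bar>p' - p\<bar>"
      using sqrt_sum_squares_le_sum_abs[of "q' - q" "p' - p"]
      by (simp add: dist_Pair_Pair dist_real_def power2_commute abs_minus_commute)
    then have "(q', p') \<in> ball (q, p) e" using that by simp
    then show ?thesis using e(2) by auto
  qed
  then show ?thesis using e(1) by (intro exI[of _ "e / 2"]) auto
qed

section \<open>Barriers on discs that may reach over the surface\<close>

context height_problem
begin

text \<open>The permitted aperture at the surface: if the gradient of the barrier leans from the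
  vertical by at most this ratio, the tangential error in \<open>touch_top_sign\<close> uses up only
  half of the normal gain.\<close>

definition \<tau> :: real where "\<tau> = c\<^sup>2 / (4 * M ^ 4)"

lemma \<tau>_pos: "\<tau> > 0"
  using c_pos M_ge by (simp add: \<tau>_def)

text \<open>All pairs of solutions and all \<eta> are quantified inside, so \<alpha> is chosen once
  per disc. For increments of \<open>w\<close> the constants then do not depend on the
  increment.\<close>

definition barrier_bound :: "real \<Rightarrow> real \<Rightarrow> real \<Rightarrow> real \<Rightarrow> real \<Rightarrow> bool" where
  "barrier_bound c1 c2 r R \<alpha> \<longleftrightarrow>
    (\<forall>w1 w1q w1p w1qq w1qp w1pq w1pp w2 w2q w2p w2qq w2qp w2pq w2pp \<eta> q p.
      hsol w1 w1q w1p w1qq w1qp w1pq w1pp \<longrightarrow> hsol w2 w2q w2p w2qq w2qp w2pq w2pp \<longrightarrow> \<eta> > 0 \<longrightarrow>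
      (\<forall>q p. (q - c1)\<^sup>2 + (p - c2)\<^sup>2 \<le> R\<^sup>2 \<longrightarrow> p \<le> 0 \<longrightarrow> w2 q p \<le> w1 q p) \<longrightarrow>
      (\<forall>q p. (q - c1)\<^sup>2 + (p - c2)\<^sup>2 \<le> r\<^sup>2 \<longrightarrow> p \<le> 0 \<longrightarrow> w2 q p + \<eta> \<le> w1 q p) \<longrightarrow>
      (q - c1)\<^sup>2 + (p - c2)\<^sup>2 \<le> R\<^sup>2 \<longrightarrow> p \<le> 0 \<longrightarrow>
      \<eta> * (exp (- \<alpha> * ((q - c1)\<^sup>2 + (p - c2)\<^sup>2)) - exp (- \<alpha> * R\<^sup>2)) \<le> w1 q p - w2 q p)"

text \<open>The classical radial exponential, compared on a disc cut by the surface. The hypothesis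
  \<open>top\<close> says that the disc meets the surface only where
  \<open>|q - c1| \<le> \<tau> * |c2|\<close>; there the barrier decreases upwards steeply enough to
  contradict the surface condition.\<close>

lemma barrier:
  assumes r: "0 < r" "r < R" and c2: "c2 < 0" "-1 < c2 - R" and top: "R\<^sup>2 \<le> (1 + \<tau>\<^sup>2) * c2\<^sup>2"
  obtains \<alpha> where "\<alpha> > 0" "barrier_bound c1 c2 r R \<alpha>"
proof -
  obtain \<kappa> where \<kappa>: "\<kappa> > 0" "\<And>x y a b. c \<le> x \<Longrightarrow> \<bar>y\<bar> \<le> M \<Longrightarrow>
     \<kappa> * (a\<^sup>2 + b\<^sup>2) \<le> x\<^sup>2 * a\<^sup>2 - x * y * (2 * (a * b)) + (1 + y\<^sup>2) * b\<^sup>2"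
    using ellipticity by blast
  define K where "K = 10 * M ^ 4"
  have K: "K > 0" using M_ge by (simp add: K_def)
  \<comment> \<open>Chosen so that \<open>4 * \<alpha> * \<kappa> * r^2\<close> exceeds by 2 the
    number \<open>4 * M^2 + 2 + 4 * K\<close> that collects the lower-order contributions outside
    the core.\<close>
  define \<alpha> where "\<alpha> = (4 * M\<^sup>2 + 4 + 4 * K) / (4 * \<kappa> * r\<^sup>2)"
  have \<alpha>: "\<alpha> > 0" using \<kappa>(1) r K by (simp add: \<alpha>_def add_pos_pos add_nonneg_pos)
  have R: "0 < R" "R < 1" using r c2 by auto
  have inside: "-1 < p" if "(q - c1)\<^sup>2 + (p - c2)\<^sup>2 \<le> R\<^sup>2" for q p :: real
  proof -
    have "(p - c2)\<^sup>2 \<le> R\<^sup>2" using that zero_le_power2[of "q - c1"] by linarith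
    then have "\<bar>p - c2\<bar> \<le> R" using R by (simp add: abs_le_square_iff[symmetric])
    then show ?thesis using c2 by auto
  qed
  show thesis
  proof (rule that[OF \<alpha>], unfold barrier_bound_def, intro allI impI, rule ccontr)
    fix w1 w1q w1p w1qq w1qp w1pq w1pp w2 w2q w2p w2qq w2qp w2pq w2pp :: "real \<Rightarrow> real \<Rightarrow> real"
      and \<eta> q1 p1 :: real
    assume s1: "hsol w1 w1q w1p w1qq w1qp w1pq w1pp" and s2: "hsol w2 w2q w2p w2qq w2qp w2pq w2pp"
      and \<eta>: "\<eta> > 0"
      and ge: "\<forall>q p. (q - c1)\<^sup>2 + (p - c2)\<^sup>2 \<le> R\<^sup>2 \<longrightarrow> p \<le> 0 \<longrightarrow> w2 q p \<le> w1 q p"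
      and core: "\<forall>q p. (q - c1)\<^sup>2 + (p - c2)\<^sup>2 \<le> r\<^sup>2 \<longrightarrow> p \<le> 0 \<longrightarrow> w2 q p + \<eta> \<le> w1 q p"
      and z1: "(q1 - c1)\<^sup>2 + (p1 - c2)\<^sup>2 \<le> R\<^sup>2" "p1 \<le> 0"
      and neg: "\<not> \<eta> * (exp (- \<alpha> * ((q1 - c1)\<^sup>2 + (p1 - c2)\<^sup>2)) - exp (- \<alpha> * R\<^sup>2)) \<le> w1 q1 p1 - w2 q1 p1"
    define A where "A = (\<lambda>q::real. exp (- \<alpha> * (q - c1)\<^sup>2))"
    define B where "B = (\<lambda>p::real. exp (- \<alpha> * (p - c2)\<^sup>2))"
    define A' where "A' = (\<lambda>q. - 2 * \<alpha> * (q - c1) * A q)"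
    define B' where "B' = (\<lambda>p. - 2 * \<alpha> * (p - c2) * B p)"
    define A'' where "A'' = (\<lambda>q. (4 * \<alpha>\<^sup>2 * (q - c1)\<^sup>2 - 2 * \<alpha>) * A q)"
    define B'' where "B'' = (\<lambda>p. (4 * \<alpha>\<^sup>2 * (p - c2)\<^sup>2 - 2 * \<alpha>) * B p)"
    have dA: "(A has_real_derivative A' q) (at q)" for q
      unfolding A_def A'_def by (auto intro!: derivative_eq_intros simp: power2_eq_square algebra_simps)
    have dA': "(A' has_real_derivative A'' q) (at q)" for q
      unfolding A'_def by (auto intro!: derivative_eq_intros dA simp: A''_def A'_def power2_eq_square algebra_simps)
    have dB: "(B has_real_derivative B' p) (at p within S)" for p S
      unfolding B_def B'_def by (auto intro!: derivative_eq_intros simp: power2_eq_square algebra_simps)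
    have dB': "(B' has_real_derivative B'' p) (at p within S)" for p S
      unfolding B'_def by (auto intro!: derivative_eq_intros dB simp: B''_def B'_def power2_eq_square algebra_simps)
    note j = jet2_cmult[OF jet2_product[OF dA dA' dB dB'], of \<eta>]
    have AB: "A q * B p = exp (- \<alpha> * ((q - c1)\<^sup>2 + (p - c2)\<^sup>2))" for q p
      by (simp add: A_def B_def exp_add[symmetric] algebra_simps)
    let ?S = "{z. (fst z - c1)\<^sup>2 + (snd z - c2)\<^sup>2 \<le> R\<^sup>2 \<and> snd z \<le> 0}"
    let ?f = "\<lambda>q p. w1 q p - w2 q p - \<eta> * (A q * B p)"
    have Ssub: "?S \<subseteq> strip" using inside by (fastforce simp: strip_def)
    have "?S = cball (c1, c2) R \<inter> {z. snd z \<le> 0}"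
      using R by (auto simp: dist_Pair_Pair dist_real_def power2_commute real_sqrt_le_iff'
          intro: real_le_lsqrt)
    then have "compact ?S"
      by (simp add: compact_Int_closed closed_Collect_le continuous_intros)
    moreover have "(q1, p1) \<in> ?S" using z1 by simp
    moreover have "continuous_on ?S (\<lambda>z. ?f (fst z) (snd z))"
      unfolding A_def B_def
      by (intro continuous_intros continuous_on_subset[OF hsol_cont(1)[OF s1] Ssub]
          continuous_on_subset[OF hsol_cont(1)[OF s2] Ssub])
    ultimately obtain z where z: "z \<in> ?S" "\<And>y. y \<in> ?S \<Longrightarrow> ?f (fst z) (snd z) \<le> ?f (fst y) (snd y)"
      using continuous_attains_inf[of ?S "\<lambda>z. ?f (fst z) (snd z)"] by blast
    obtain q p where qp: "z = (q, p)" by (cases z)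
    have zin: "(q - c1)\<^sup>2 + (p - c2)\<^sup>2 \<le> R\<^sup>2" "p \<le> 0" using z(1) qp by auto
    have min: "?f q p \<le> ?f q' p'" if "(q' - c1)\<^sup>2 + (p' - c2)\<^sup>2 \<le> R\<^sup>2" "p' \<le> 0" for q' p'
      using z(2)[of "(q', p')"] that qp by simp
    \<comment> \<open>The barrier without its additive constant is the touching function. This
      strict bound keeps the minimum off the rim of the disc, and the margin \<eta> keeps it out of
      the core.\<close>
    have fneg: "?f q p < - (\<eta> * exp (- \<alpha> * R\<^sup>2))"
      using min[OF z1] neg by (simp add: AB algebra_simps)
    have vpos: "w2 q p \<le> w1 q p" using ge zin by blast
    define d where "d = (q - c1)\<^sup>2 + (p - c2)\<^sup>2"
    have "d < R\<^sup>2"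
    proof (rule ccontr)
      assume "\<not> d < R\<^sup>2"
      then have "d = R\<^sup>2" using zin by (simp add: d_def)
      then show False using fneg vpos by (simp add: AB d_def)
    qed
    have "r\<^sup>2 < d"
    proof (rule ccontr)
      assume "\<not> r\<^sup>2 < d"
      then have "w2 q p + \<eta> \<le> w1 q p" using core zin by (simp add: d_def)
      moreover have "exp (- \<alpha> * d) \<le> 1" using \<alpha> by (simp add: d_def)
      then have "\<eta> * (A q * B p) \<le> \<eta>" using \<eta> by (simp add: AB d_def mult_left_le)
      moreover have "\<eta> * exp (- \<alpha> * R\<^sup>2) > 0" using \<eta> by simp
      ultimately show False using fneg by linarith
    qed
    have p: "-1 < p" using inside zin by blast
    obtain e where e: "e > 0" "\<And>q' p'. \<bar>q' - q\<bar> < e \<Longrightarrow> \<bar>p' - p\<bar> < e \<Longrightarrow> (q' - c1)\<^sup>2 + (p' - c2)\<^sup>2 < R\<^sup>2"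
      using strip_neighbourhood[of q "q + 1" c1 p c2 "R\<^sup>2"] \<open>d < R\<^sup>2\<close> by (auto simp: d_def)
    define E where "E = \<eta> * (A q * B p)"
    have E: "E > 0" using \<eta> by (simp add: E_def A_def B_def)
    define a b where "a = q - c1" and "b = p - c2"
    have "a\<^sup>2 \<le> R\<^sup>2" "b\<^sup>2 \<le> R\<^sup>2" using zin(1) 
      unfolding a_def b_def using zero_le_power2[of "q - c1"] zero_le_power2[of "p - c2"] by linarith+
    then have ab: "\<bar>a\<bar> \<le> 1" "\<bar>b\<bar> \<le> 1" using R by (auto simp: abs_le_square_iff[symmetric])
    have \<theta>q: "\<eta> * (A' q * B p) = - 2 * \<alpha> * a * E" and \<theta>p: "\<eta> * (A q * B' p) = - 2 * \<alpha> * b * E"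
      and \<theta>qq: "\<eta> * (A'' q * B p) = (4 * \<alpha>\<^sup>2 * a\<^sup>2 - 2 * \<alpha>) * E"
      and \<theta>qp: "\<eta> * (A' q * B' p) = 4 * \<alpha>\<^sup>2 * (a * b) * E"
      and \<theta>pp: "\<eta> * (A q * B'' p) = (4 * \<alpha>\<^sup>2 * b\<^sup>2 - 2 * \<alpha>) * E"
      by (simp_all add: A'_def B'_def A''_def B''_def E_def a_def b_def power2_eq_square)
    show False
    proof (cases "p = 0")
      case False
      then have "p < 0" using zin by simp
      have min': "w1 q p - w2 q p - \<eta> * (A q * B p) \<le> w1 q' p' - w2 q' p' - \<eta> * (A q' * B p')"
        if "\<bar>q' - q\<bar> < e" "\<bar>p' - p\<bar> < e" "-1 \<le> p'" "p' \<le> 0" for q' p'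
        using min e(2)[of q' p'] that by (simp add: less_imp_le)
      note t = touch_interior[OF s1 s2 j p \<open>p < 0\<close> e(1) min', unfolded \<theta>q \<theta>p \<theta>qq \<theta>qp \<theta>pp]
      define x1 y1 where "x1 = Hp p + w1p q p" and "y1 = w1q q p"
      have p': "-1 \<le> p" "p \<le> 0" using p zin by auto
      note b1 = hsol_bounds[OF s1 p', of q]
      define D where "D = \<bar>x1 - (Hp p + w2p q p)\<bar> + \<bar>y1 - w2q q p\<bar> + max 0 (w2 q p - w1 q p)"
      have 1: "x1\<^sup>2 * ((4 * \<alpha>\<^sup>2 * a\<^sup>2 - 2 * \<alpha>) * E) - x1 * y1 * (4 * \<alpha>\<^sup>2 * (a * b) * E + 4 * \<alpha>\<^sup>2 * (a * b) * E)
          + (1 + y1\<^sup>2) * ((4 * \<alpha>\<^sup>2 * b\<^sup>2 - 2 * \<alpha>) * E) - K * D \<le> 0"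
        unfolding x1_def y1_def K_def D_def
        by (rule order_trans[OF hsol_defect_lower[OF s1 s2 p'] t(3)])
      have "\<bar>x1 - (Hp p + w2p q p)\<bar> = 2 * \<alpha> * E * \<bar>b\<bar>" "\<bar>y1 - w2q q p\<bar> = 2 * \<alpha> * E * \<bar>a\<bar>"
        using t(1,2) \<alpha> E by (simp_all add: x1_def y1_def abs_mult)
      moreover have "max 0 (w2 q p - w1 q p) = 0" using vpos by simp
      ultimately have "D = E * (2 * \<alpha> * (\<bar>a\<bar> + \<bar>b\<bar>))" by (simp add: D_def algebra_simps)
      then have "x1\<^sup>2 * ((4 * \<alpha>\<^sup>2 * a\<^sup>2 - 2 * \<alpha>) * E) - x1 * y1 * (4 * \<alpha>\<^sup>2 * (a * b) * E + 4 * \<alpha>\<^sup>2 * (a * b) * E)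
          + (1 + y1\<^sup>2) * ((4 * \<alpha>\<^sup>2 * b\<^sup>2 - 2 * \<alpha>) * E) - K * D
        = E * (4 * \<alpha>\<^sup>2 * (x1\<^sup>2 * a\<^sup>2 - x1 * y1 * (2 * (a * b)) + (1 + y1\<^sup>2) * b\<^sup>2)
          - 2 * \<alpha> * (x1\<^sup>2 + 1 + y1\<^sup>2) - K * (2 * \<alpha> * (\<bar>a\<bar> + \<bar>b\<bar>)))"
        by algebra
      with 1 have "E * (4 * \<alpha>\<^sup>2 * (x1\<^sup>2 * a\<^sup>2 - x1 * y1 * (2 * (a * b)) + (1 + y1\<^sup>2) * b\<^sup>2)
          - 2 * \<alpha> * (x1\<^sup>2 + 1 + y1\<^sup>2) - K * (2 * \<alpha> * (\<bar>a\<bar> + \<bar>b\<bar>))) \<le> 0"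
        by (simp only:)
      then have "4 * \<alpha>\<^sup>2 * (x1\<^sup>2 * a\<^sup>2 - x1 * y1 * (2 * (a * b)) + (1 + y1\<^sup>2) * b\<^sup>2)
          - 2 * \<alpha> * (x1\<^sup>2 + 1 + y1\<^sup>2) - K * (2 * \<alpha> * (\<bar>a\<bar> + \<bar>b\<bar>)) \<le> 0"
        using E by (simp add: mult_le_0_iff)
      moreover have "4 * \<alpha>\<^sup>2 * (\<kappa> * r\<^sup>2) \<le> 4 * \<alpha>\<^sup>2 * (x1\<^sup>2 * a\<^sup>2 - x1 * y1 * (2 * (a * b)) + (1 + y1\<^sup>2) * b\<^sup>2)"
      proof (intro mult_left_mono)
        have "\<kappa> * r\<^sup>2 \<le> \<kappa> * (a\<^sup>2 + b\<^sup>2)" using \<open>r\<^sup>2 < d\<close> \<kappa> by (simp add: d_def a_def b_def)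
        also have "\<dots> \<le> x1\<^sup>2 * a\<^sup>2 - x1 * y1 * (2 * (a * b)) + (1 + y1\<^sup>2) * b\<^sup>2"
          using b1(2,8) by (intro \<kappa>(2)) (simp_all add: x1_def y1_def)
        finally show "\<kappa> * r\<^sup>2 \<le> x1\<^sup>2 * a\<^sup>2 - x1 * y1 * (2 * (a * b)) + (1 + y1\<^sup>2) * b\<^sup>2" .
      qed auto
      moreover have "2 * \<alpha> * (x1\<^sup>2 + 1 + y1\<^sup>2) \<le> 2 * \<alpha> * (M\<^sup>2 + 1 + M\<^sup>2)"
        using b1(2,8,9) \<alpha> c_pos M_ge
        by (intro mult_left_mono add_mono) (simp_all add: x1_def y1_def abs_le_square_iff[symmetric])
      moreover have "K * (2 * \<alpha> * (\<bar>a\<bar> + \<bar>b\<bar>)) \<le> K * (2 * \<alpha> * 2)"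
        using ab K \<alpha> by (intro mult_left_mono) auto
      ultimately have "4 * \<alpha>\<^sup>2 * (\<kappa> * r\<^sup>2) - 2 * \<alpha> * (M\<^sup>2 + 1 + M\<^sup>2) - K * (2 * \<alpha> * 2) \<le> 0"
        by linarith
      then have "\<alpha> * (4 * \<alpha> * (\<kappa> * r\<^sup>2) - (4 * M\<^sup>2 + 2 + 4 * K)) \<le> 0"
        by (simp add: algebra_simps power2_eq_square)
      moreover have "4 * \<alpha> * (\<kappa> * r\<^sup>2) = 4 * M\<^sup>2 + 4 + 4 * K"
        using \<kappa>(1) r by (simp add: \<alpha>_def)
      ultimately show False using \<alpha> by simp
    next
      case True
      have min': "w1 q 0 - w2 q 0 - \<eta> * (A q * B 0) \<le> w1 q' p' - w2 q' p' - \<eta> * (A q' * B p')"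
        if "\<bar>q' - q\<bar> < e" "\<bar>p'\<bar> < e" "-1 \<le> p'" "p' \<le> 0" for q' p'
        using min e(2)[of q' p'] that True by (simp add: less_imp_le)
      have neg': "\<eta> * (A q * B' 0) \<le> 0"
        using \<theta>p True \<alpha> E c2 by (simp add: b_def mult_le_0_iff zero_le_mult_iff)
      note t = touch_top_sign[OF s1 s2 j e(1) min' neg']
      have b: "b = - c2" using True by (simp add: b_def)
      have "a\<^sup>2 + c2\<^sup>2 \<le> (1 + \<tau>\<^sup>2) * c2\<^sup>2" using zin top True by (simp add: a_def)
      then have "a\<^sup>2 \<le> (\<tau> * c2)\<^sup>2" by (simp add: algebra_simps power_mult_distrib)
      then have "\<bar>a\<bar> \<le> \<bar>\<tau> * c2\<bar>" by (simp add: abs_le_square_iff)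
      then have a: "\<bar>a\<bar> \<le> \<tau> * b" using b c2 \<tau>_pos by (simp add: abs_mult)
      have "\<bar>\<eta> * (A' q * B 0)\<bar> * (M / c\<^sup>2) = 2 * \<alpha> * E * (\<bar>a\<bar> * (M / c\<^sup>2))"
        using \<theta>q True \<alpha> E by (simp add: abs_mult)
      also have "\<dots> \<le> 2 * \<alpha> * E * ((\<tau> * b) * (M / c\<^sup>2))"
        using a \<alpha> E M_ge c_pos by (intro mult_left_mono mult_right_mono) auto
      also have "\<dots> = 2 * \<alpha> * E * (b / (4 * M ^ 3))"
        using c_pos M_ge by (simp add: \<tau>_def power4_eq_xxxx power3_eq_cube)
      also have "\<dots> < 2 * \<alpha> * E * (b / (2 * M ^ 3))"
        using b c2 M_ge \<alpha> E by (intro mult_strict_left_mono divide_strict_left_mono) auto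
      also have "\<dots> = - (\<eta> * (A q * B' 0)) / (2 * M ^ 3)"
        using \<theta>p True by (simp add: divide_simps)
      finally have "0 < - (\<eta> * (A q * B' 0)) / (2 * M ^ 3) - \<bar>\<eta> * (A' q * B 0)\<bar> * (M / c\<^sup>2)" by simp
      moreover have "\<mu> * \<rho>0 * (w1 q 0 - w2 q 0) \<ge> 0"
        using vpos True \<mu>_pos \<rho>0_pos by (intro mult_nonneg_nonneg) auto
      ultimately show False using t by linarith
    qed
  qed
qed

end

text \<open>Here \<open>spread\<close> abstracts the barrier estimate: positivity on a small disc extends to a larger
  one, which may reach over the top of the strip by a relative amount \<open>t\<close>.\<close>

lemma positivity_propagates:
  fixes f :: "real \<Rightarrow> real \<Rightarrow> real"
  assumes "t > 0"
    and cont: "continuous_on strip (\<lambda>z. f (fst z) (snd z))"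
    and spread: "\<And>c1 c2 r R \<eta> q p. 0 < r \<Longrightarrow> r < R \<Longrightarrow> c2 < 0 \<Longrightarrow> -1 < c2 - R \<Longrightarrow> c1 + R < L \<Longrightarrow>
        R\<^sup>2 \<le> (1 + t\<^sup>2) * c2\<^sup>2 \<Longrightarrow> \<eta> > 0 \<Longrightarrow>
        (\<And>q p. (q - c1)\<^sup>2 + (p - c2)\<^sup>2 \<le> r\<^sup>2 \<Longrightarrow> p \<le> 0 \<Longrightarrow> \<eta> \<le> f q p) \<Longrightarrow>
        (q - c1)\<^sup>2 + (p - c2)\<^sup>2 < R\<^sup>2 \<Longrightarrow> p \<le> 0 \<Longrightarrow> f q p > 0"
    and pos: "f q1 p1 > 0" "q1 < L" "-1 < p1" "p1 \<le> 0"
    and qp: "q < L" "-1 < p" "p \<le> 0"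
  shows "f q p > 0"
proof -
  define \<Omega> :: "(real \<times> real) set" where "\<Omega> = {..<L} \<times> {-1<..<0}"
  define g where "g = (\<lambda>z. f (fst z) (snd z))"
  have "open \<Omega>" "connected \<Omega>"
    by (auto simp: \<Omega>_def open_Times intro!: convex_connected convex_Times)
  have "\<Omega> \<subseteq> strip" by (auto simp: \<Omega>_def strip_def)
  then have gcont: "continuous_on \<Omega> g" using cont continuous_on_subset by (auto simp: g_def)
  have step: "f q p > 0" if "f c1 c2 > 0" "(c1, c2) \<in> \<Omega>" "0 < R" "-1 < c2 - R" "c1 + R < L"
    "R\<^sup>2 \<le> (1 + t\<^sup>2) * c2\<^sup>2" "(q - c1)\<^sup>2 + (p - c2)\<^sup>2 < R\<^sup>2" "p \<le> 0" for c1 c2 R q p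
  proof -
    have "isCont g (c1, c2)"
      using gcont \<open>open \<Omega>\<close> that(2) by (simp add: continuous_on_eq_continuous_at)
    moreover have "f c1 c2 / 2 < g (c1, c2)" using that(1) by (simp add: g_def)
    ultimately have "eventually (\<lambda>z. f c1 c2 / 2 < g z) (nhds (c1, c2))"
      unfolding isCont_def tendsto_at_iff_tendsto_nhds by (rule order_tendstoD(1))
    then obtain d where d: "d > 0" "\<And>z. dist z (c1, c2) < d \<Longrightarrow> f c1 c2 / 2 < g z"
      by (auto simp: eventually_nhds_metric)
    define r where "r = min d R / 2"
    have r: "0 < r" "r < R" "r < d" using d(1) that(3) by (auto simp: r_def)
    show ?thesis
    proof (rule spread[of r R c2 c1 "f c1 c2 / 2"])
      fix q p :: real assume *: "(q - c1)\<^sup>2 + (p - c2)\<^sup>2 \<le> r\<^sup>2" "p \<le> 0"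
      have "dist (q, p) (c1, c2) \<le> sqrt (r\<^sup>2)"
        unfolding dist_Pair_Pair dist_real_def power2_abs by (rule real_sqrt_le_mono[OF *(1)])
      then have "dist (q, p) (c1, c2) < d" using r by simp
      from d(2)[OF this] show "f c1 c2 / 2 \<le> f q p" by (simp add: g_def)
    qed (use that r in \<open>auto simp: \<Omega>_def\<close>)
  qed
  \<comment> \<open>The positivity set and its complement in \<Omega> are both open, so
    connectedness decides. For the complement: a positive point within \<open>d\<close> of
    \<open>z\<close> would, through the disc of radius \<open>2 * d\<close> around it, make
    \<open>z\<close> positive.\<close>
  let ?P = "\<Omega> \<inter> g -` {0<..}" and ?N = "{z \<in> \<Omega>. \<not> g z > 0}"
  have "open ?P" using gcont \<open>open \<Omega>\<close> by (rule continuous_open_preimage) simp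
  have "open ?N"
  proof (rule openI)
    fix z assume z: "z \<in> ?N"
    obtain q p where qp: "z = (q, p)" by (cases z)
    \<comment> \<open>The quarter leaves room for the displacement of the centre plus the radius,
      together less than \<open>3 * d\<close>.\<close>
    define d where "d = min (L - q) (min (p + 1) (- p)) / 4"
    have d: "0 < d" "4 * d \<le> L - q" "4 * d \<le> p + 1" "4 * d \<le> - p"
      using z qp by (auto simp: \<Omega>_def d_def)
    have "ball z d \<subseteq> ?N"
    proof
      fix y assume y: "y \<in> ball z d"
      obtain c1 c2 where c: "y = (c1, c2)" by (cases y)
      have "(dist z y)\<^sup>2 < d\<^sup>2" using y d(1) by (intro power_strict_mono) auto
      then have D: "(q - c1)\<^sup>2 + (p - c2)\<^sup>2 < d\<^sup>2"
        by (simp add: qp c dist_Pair_Pair dist_real_def)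
      then have "\<bar>q - c1\<bar>\<^sup>2 < d\<^sup>2" "\<bar>p - c2\<bar>\<^sup>2 < d\<^sup>2"
        unfolding power2_abs using zero_le_power2[of "q - c1"] zero_le_power2[of "p - c2"] by linarith+
      then have cc: "\<bar>q - c1\<bar> < d" "\<bar>p - c2\<bar> < d"
        using d(1) power2_less_imp_less[of _ d] by (meson less_imp_le)+
      have in\<Omega>: "(c1, c2) \<in> \<Omega>" using cc d by (auto simp: \<Omega>_def)
      show "y \<in> ?N"
      proof (rule ccontr)
        assume "y \<notin> ?N"
        then have "f c1 c2 > 0" using in\<Omega> c by (simp add: g_def)
        moreover have "(2 * d)\<^sup>2 \<le> (1 + t\<^sup>2) * c2\<^sup>2"
        proof -
          have "\<bar>2 * d\<bar> \<le> \<bar>c2\<bar>" using cc d by auto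
          then have "(2 * d)\<^sup>2 \<le> c2\<^sup>2" by (simp only: abs_le_square_iff)
          also have "\<dots> \<le> (1 + t\<^sup>2) * c2\<^sup>2" by (simp add: mult_le_cancel_right1)
          finally show ?thesis .
        qed
        moreover have "(q - c1)\<^sup>2 + (p - c2)\<^sup>2 < (2 * d)\<^sup>2"
          using D zero_le_power2[of d] unfolding four_x_squared[symmetric] by linarith
        ultimately have "f q p > 0"
          using step[of c1 c2 "2 * d" q p] in\<Omega> cc d by auto
        then show False using z qp by (simp add: g_def)
      qed
    qed
    then show "\<exists>e>0. ball z e \<subseteq> ?N" using d(1) by blast
  qed
  have "\<exists>z\<in>\<Omega>. g z > 0"
  proof (cases "p1 = 0")
    case False
    then show ?thesis using pos by (intro bexI[of _ "(q1, p1)"]) (auto simp: \<Omega>_def g_def)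
  next
    case True
    have "continuous_on {-1..0} (\<lambda>p. g (q1, p))"
      unfolding g_def by (intro continuous_on_compose2[OF cont] continuous_intros) (auto simp: strip_def)
    then have "((\<lambda>p. g (q1, p)) \<longlongrightarrow> g (q1, 0)) (at 0 within {-1..0})"
      by (simp add: continuous_on_def)
    moreover have "g (q1, 0) > 0" using pos True by (simp add: g_def)
    ultimately have "eventually (\<lambda>p. g (q1, p) > 0) (at 0 within {-1..0})"
      using order_tendstoD(1) by blast
    then obtain d where d: "d > 0" "\<And>p. p \<in> {-1..0} \<Longrightarrow> p \<noteq> 0 \<Longrightarrow> \<bar>p\<bar> < d \<Longrightarrow> g (q1, p) > 0"
      by (auto simp: eventually_at dist_real_def)
    have "g (q1, - min d 1 / 2) > 0" using d(1) by (intro d(2)) auto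
    then show ?thesis using d(1) pos by (intro bexI[of _ "(q1, - min d 1 / 2)"]) (auto simp: \<Omega>_def min_def)
  qed
  then have "?P \<inter> \<Omega> \<noteq> {}" by auto
  moreover have "?P \<inter> ?N \<inter> \<Omega> = {}" "\<Omega> \<subseteq> ?P \<union> ?N" by auto
  ultimately have "?N \<inter> \<Omega> = {}"
    using connectedD[OF \<open>connected \<Omega>\<close> \<open>open ?P\<close> \<open>open ?N\<close>] by blast
  then have int: "f q p > 0" if "q < L" "-1 < p" "p < 0" for q p
  proof -
    have "(q, p) \<in> \<Omega>" using that by (simp add: \<Omega>_def)
    then have "g (q, p) > 0" using \<open>?N \<inter> \<Omega> = {}\<close> by blast
    then show ?thesis by (simp add: g_def)
  qed
  show ?thesis
  proof (cases "p = 0")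
    case False then show ?thesis using int qp by simp
  next
    case True
    \<comment> \<open>A surface point is reached by a disc of radius \<open>u * s\<close> around the
      point at depth \<open>s\<close> below it; \<open>u > 1\<close> is exactly what the permitted
      overhang provides.\<close>
    define u where "u = sqrt (1 + t\<^sup>2)"
    have u: "u > 1" using \<open>t > 0\<close> by (simp add: u_def)
    define s where "s = min 1 (L - q) / (2 * (u + 1))"
    have s: "s > 0" using u qp by (simp add: s_def)
    have "s * (u + 1) = min 1 (L - q) / 2" using u by (simp add: s_def field_simps)
    then have s': "s * (u + 1) < 1" "s * (u + 1) < L - q" using qp by auto
    have su: "s * u > s" using u s by simp
    have sl: "s + s * u < 1" "s + s * u < L - q" using s' by (simp_all only: distrib_left mult_1_right add.commute)
    have sl': "s < 1" "u * s < L - q" "-1 < - s - u * s"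
      using sl su s by (simp_all only: mult.commute[of u s])
    show ?thesis
    proof (rule step[of q "- s" "u * s"])
      show "f q (- s) > 0" using s sl' by (intro int) (simp_all add: qp)
      show "(u * s)\<^sup>2 \<le> (1 + t\<^sup>2) * (- s)\<^sup>2" by (simp add: u_def power_mult_distrib)
      show "(q - q)\<^sup>2 + (p - - s)\<^sup>2 < (u * s)\<^sup>2"
        using True su s by (simp add: mult.commute power_strict_mono)
      show "(q, - s) \<in> \<Omega>" using s sl' qp by (simp add: \<Omega>_def)
    qed (use s sl' True u in simp_all)
  qed
qed

section \<open>Supersolutions of the linearized problem\<close>

lemma integral_series:
  fixes f :: "nat \<Rightarrow> real \<Rightarrow> real"
  assumes cont: "\<And>n. continuous_on {a..b} (f n)"
    and bound: "\<And>n x. x \<in> {a..b} \<Longrightarrow> \<bar>f n x\<bar> \<le> C n" and "summable C"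
  shows "(\<lambda>n. integral {a..b} (f n)) sums integral {a..b} (\<lambda>x. \<Sum>n. f n x)"
proof -
  have u: "uniform_limit {a..b} (\<lambda>n x. \<Sum>i<n. f i x) (\<lambda>x. \<Sum>n. f n x) sequentially"
    by (rule Weierstrass_m_test[OF _ \<open>summable C\<close>]) (simp add: bound)
  have c: "continuous_on {a..b} (\<lambda>x. \<Sum>i<n. f i x)" for n
    by (intro continuous_intros cont)
  obtain I J where I: "\<And>n. ((\<lambda>x. \<Sum>i<n. f i x) has_integral I n) {a..b}"
    and J: "((\<lambda>x. \<Sum>n. f n x) has_integral J) {a..b}" and lim: "(I \<longlongrightarrow> J) sequentially"
    using uniform_limit_integral[OF u c] by auto
  have "I n = (\<Sum>i<n. integral {a..b} (f i))" for n
    using integral_unique[OF I[of n]] by (simp add: integral_sum integrable_continuous_real cont)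
  then have "I = (\<lambda>n. \<Sum>i<n. integral {a..b} (f i))" by auto
  with lim integral_unique[OF J] show ?thesis by (simp add: sums_def)
qed

text \<open>The coefficient of \<open>(- m) ^ n\<close> in the expansion of \<psi>, found by
  iterating the two integral equations of the shooting problem.\<close>

primrec shoot :: "(real \<Rightarrow> real) \<Rightarrow> (real \<Rightarrow> real) \<Rightarrow> nat \<Rightarrow> real \<Rightarrow> real" where
  "shoot a r 0 = (\<lambda>p. 1)"
| "shoot a r (Suc n) = (\<lambda>p. integral {-1..p} (\<lambda>t. r t * integral {-1..t} (\<lambda>s. a s * shoot a r n s)))"

text \<open>Each integration contributes a factor \<open>(p + 1) / Suc n\<close>; iterated, these
  produce the factorial that makes the series converge for every parameter.\<close>

lemma integral_le_power:
  fixes f :: "real \<Rightarrow> real"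
  assumes "continuous_on {-1..0} f" "p \<in> {-1..0}"
    and bd: "\<And>t. t \<in> {-1..0} \<Longrightarrow> \<bar>f t\<bar> \<le> K * (t + 1) ^ n"
  shows "\<bar>integral {-1..p} f\<bar> \<le> K * (p + 1) ^ Suc n / Suc n"
proof -
  have sub: "{-1..p} \<subseteq> {-1..0}" using assms by auto
  have d: "((\<lambda>t. K * (t + 1) ^ Suc n / Suc n) has_real_derivative K * (t + 1) ^ n) (at t within S)" for t S
    by (rule derivative_eq_intros refl | simp)+
  have I: "((\<lambda>t. K * (t + 1) ^ n) has_integral
      K * (p + 1) ^ Suc n / Suc n - K * (-1 + 1) ^ Suc n / Suc n) {-1..p}"
    using assms(2) d by (intro fundamental_theorem_of_calculus) (auto simp: has_real_derivative_iff_has_vector_derivative)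
  have "norm (integral {-1..p} f) \<le> integral {-1..p} (\<lambda>t. K * (t + 1) ^ n)"
    using sub bd by (intro integral_norm_bound_integral integrable_continuous_real
        continuous_on_subset[OF assms(1)] continuous_intros) auto
  also have "\<dots> = K * (p + 1) ^ Suc n / Suc n" using integral_unique[OF I] by simp
  finally show ?thesis by simp
qed

lemma continuous_on_interval_bound:
  fixes f :: "real \<Rightarrow> real"
  assumes "continuous_on {a..b} f"
  obtains B where "B > 0" "\<And>t. t \<in> {a..b} \<Longrightarrow> \<bar>f t\<bar> \<le> B"
  using compact_imp_bounded[OF compact_continuous_image[OF assms]] by (auto simp: bounded_pos)

text \<open>The initial value problem \<open>\<phi>' = a \<psi>\<close>, \<open>\<psi>' = - m r \<phi>\<close>, \<open>\<phi>(-1) = 0\<close>, \<open>\<psi>(-1) = 1\<close>, solved by its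
  power series in the parameter \<open>m\<close>.\<close>

definition shooting :: "(real \<Rightarrow> real) \<Rightarrow> (real \<Rightarrow> real) \<Rightarrow> (real \<Rightarrow> real \<Rightarrow> real) \<Rightarrow>
    (real \<Rightarrow> real \<Rightarrow> real) \<Rightarrow> bool" where
  "shooting a r \<phi> \<psi> \<longleftrightarrow>
     (\<forall>m. \<forall>p\<in>{-1..0}. \<phi> m p = integral {-1..p} (\<lambda>t. a t * \<psi> m t) \<and>
        \<psi> m p = 1 - m * integral {-1..p} (\<lambda>t. r t * \<phi> m t)) \<and>
     (\<forall>B. continuous_on ({-B..B} \<times> {-1..0}) (\<lambda>z. \<phi> (fst z) (snd z)) \<and>
        continuous_on ({-B..B} \<times> {-1..0}) (\<lambda>z. \<psi> (fst z) (snd z)))"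

lemma shootingD:
  assumes "shooting a r \<phi> \<psi>"
  shows "p \<in> {-1..0} \<Longrightarrow> \<phi> m p = integral {-1..p} (\<lambda>t. a t * \<psi> m t)"
    "p \<in> {-1..0} \<Longrightarrow> \<psi> m p = 1 - m * integral {-1..p} (\<lambda>t. r t * \<phi> m t)"
    "continuous_on ({-B..B} \<times> {-1..0}) (\<lambda>z. \<phi> (fst z) (snd z))"
    "continuous_on ({-B..B} \<times> {-1..0}) (\<lambda>z. \<psi> (fst z) (snd z))"
  using assms unfolding shooting_def by blast+

lemma has_real_derivative_transform:
  fixes f g :: "real \<Rightarrow> real"
  assumes "(f has_real_derivative D) (at x within S)" "x \<in> S" "\<And>y. y \<in> S \<Longrightarrow> g y = f y"
  shows "(g has_real_derivative D) (at x within S)"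
  using assms has_derivative_transform unfolding has_field_derivative_def by blast

lemma has_real_derivative_unique_Icc:
  fixes f :: "real \<Rightarrow> real"
  assumes "(f has_real_derivative D) (at x within {a..b})" "(f has_real_derivative E) (at x within {a..b})"
    and "x \<in> {a..b}" "a < b"
  shows "D = E"
proof (rule vector_derivative_unique_within)
  show "at x within {a..b} \<noteq> bot" using assms(3,4) by (simp add: trivial_limit_within islimpt_Icc)
qed (use assms in \<open>auto simp: has_real_derivative_iff_has_vector_derivative\<close>)

lemma shooting_method:
  fixes a r :: "real \<Rightarrow> real"
  assumes a: "continuous_on {-1..0} a" and r: "continuous_on {-1..0} r"
  obtains \<phi> \<psi> :: "real \<Rightarrow> real \<Rightarrow> real" where "shooting a r \<phi> \<psi>"
proof -
  obtain A where A: "\<And>t. t \<in> {-1..0} \<Longrightarrow> \<bar>a t\<bar> \<le> A" "A \<ge> 0"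
    using continuous_on_interval_bound[OF a] by (metis less_imp_le)
  obtain R where R: "\<And>t. t \<in> {-1..0} \<Longrightarrow> \<bar>r t\<bar> \<le> R" "R \<ge> 0"
    using continuous_on_interval_bound[OF r] by (metis less_imp_le)
  define \<Psi> where "\<Psi> = shoot a r"
  define \<Phi> where "\<Phi> = (\<lambda>n p. integral {-1..p} (\<lambda>s. a s * \<Psi> n s))"
  have \<Psi>Suc: "\<Psi> (Suc n) p = integral {-1..p} (\<lambda>t. r t * \<Phi> n t)" for n p
    by (simp add: \<Psi>_def \<Phi>_def)
  have cont\<Phi>: "continuous_on {-1..0} (\<Phi> n)" if "continuous_on {-1..0} (\<Psi> n)" for n
    unfolding \<Phi>_def
    by (intro indefinite_integral_continuous_1 integrable_continuous_real continuous_intros a that)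
  have cont\<Psi>: "continuous_on {-1..0} (\<Psi> n)" for n
  proof (induction n)
    case 0 show ?case by (simp add: \<Psi>_def)
  next
    case (Suc n)
    have "\<Psi> (Suc n) = (\<lambda>p. integral {-1..p} (\<lambda>t. r t * \<Phi> n t))" using \<Psi>Suc by auto
    then show ?case
      by (simp only:) (intro indefinite_integral_continuous_1 integrable_continuous_real continuous_intros r cont\<Phi> Suc.IH)
  qed
  note cont\<Phi> = cont\<Phi>[OF cont\<Psi>]
  define K where "K = (\<lambda>n::nat. (A * R) ^ n / fact n)"
  have K: "K n \<ge> 0" for n using A R by (simp add: K_def)
  have bd\<Phi>: "\<bar>\<Phi> n p\<bar> \<le> A * K n * (p + 1) ^ n"
    if p: "p \<in> {-1..0}" and bd: "\<And>p. p \<in> {-1..0} \<Longrightarrow> \<bar>\<Psi> n p\<bar> \<le> K n * (p + 1) ^ n" for n p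
  proof -
    have "\<bar>a t * \<Psi> n t\<bar> \<le> A * K n * (t + 1) ^ n" if "t \<in> {-1..0}" for t
      using mult_mono[OF A(1)[OF that] bd[OF that] A(2)] by (simp add: abs_mult mult_ac)
    from integral_le_power[OF _ p this]
    have "\<bar>\<Phi> n p\<bar> \<le> A * K n * (p + 1) ^ Suc n / Suc n"
      unfolding \<Phi>_def by (simp add: continuous_intros a cont\<Psi>)
    \<comment> \<open>The gain of this integration is discarded: one factorial for every two
      integrations is enough.\<close>
    also have "\<dots> \<le> A * K n * (p + 1) ^ Suc n"
    proof -
      have "0 \<le> A * K n * (p + 1) ^ Suc n" using A(2) K[of n] p by simp
      then show ?thesis by (simp add: divide_le_eq mult_le_cancel_left1 del: power_Suc)
    qed
    also have "\<dots> \<le> A * K n * (p + 1) ^ n"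
      using A(2) K[of n] p by (intro mult_left_mono power_decreasing) auto
    finally show ?thesis .
  qed
  have bd\<Psi>: "\<bar>\<Psi> n p\<bar> \<le> K n * (p + 1) ^ n" if "p \<in> {-1..0}" for n p
    using that
  proof (induction n arbitrary: p)
    case 0 then show ?case by (simp add: \<Psi>_def K_def)
  next
    case (Suc n)
    have "\<bar>r t * \<Phi> n t\<bar> \<le> R * (A * K n) * (t + 1) ^ n" if "t \<in> {-1..0}" for t
      using mult_mono[OF R(1)[OF that] bd\<Phi>[OF that Suc.IH] R(2)] by (simp add: abs_mult mult_ac)
    from integral_le_power[OF _ Suc.prems this]
    have "\<bar>\<Psi> (Suc n) p\<bar> \<le> R * (A * K n) * (p + 1) ^ Suc n / Suc n"
      unfolding \<Psi>Suc by (simp add: continuous_intros r cont\<Phi>)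
    also have "\<dots> = K (Suc n) * (p + 1) ^ Suc n" by (simp add: K_def field_simps)
    finally show ?case .
  qed
  have pw: "(p + 1) ^ n \<le> 1" if "p \<in> {-1..0}" for n and p :: real
    using that by (intro power_le_one) auto
  have b\<Psi>: "\<bar>\<Psi> n p\<bar> \<le> K n" if "p \<in> {-1..0}" for n p
    using order_trans[OF bd\<Psi>[OF that] mult_left_mono[OF pw[OF that] K]] by simp
  have b\<Phi>: "\<bar>\<Phi> n p\<bar> \<le> A * K n" if "p \<in> {-1..0}" for n p
    using order_trans[OF bd\<Phi>[OF that bd\<Psi>] mult_left_mono[OF pw[OF that]]] A(2) K[of n] by simp
  have sumK: "summable (\<lambda>n. C * (B ^ n * K n))" for B C :: real
    using summable_mult[OF summable_exp[of "B * (A * R)"], of C]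
    by (simp add: K_def power_mult_distrib divide_inverse mult_ac)
  define \<phi> \<psi> where "\<phi> = (\<lambda>m p. \<Sum>n. (- m) ^ n * \<Phi> n p)" and "\<psi> = (\<lambda>m p. \<Sum>n. (- m) ^ n * \<Psi> n p)"
  have t\<Psi>: "\<bar>(- m) ^ n * \<Psi> n p\<bar> \<le> 1 * (B ^ n * K n)" if "\<bar>m\<bar> \<le> B" "p \<in> {-1..0}" for m B n p
    unfolding abs_mult power_abs using that b\<Psi>[OF that(2)] by (auto intro!: mult_mono power_mono)
  have t\<Phi>: "\<bar>(- m) ^ n * \<Phi> n p\<bar> \<le> A * (B ^ n * K n)" if "\<bar>m\<bar> \<le> B" "p \<in> {-1..0}" for m B n p
  proof -
    have "\<bar>(- m) ^ n * \<Phi> n p\<bar> \<le> B ^ n * (A * K n)"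
      unfolding abs_mult power_abs using that b\<Phi>[OF that(2)] by (auto intro!: mult_mono power_mono)
    then show ?thesis by (simp add: mult_ac)
  qed
  have s\<Psi>: "summable (\<lambda>n. (- m) ^ n * \<Psi> n p)" if "p \<in> {-1..0}" for m p
    using t\<Psi>[of m "\<bar>m\<bar>" p] that
    by (intro summable_comparison_test'[OF sumK[of 1 "\<bar>m\<bar>"], of 0]) auto
  have s\<Phi>: "summable (\<lambda>n. (- m) ^ n * \<Phi> n p)" if "p \<in> {-1..0}" for m p
    using t\<Phi>[of m "\<bar>m\<bar>" p] that
    by (intro summable_comparison_test'[OF sumK[of A "\<bar>m\<bar>"], of 0]) auto
  show thesis
  proof (rule that, unfold shooting_def, intro conjI allI ballI)
    fix m p :: real assume p: "p \<in> {-1..0}"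
    then have sub: "{-1..p} \<subseteq> {-1..0}" by auto
    have "(\<lambda>n. integral {-1..p} (\<lambda>t. a t * ((- m) ^ n * \<Psi> n t))) sums
          integral {-1..p} (\<lambda>t. \<Sum>n. a t * ((- m) ^ n * \<Psi> n t))"
    proof (rule integral_series[where C = "\<lambda>n. A * (\<bar>m\<bar> ^ n * K n)"])
      show "continuous_on {-1..p} (\<lambda>t. a t * ((- m) ^ n * \<Psi> n t))" for n
        by (intro continuous_intros continuous_on_subset[OF a sub] continuous_on_subset[OF cont\<Psi> sub])
      show "\<bar>a t * ((- m) ^ n * \<Psi> n t)\<bar> \<le> A * (\<bar>m\<bar> ^ n * K n)" if "t \<in> {-1..p}" for n t
      proof -
        have t: "t \<in> {-1..0}" using that sub by auto
        show ?thesis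
          unfolding abs_mult[of "a t"] using A t\<Psi>[of m "\<bar>m\<bar>" t n] t by (intro mult_mono) auto
      qed
    qed (rule sumK)
    moreover have "integral {-1..p} (\<lambda>t. a t * ((- m) ^ n * \<Psi> n t)) = (- m) ^ n * \<Phi> n p" for n
    proof -
      have "(\<lambda>t. a t * ((- m) ^ n * \<Psi> n t)) = (\<lambda>t. (- m) ^ n * (a t * \<Psi> n t))" by (auto simp: mult_ac)
      then show ?thesis by (simp add: \<Phi>_def)
    qed
    moreover have "integral {-1..p} (\<lambda>t. \<Sum>n. a t * ((- m) ^ n * \<Psi> n t)) = integral {-1..p} (\<lambda>t. a t * \<psi> m t)"
      using sub s\<Psi> by (intro integral_cong) (auto simp: \<psi>_def suminf_mult)
    ultimately show "\<phi> m p = integral {-1..p} (\<lambda>t. a t * \<psi> m t)"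
      by (simp add: \<phi>_def sums_iff)
    have "(\<lambda>n. integral {-1..p} (\<lambda>t. r t * ((- m) ^ n * \<Phi> n t))) sums
          integral {-1..p} (\<lambda>t. \<Sum>n. r t * ((- m) ^ n * \<Phi> n t))"
    proof (rule integral_series[where C = "\<lambda>n. R * A * (\<bar>m\<bar> ^ n * K n)"])
      show "continuous_on {-1..p} (\<lambda>t. r t * ((- m) ^ n * \<Phi> n t))" for n
        by (intro continuous_intros continuous_on_subset[OF r sub] continuous_on_subset[OF cont\<Phi> sub])
      show "\<bar>r t * ((- m) ^ n * \<Phi> n t)\<bar> \<le> R * A * (\<bar>m\<bar> ^ n * K n)" if "t \<in> {-1..p}" for n t
      proof -
        have t: "t \<in> {-1..0}" using that sub by auto
        have "\<bar>r t * ((- m) ^ n * \<Phi> n t)\<bar> \<le> R * (A * (\<bar>m\<bar> ^ n * K n))"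
          unfolding abs_mult[of "r t"] using R t\<Phi>[of m "\<bar>m\<bar>" t n] t by (intro mult_mono) auto
        then show ?thesis by (simp add: mult_ac)
      qed
    qed (rule sumK)
    moreover have "integral {-1..p} (\<lambda>t. r t * ((- m) ^ n * \<Phi> n t)) = (- m) ^ n * \<Psi> (Suc n) p" for n
    proof -
      have "(\<lambda>t. r t * ((- m) ^ n * \<Phi> n t)) = (\<lambda>t. (- m) ^ n * (r t * \<Phi> n t))" by (auto simp: mult_ac)
      then show ?thesis by (simp add: \<Psi>Suc)
    qed
    moreover have "integral {-1..p} (\<lambda>t. \<Sum>n. r t * ((- m) ^ n * \<Phi> n t)) = integral {-1..p} (\<lambda>t. r t * \<phi> m t)"
      using sub s\<Phi> by (intro integral_cong) (auto simp: \<phi>_def suminf_mult)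
    ultimately have "(\<lambda>n. (- m) ^ n * \<Psi> (Suc n) p) sums integral {-1..p} (\<lambda>t. r t * \<phi> m t)"
      by simp
    then have "(\<lambda>n. (- m) * ((- m) ^ n * \<Psi> (Suc n) p)) sums ((- m) * integral {-1..p} (\<lambda>t. r t * \<phi> m t))"
      by (rule sums_mult)
    then have "(\<lambda>n. (- m) ^ Suc n * \<Psi> (Suc n) p) sums ((- m) * integral {-1..p} (\<lambda>t. r t * \<phi> m t))"
      by (simp add: mult_ac)
    then have "(\<lambda>n. (- m) ^ n * \<Psi> n p) sums ((- m) * integral {-1..p} (\<lambda>t. r t * \<phi> m t) + (- m) ^ 0 * \<Psi> 0 p)"
      by (rule sums_Suc)
    then show "\<psi> m p = 1 - m * integral {-1..p} (\<lambda>t. r t * \<phi> m t)"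
      by (simp add: \<psi>_def sums_iff \<Psi>_def)
  next
    fix B :: real
    let ?S = "{-B..B} \<times> {-1..0::real}"
    have "uniform_limit ?S (\<lambda>N z. \<Sum>n<N. (- fst z) ^ n * \<Psi> n (snd z))
        (\<lambda>z. \<Sum>n. (- fst z) ^ n * \<Psi> n (snd z)) sequentially"
      by (rule Weierstrass_m_test[where M = "\<lambda>n. 1 * (B ^ n * K n)"]) (use t\<Psi>[of _ B] sumK[of 1 B] in \<open>auto simp: abs_le_iff\<close>)
    then show "continuous_on ?S (\<lambda>z. \<psi> (fst z) (snd z))"
      unfolding \<psi>_def
      by (rule uniform_limit_theorem[rotated])
        (auto intro!: always_eventually continuous_intros continuous_on_compose2[OF cont\<Psi>])
    have "uniform_limit ?S (\<lambda>N z. \<Sum>n<N. (- fst z) ^ n * \<Phi> n (snd z))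
        (\<lambda>z. \<Sum>n. (- fst z) ^ n * \<Phi> n (snd z)) sequentially"
      by (rule Weierstrass_m_test[where M = "\<lambda>n. A * (B ^ n * K n)"]) (use t\<Phi>[of _ B] sumK[of A B] in \<open>auto simp: abs_le_iff\<close>)
    then show "continuous_on ?S (\<lambda>z. \<phi> (fst z) (snd z))"
      unfolding \<phi>_def
      by (rule uniform_limit_theorem[rotated])
        (auto intro!: always_eventually continuous_intros continuous_on_compose2[OF cont\<Phi>])
  qed
qed


lemma shooting_derivatives:
  fixes a r :: "real \<Rightarrow> real" and \<phi> \<psi> :: "real \<Rightarrow> real \<Rightarrow> real"
  assumes a: "continuous_on {-1..0} a" and r: "continuous_on {-1..0} r"
    and s: "shooting a r \<phi> \<psi>"
  shows "continuous_on {-1..0} (\<phi> m)" "continuous_on {-1..0} (\<psi> m)"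
    "\<And>p. p \<in> {-1..0} \<Longrightarrow> (\<phi> m has_real_derivative a p * \<psi> m p) (at p within {-1..0})"
    "\<And>p. p \<in> {-1..0} \<Longrightarrow> (\<psi> m has_real_derivative - m * r p * \<phi> m p) (at p within {-1..0})"
proof -
  note \<phi> = shootingD(1)[OF s] and \<psi> = shootingD(2)[OF s] and c\<phi> = shootingD(3)[OF s] and c\<psi> = shootingD(4)[OF s]
  have "continuous_on {-1..0} (\<lambda>p. (\<lambda>z. \<phi> (fst z) (snd z)) (m, p))"
    by (rule continuous_on_compose2[OF c\<phi>[of "\<bar>m\<bar>"]]) (auto intro!: continuous_intros)
  then show 1: "continuous_on {-1..0} (\<phi> m)" by simp
  have "continuous_on {-1..0} (\<lambda>p. (\<lambda>z. \<psi> (fst z) (snd z)) (m, p))"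
    by (rule continuous_on_compose2[OF c\<psi>[of "\<bar>m\<bar>"]]) (auto intro!: continuous_intros)
  then show 2: "continuous_on {-1..0} (\<psi> m)" by simp
  fix p :: real assume p: "p \<in> {-1..0}"
  have "((\<lambda>x. integral {-1..x} (\<lambda>t. a t * \<psi> m t)) has_real_derivative a p * \<psi> m p) (at p within {-1..0})"
    by (intro integral_has_real_derivative continuous_intros a 2 p)
  then show "(\<phi> m has_real_derivative a p * \<psi> m p) (at p within {-1..0})"
    by (rule has_real_derivative_transform) (use p \<phi> in auto)
  have "((\<lambda>x. integral {-1..x} (\<lambda>t. r t * \<phi> m t)) has_real_derivative r p * \<phi> m p) (at p within {-1..0})"
    by (intro integral_has_real_derivative continuous_intros r 1 p)
  then have "((\<lambda>x. 1 - m * integral {-1..x} (\<lambda>t. r t * \<phi> m t)) has_real_derivative - m * r p * \<phi> m p) (at p within {-1..0})"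
    by (auto intro!: derivative_eq_intros)
  then show "(\<psi> m has_real_derivative - m * r p * \<phi> m p) (at p within {-1..0})"
    by (rule has_real_derivative_transform) (use p \<psi> in auto)
qed

text \<open>At the first parameter where \<open>\<psi>\<close> reaches zero, \<open>\<psi>\<close> is nonincreasing and hence vanishes at the
  surface, where the boundary expression is then nonnegative.\<close>

lemma shooting_positive:
  fixes a r :: "real \<Rightarrow> real" and \<phi> \<psi> :: "real \<Rightarrow> real \<Rightarrow> real"
  assumes a: "continuous_on {-1..0} a" and r: "continuous_on {-1..0} r"
    and s: "shooting a r \<phi> \<psi>"
    and a_pos: "\<And>p. p \<in> {-1..0} \<Longrightarrow> a p > 0" and r_nonneg: "\<And>p. p \<in> {-1..0} \<Longrightarrow> r p \<ge> 0"
    and "k > 0" "\<mu> > 0"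
    and noeig: "\<And>m. 0 < m \<Longrightarrow> m \<le> \<mu> \<Longrightarrow> - \<psi> m 0 + m * k * \<phi> m 0 \<noteq> 0"
  shows "- \<psi> \<mu> 0 + \<mu> * k * \<phi> \<mu> 0 < 0" "\<And>p. p \<in> {-1..0} \<Longrightarrow> \<psi> \<mu> p > 0"
proof -
  note \<phi> = shootingD(1)[OF s] and \<psi> = shootingD(2)[OF s] and c\<phi> = shootingD(3)[OF s] and c\<psi> = shootingD(4)[OF s]
  have cm\<phi>: "continuous_on {0..B} (\<lambda>m. \<phi> m p)" if "p \<in> {-1..0}" for p B
  proof -
    have "continuous_on {0..B} (\<lambda>m. (\<lambda>z. \<phi> (fst z) (snd z)) (m, p))"
      by (rule continuous_on_compose2[OF c\<phi>[of B]]) (use that in \<open>auto intro!: continuous_intros\<close>)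
    then show ?thesis by simp
  qed
  have cm\<psi>: "continuous_on {0..B} (\<lambda>m. \<psi> m p)" if "p \<in> {-1..0}" for p B
  proof -
    have "continuous_on {0..B} (\<lambda>m. (\<lambda>z. \<psi> (fst z) (snd z)) (m, p))"
      by (rule continuous_on_compose2[OF c\<psi>[of B]]) (use that in \<open>auto intro!: continuous_intros\<close>)
    then show ?thesis by simp
  qed
  have \<psi>0: "\<psi> 0 p = 1" if "p \<in> {-1..0}" for p using \<psi>[OF that, of 0] by simp
  \<comment> \<open>At parameter 0 the expression equals \<open>-1\<close>, because \<psi> is
    constantly 1; the absence of eigenvalues then forbids a change of sign.\<close>
  have B: "- \<psi> m 0 + m * k * \<phi> m 0 < 0" if m: "0 \<le> m" "m \<le> \<mu>" for m
  proof (rule ccontr)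
    assume "\<not> ?thesis"
    moreover have "continuous_on {0..m} (\<lambda>m. - \<psi> m 0 + m * k * \<phi> m 0)"
      by (intro continuous_intros cm\<phi> cm\<psi>) auto
    ultimately obtain x where "0 \<le> x" "x \<le> m" "- \<psi> x 0 + x * k * \<phi> x 0 = 0"
      using IVT'[of "\<lambda>m. - \<psi> m 0 + m * k * \<phi> m 0" 0 0 m] \<psi>0[of 0] m by auto
    then show False using noeig[of x] m \<psi>0[of 0] by (cases "x = 0") auto
  qed
  show "- \<psi> \<mu> 0 + \<mu> * k * \<phi> \<mu> 0 < 0" using B \<open>\<mu> > 0\<close> by simp
  let ?Z = "({0..\<mu>} \<times> {-1..0}) \<inter> {z. \<psi> (fst z) (snd z) \<le> 0}"
  have "?Z = {}"
  proof (rule ccontr)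
    assume "?Z \<noteq> {}"
    have "continuous_on ({0..\<mu>} \<times> {-1..0}) (\<lambda>z. \<psi> (fst z) (snd z))"
      using c\<psi>[of \<mu>] by (rule continuous_on_subset) (use \<open>\<mu> > 0\<close> in auto)
    then have "closed ?Z"
      using continuous_closed_preimage[of "{0..\<mu>} \<times> {-1..0}" "\<lambda>z. \<psi> (fst z) (snd z)" "{..0}"]
      by (auto simp: vimage_def closed_Times)
    then have "compact ?Z"
      using compact_Int_closed[of "{0..\<mu>} \<times> {-1..0}" ?Z] by (auto simp: compact_Times Int_assoc[symmetric])
    \<comment> \<open>A nonpositive value of \<psi> with the smallest possible parameter. For
      smaller parameters \<psi> is positive, so by continuity in the parameter it is still
      nonnegative at this one.\<close>
    then obtain z where z: "z \<in> ?Z" "\<And>y. y \<in> ?Z \<Longrightarrow> fst z \<le> fst y"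
      using continuous_attains_inf[OF _ \<open>?Z \<noteq> {}\<close>, of fst] continuous_on_fst[OF continuous_on_id] by blast
    define m where "m = fst z"
    define p where "p = snd z"
    have mp: "0 \<le> m" "m \<le> \<mu>" "p \<in> {-1..0}" "\<psi> m p \<le> 0" using z(1) by (auto simp: m_def p_def)
    have below: "\<psi> x t > 0" if "0 \<le> x" "x < m" "t \<in> {-1..0}" for x t
      using z(2)[of "(x, t)"] that mp by (force simp: m_def)
    have nn: "\<psi> m t \<ge> 0" if t: "t \<in> {-1..0}" for t
    proof (rule ccontr)
      assume neg: "\<not> \<psi> m t \<ge> 0"
      then obtain x where "0 \<le> x" "x \<le> m" "\<psi> x t = 0"
        using IVT2'[of "\<lambda>x. \<psi> x t" m 0 0] \<psi>0[OF t] cm\<psi>[OF t] mp by auto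
      then show False using below[of x t] t neg by (cases "x = m") auto
    qed
    note d = shooting_derivatives[OF a r s, of m]
    have \<phi>nn: "\<phi> m t \<ge> 0" if t: "t \<in> {-1..0}" for t
      unfolding \<phi>[OF t] using nn a_pos t
      by (intro integral_nonneg integrable_continuous_real continuous_intros
          continuous_on_subset[OF a] continuous_on_subset[OF d(2)]) (auto simp: less_imp_le)
    have "integral {-1..p} (\<lambda>t. r t * \<phi> m t) \<le> integral {-1..0} (\<lambda>t. r t * \<phi> m t)"
      using \<phi>nn r_nonneg mp
      by (intro integral_subset_le integrable_continuous_real continuous_intros
          continuous_on_subset[OF r] continuous_on_subset[OF d(1)]) auto
    then have "\<psi> m 0 \<le> \<psi> m p"
      using \<psi>[OF mp(3), of m] \<psi>[of 0 m] mp(1) by (simp add: mult_left_mono)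
    moreover have "m * k * \<phi> m 0 \<ge> 0" using mp(1) \<open>k > 0\<close> \<phi>nn[of 0] by simp
    ultimately show False using B[OF mp(1,2)] mp(4) by linarith
  qed
  then have nz: "(\<mu>, p) \<notin> ?Z" for p by blast
  show "\<psi> \<mu> p > 0" if "p \<in> {-1..0}" for p
    using nz[of p] that \<open>\<mu> > 0\<close> by (simp add: not_le)
qed

section \<open>Supersolutions from the absence of eigenvalues\<close>

context height_problem
begin

lemma Hp_cont: "continuous_on {-1..0} Hp"
  using Hp_deriv by (rule DERIV_continuous_on)

text \<open>Shooting with \<open>a = Hp ^ 3\<close> and \<open>r = - \<rho>p\<close> is the
  eigenvalue problem written for \<phi> and its flux \<open>\<psi> = \<phi>' / Hp ^ 3\<close>, so a
  zero of the surface expression would be an eigenvalue. With \<open>k\<close> the minimum of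
  \<phi>', the profile grows at least linearly from the bed; this is what allows it to be perturbed
  there.\<close>

lemma linear_profile:
  assumes "\<rho> 0 = \<rho>0"
    and noeig: "\<And>m. 0 < m \<Longrightarrow> m \<le> \<mu> \<Longrightarrow> \<not> has_eigensolution Hp \<rho> \<rho>p m"
  obtains \<phi> \<phi>' \<phi>'' :: "real \<Rightarrow> real" and k where
    "\<And>p. p \<in> {-1..0} \<Longrightarrow> (\<phi> has_real_derivative \<phi>' p) (at p within {-1..0})"
    "\<And>p. p \<in> {-1..0} \<Longrightarrow> (\<phi>' has_real_derivative \<phi>'' p) (at p within {-1..0})"
    "continuous_on {-1..0} \<phi>''"
    "\<And>p. p \<in> {-1..0} \<Longrightarrow> \<phi>'' p - 3 * (Hpp p / Hp p) * \<phi>' p - \<mu> * \<rho>p p * Hp p ^ 3 * \<phi> p = 0"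
    "\<phi>' 0 / Hp 0 ^ 3 - \<mu> * \<rho>0 * \<phi> 0 > 0"
    "k > 0" "\<And>p. p \<in> {-1..0} \<Longrightarrow> k * (p + 1) \<le> \<phi> p"
proof -
  define a where "a = (\<lambda>p. Hp p ^ 3)"
  define r where "r = (\<lambda>p. - \<rho>p p)"
  have a: "continuous_on {-1..0} a" and r: "continuous_on {-1..0} r"
    by (auto simp: a_def r_def intro!: continuous_intros Hp_cont \<rho>p_cont)
  have a_pos: "a p > 0" and r_nn: "r p \<ge> 0" if "p \<in> {-1..0}" for p
    using that Hp_pos \<rho>p_le by (auto simp: a_def r_def)
  obtain \<phi> \<psi> where sh: "shooting a r \<phi> \<psi>"
    using shooting_method[OF a r] by blast
  note s = shootingD[OF sh]
  note d = shooting_derivatives[OF a r sh]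
  have noeig': "- \<psi> m 0 + m * \<rho>0 * \<phi> m 0 \<noteq> 0" if m: "0 < m" "m \<le> \<mu>" for m
  proof
    assume eq: "- \<psi> m 0 + m * \<rho>0 * \<phi> m 0 = 0"
    have "has_eigensolution Hp \<rho> \<rho>p m"
      unfolding has_eigensolution_def
    proof (intro exI conjI ballI)
      show "(\<phi> m has_real_derivative a x * \<psi> m x) (at x within {-1..0})" if "x \<in> {-1..0}" for x
        using d(3)[OF that] .
      show "continuous_on {-1..0} (\<lambda>x. a x * \<psi> m x)" by (intro continuous_intros a d(2))
      show "\<phi> m (-1) = 0" using s(1)[of "-1" m] by simp
      show "- (a 0 * \<psi> m 0) / Hp 0 ^ 3 + m * \<rho> 0 * \<phi> m 0 = 0"
        using eq a_pos[of 0] assms(1) by (simp add: a_def)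
      show "((\<lambda>y. a y * \<psi> m y / Hp y ^ 3) has_real_derivative m * \<rho>p x * \<phi> m x) (at x)"
        "m * \<rho>p x * \<phi> m x - m * \<rho>p x * \<phi> m x = 0" if x: "x \<in> {-1<..<0}" for x
      proof -
        have x': "x \<in> {-1..0}" using x by auto
        have "at x within {-1..0} = at x" using x by (simp add: at_within_Icc_at)
        then have "(\<psi> m has_real_derivative m * \<rho>p x * \<phi> m x) (at x)"
          using d(4)[OF x', of m] by (simp add: r_def)
        then show "((\<lambda>y. a y * \<psi> m y / Hp y ^ 3) has_real_derivative m * \<rho>p x * \<phi> m x) (at x)"
        proof (rule has_field_derivative_transform_within_open[OF _ open_greaterThanLessThan x])
          fix y :: real assume "y \<in> {-1<..<0}"
          then show "\<psi> m y = a y * \<psi> m y / Hp y ^ 3" using a_pos[of y] by (simp add: a_def)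
        qed
      qed simp
      show "\<exists>x\<in>{-1..0}. \<phi> m x \<noteq> 0"
      proof (rule ccontr)
        assume "\<not> ?thesis"
        then have z: "\<phi> m x = 0" if "x \<in> {-1..0}" for x using that by blast
        have "\<psi> m x = 1" if x: "x \<in> {-1..0}" for x
        proof -
          have "integral {-1..x} (\<lambda>t. r t * \<phi> m t) = integral {-1..x} (\<lambda>t. 0)"
            using z x by (intro integral_cong) auto
          then show ?thesis using s(2)[OF x, of m] by simp
        qed
        moreover have "((\<phi> m) has_real_derivative 0) (at 0 within {-1..0})"
          by (rule has_real_derivative_transform[OF DERIV_const[of 0]]) (use z in auto)
        then have "a 0 * \<psi> m 0 = 0"
          using has_real_derivative_unique_Icc[OF d(3)[of 0 m]] by simp
        ultimately show False using a_pos[of 0] by simp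
      qed
    qed
    then show False using noeig m by blast
  qed
  have P: "- \<psi> \<mu> 0 + \<mu> * \<rho>0 * \<phi> \<mu> 0 < 0" "\<psi> \<mu> p > 0" if "p \<in> {-1..0}" for p
    using shooting_positive[OF a r sh _ _ \<rho>0_pos \<mu>_pos] a_pos r_nn noeig' that by blast+
  define \<phi>'' where "\<phi>'' = (\<lambda>p. 3 * Hp p ^ 2 * Hpp p * \<psi> \<mu> p + a p * (- \<mu> * r p * \<phi> \<mu> p))"
  have "continuous_on {-1..0} (\<lambda>p. a p * \<psi> \<mu> p)" by (intro continuous_intros a d(2))
  then obtain x where x: "x \<in> {-1..0}" "\<And>y. y \<in> {-1..0} \<Longrightarrow> a x * \<psi> \<mu> x \<le> a y * \<psi> \<mu> y"
    using continuous_attains_inf[of "{-1..0}" "\<lambda>p. a p * \<psi> \<mu> p"] by force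
  show thesis
  proof
    show "(\<phi> \<mu> has_real_derivative a p * \<psi> \<mu> p) (at p within {-1..0})" if "p \<in> {-1..0}" for p
      using d(3)[OF that] .
    show "((\<lambda>p. a p * \<psi> \<mu> p) has_real_derivative \<phi>'' p) (at p within {-1..0})" if p: "p \<in> {-1..0}" for p
      unfolding a_def
      by (rule derivative_eq_intros Hp_deriv[OF p] d(4)[OF p] refl)+ (simp add: \<phi>''_def a_def algebra_simps)
    show "continuous_on {-1..0} \<phi>''"
      unfolding \<phi>''_def by (intro continuous_intros a r d(1,2) Hp_cont Hpp_cont)
    show "\<phi>'' p - 3 * (Hpp p / Hp p) * (a p * \<psi> \<mu> p) - \<mu> * \<rho>p p * Hp p ^ 3 * \<phi> \<mu> p = 0"
      if p: "p \<in> {-1..0}" for p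
      using Hp_pos[OF p] by (simp add: \<phi>''_def a_def r_def field_simps power2_eq_square power3_eq_cube)
    show "a 0 * \<psi> \<mu> 0 / Hp 0 ^ 3 - \<mu> * \<rho>0 * \<phi> \<mu> 0 > 0"
      using P(1)[of 0] a_pos[of 0] by (simp add: a_def)
    show "a x * \<psi> \<mu> x > 0" using x(1) a_pos P(2) by simp
    show "a x * \<psi> \<mu> x * (p + 1) \<le> \<phi> \<mu> p" if p: "p \<in> {-1..0}" for p
    proof -
      have "integral {-1..p} (\<lambda>t. a x * \<psi> \<mu> x) \<le> integral {-1..p} (\<lambda>t. a t * \<psi> \<mu> t)"
        using p x by (intro integral_le integrable_continuous_real continuous_intros
            continuous_on_subset[OF a] continuous_on_subset[OF d(2)]) auto
      then show ?thesis using s(1)[OF p, of \<mu>] p by (simp add: algebra_simps)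
    qed
  qed
qed

text \<open>Besides being a strict supersolution, \<open>\<Phi>\<close> is so concave in the bottom layer of width \<open>\<delta>\<close> that
  it remains a supersolution there for any coefficients controlled by \<open>N\<close>.\<close>

definition supersol :: "real \<Rightarrow> real \<Rightarrow> real \<Rightarrow> real \<Rightarrow> (real \<Rightarrow> real) \<Rightarrow> (real \<Rightarrow> real) \<Rightarrow> (real \<Rightarrow> real) \<Rightarrow> bool" where
  "supersol N b U \<delta> \<Phi> \<Phi>' \<Phi>'' \<longleftrightarrow>
     0 < \<delta> \<and> \<delta> < 1 \<and> continuous_on {-1..0} \<Phi>'' \<and> \<Phi> 0 \<le> U \<and> \<Phi>' 0 / Hp 0 ^ 3 - \<mu> * \<rho>0 * \<Phi> 0 > 0 \<and>
     (\<forall>p\<in>{-1..0}. (\<Phi> has_real_derivative \<Phi>' p) (at p within {-1..0}) \<and>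
        (\<Phi>' has_real_derivative \<Phi>'' p) (at p within {-1..0}) \<and> b \<le> \<Phi> p \<and>
        \<Phi>'' p - 3 * (Hpp p / Hp p) * \<Phi>' p - \<mu> * \<rho>p p * Hp p ^ 3 * \<Phi> p < 0 \<and>
        (p \<le> -1 + \<delta> \<longrightarrow> \<Phi>'' p + N * (1 + \<bar>\<Phi>' p\<bar> + \<Phi> p) < 0))"

text \<open>The linear profile is corrected twice. Adding
  \<open>\<epsilon> * (2 - exp (K0 * (p + 1)))\<close> makes it strict and positive down to the bed;
  subtracting \<open>b * exp (- K * (p + 1))\<close> makes it as concave as required near the bed.
  The second correction costs at most half of the lower bound \<epsilon>, so \<open>b\<close> and
  \<open>U\<close> do not depend on \<open>N\<close>.\<close>

lemma supersolution_exists: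
  assumes "\<rho> 0 = \<rho>0"
    and noeig: "\<And>m. 0 < m \<Longrightarrow> m \<le> \<mu> \<Longrightarrow> \<not> has_eigensolution Hp \<rho> \<rho>p m"
  obtains b U where "b > 0" "\<And>N. \<exists>\<delta> \<Phi> \<Phi>' \<Phi>''. supersol N b U \<delta> \<Phi> \<Phi>' \<Phi>''"
proof -
  obtain \<phi> \<phi>' \<phi>'' k where
    d: "\<And>p. p \<in> {-1..0} \<Longrightarrow> (\<phi> has_real_derivative \<phi>' p) (at p within {-1..0})"
      "\<And>p. p \<in> {-1..0} \<Longrightarrow> (\<phi>' has_real_derivative \<phi>'' p) (at p within {-1..0})"
    and c'': "continuous_on {-1..0} \<phi>''"
    and eq: "\<And>p. p \<in> {-1..0} \<Longrightarrow> \<phi>'' p - 3 * (Hpp p / Hp p) * \<phi>' p - \<mu> * \<rho>p p * Hp p ^ 3 * \<phi> p = 0"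
    and top: "\<phi>' 0 / Hp 0 ^ 3 - \<mu> * \<rho>0 * \<phi> 0 > 0"
    and k: "k > 0" "\<And>p. p \<in> {-1..0} \<Longrightarrow> k * (p + 1) \<le> \<phi> p"
    using linear_profile[OF assms(1) noeig] by blast
  define g where "g = (\<lambda>p. 3 * (Hpp p / Hp p))"
  define h where "h = (\<lambda>p. - (\<mu> * \<rho>p p * Hp p ^ 3))"
  have "continuous_on {-1..0} (\<lambda>p. \<bar>g p\<bar> + \<bar>h p\<bar>)"
    unfolding g_def h_def using Hp_pos
    by (intro continuous_intros Hp_cont Hpp_cont \<rho>p_cont) (auto simp: less_le)
  then obtain C where "C > 0" and C: "\<And>p. p \<in> {-1..0} \<Longrightarrow> \<bar>\<bar>g p\<bar> + \<bar>h p\<bar>\<bar> \<le> C"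
    using continuous_on_interval_bound by blast
  have h0: "h p \<ge> 0" if "p \<in> {-1..0}" for p
  proof -
    have "0 \<le> \<mu> * (- \<rho>p p) * Hp p ^ 3"
      using \<rho>p_le[OF that] \<mu>_pos Hp_pos[OF that] by (intro mult_nonneg_nonneg) auto
    then show ?thesis by (simp add: h_def)
  qed
  have gC: "\<bar>g p\<bar> \<le> C" and hC: "h p \<le> C" if "p \<in> {-1..0}" for p
    using C[OF that] by auto
  \<comment> \<open>With this value \<open>- K0^2 + C * K0 + C = - C - 4\<close>, so the second
    derivative of the exponential dominates the lower-order terms.\<close>
  define K0 where "K0 = C + 2"
  have K0: "K0 > 0" using \<open>C > 0\<close> by (simp add: K0_def)
  define T0 where "T0 = \<phi>' 0 / Hp 0 ^ 3 - \<mu> * \<rho>0 * \<phi> 0"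
  define D where "D = K0 * exp K0 / Hp 0 ^ 3 + 2 * \<mu> * \<rho>0"
  have Hp0: "Hp 0 > 0" using Hp_pos by simp
  have D: "D > 0" using K0 Hp0 \<mu>_pos \<rho>0_pos by (simp add: D_def add_pos_pos)
  \<comment> \<open>The first bound lets \<open>k * (p + 1) \<le> \<phi> p\<close> absorb the growth
    of the exponential away from the bed; the second spends at most half of the surface slack
    \<open>T0\<close>.\<close>
  define \<epsilon> where "\<epsilon> = min (k / (K0 * exp K0)) (T0 / (2 * D))"
  have \<epsilon>: "\<epsilon> > 0" using k K0 top D by (simp add: \<epsilon>_def T0_def)
  have "\<epsilon> \<le> k / (K0 * exp K0)" "\<epsilon> \<le> T0 / (2 * D)" by (simp_all add: \<epsilon>_def)
  then have \<epsilon>1: "\<epsilon> * (K0 * exp K0) \<le> k" and \<epsilon>2: "\<epsilon> * D \<le> T0 / 2"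
    using K0 D by (simp_all add: pos_le_divide_eq field_simps)
  define e where "e = (\<lambda>p::real. exp (K0 * (p + 1)))"
  have e1: "e p \<ge> 1" if "p \<in> {-1..0}" for p using that K0 by (simp add: e_def)
  define \<Phi>a \<Phi>a' \<Phi>a'' where "\<Phi>a = (\<lambda>p. \<phi> p + \<epsilon> * (2 - e p))"
    and "\<Phi>a' = (\<lambda>p. \<phi>' p - \<epsilon> * (K0 * e p))" and "\<Phi>a'' = (\<lambda>p. \<phi>'' p - \<epsilon> * (K0\<^sup>2 * e p))"
  have de: "(e has_real_derivative K0 * e p) (at p within S)" for p S
    unfolding e_def by (auto intro!: derivative_eq_intros)
  have da: "(\<Phi>a has_real_derivative \<Phi>a' p) (at p within {-1..0})" if "p \<in> {-1..0}" for p
    unfolding \<Phi>a_def by (rule derivative_eq_intros d(1)[OF that] de refl)+ (simp add: \<Phi>a'_def)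
  have da': "(\<Phi>a' has_real_derivative \<Phi>a'' p) (at p within {-1..0})" if "p \<in> {-1..0}" for p
    unfolding \<Phi>a'_def
    by (rule derivative_eq_intros d(2)[OF that] de refl)+ (simp add: \<Phi>a''_def power2_eq_square)
  have ce: "continuous_on {-1..0} e" unfolding e_def by (intro continuous_intros)
  have ca: "continuous_on {-1..0} \<Phi>a" "continuous_on {-1..0} \<Phi>a'" "continuous_on {-1..0} \<Phi>a''"
    using DERIV_continuous_on[OF da] DERIV_continuous_on[OF da']
    by (auto simp: \<Phi>a''_def intro!: continuous_intros c'' ce)
  have "continuous_on {-1..0} (\<lambda>p. \<bar>\<Phi>a p\<bar> + \<bar>\<Phi>a' p\<bar> + \<bar>\<Phi>a'' p\<bar>)"
    by (intro continuous_intros ca)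
  then obtain C1 where "C1 > 0" and C1': "\<And>p. p \<in> {-1..0} \<Longrightarrow> \<bar>\<bar>\<Phi>a p\<bar> + \<bar>\<Phi>a' p\<bar> + \<bar>\<Phi>a'' p\<bar>\<bar> \<le> C1"
    using continuous_on_interval_bound by blast
  have C1: "\<bar>\<Phi>a p\<bar> \<le> C1" "\<bar>\<Phi>a' p\<bar> \<le> C1" "\<bar>\<Phi>a'' p\<bar> \<le> C1" if "p \<in> {-1..0}" for p
    using C1'[OF that] by linarith+
  have a_ge: "\<epsilon> \<le> \<Phi>a p" if p: "p \<in> {-1..0}" for p
  proof -
    define x where "x = K0 * (p + 1)"
    have "0 \<le> x" "x \<le> K0" using p K0 by (auto simp: x_def mult_le_cancel_left1)
    have "1 - x \<le> exp (- x)" using exp_ge_add_one_self[of "- x"] by simp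
    then have "(1 - x) * exp x \<le> exp (- x) * exp x" by (intro mult_right_mono) auto
    then have "exp x - 1 \<le> x * exp x" by (simp add: algebra_simps exp_minus)
    also have "\<dots> \<le> x * exp K0" using \<open>0 \<le> x\<close> \<open>x \<le> K0\<close> by (intro mult_left_mono) auto
    finally have "\<epsilon> * (e p - 1) \<le> \<epsilon> * (x * exp K0)" using \<epsilon> by (simp add: e_def x_def)
    also have "\<dots> = (\<epsilon> * (K0 * exp K0)) * (p + 1)" by (simp add: x_def)
    also have "\<dots> \<le> k * (p + 1)" using \<epsilon>1 p by (intro mult_right_mono) auto
    also have "\<dots> \<le> \<phi> p" using k(2)[OF p] .
    finally show ?thesis by (simp add: \<Phi>a_def algebra_simps)
  qed
  have a_int: "\<Phi>a'' p - g p * \<Phi>a' p + h p * \<Phi>a p < 0" if p: "p \<in> {-1..0}" for p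
  proof -
    have "\<Phi>a'' p - g p * \<Phi>a' p + h p * \<Phi>a p
        = (\<phi>'' p - g p * \<phi>' p + h p * \<phi> p) + \<epsilon> * (- (K0\<^sup>2 * e p) + g p * (K0 * e p) + h p * (2 - e p))"
      by (simp add: \<Phi>a_def \<Phi>a'_def \<Phi>a''_def algebra_simps)
    also have "\<phi>'' p - g p * \<phi>' p + h p * \<phi> p = 0" using eq[OF p] by (simp add: g_def h_def)
    finally have 1: "\<Phi>a'' p - g p * \<Phi>a' p + h p * \<Phi>a p
        = \<epsilon> * (- (K0\<^sup>2 * e p) + g p * (K0 * e p) + h p * (2 - e p))" by simp
    have "g p * (K0 * e p) \<le> C * (K0 * e p)"
      using gC[OF p] K0 by (intro mult_right_mono) (auto simp: e_def)
    moreover have "h p * (2 - e p) \<le> C * e p"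
    proof -
      have "h p * (2 - e p) \<le> h p * e p" using e1[OF p] h0[OF p] by (intro mult_left_mono) auto
      also have "\<dots> \<le> C * e p" using hC[OF p] by (intro mult_right_mono) (auto simp: e_def)
      finally show ?thesis .
    qed
    ultimately have "- (K0\<^sup>2 * e p) + g p * (K0 * e p) + h p * (2 - e p) \<le> e p * (- K0\<^sup>2 + C * K0 + C)"
      by (simp add: algebra_simps)
    also have "- K0\<^sup>2 + C * K0 + C = - C - 4" by (simp add: K0_def power2_eq_square algebra_simps)
    also have "e p * (- C - 4) < 0" using \<open>C > 0\<close> by (intro mult_pos_neg) (auto simp: e_def)
    finally show ?thesis unfolding 1 using \<epsilon> by (intro mult_pos_neg)
  qed
  have a_top: "\<Phi>a' 0 / Hp 0 ^ 3 - \<mu> * \<rho>0 * \<Phi>a 0 > 0"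
  proof -
    have "\<Phi>a' 0 / Hp 0 ^ 3 - \<mu> * \<rho>0 * \<Phi>a 0 = T0 - \<epsilon> * D + \<epsilon> * (\<mu> * \<rho>0 * exp K0)"
      by (simp add: \<Phi>a'_def \<Phi>a_def T0_def D_def e_def diff_divide_distrib algebra_simps)
    moreover have "\<epsilon> * (\<mu> * \<rho>0 * exp K0) > 0" using \<epsilon> \<mu>_pos \<rho>0_pos by simp
    ultimately show ?thesis using \<epsilon>2 top by (simp add: T0_def)
  qed
  have "\<exists>\<delta> \<Phi> \<Phi>' \<Phi>''. supersol N (\<epsilon> / 2) (\<Phi>a 0) \<delta> \<Phi> \<Phi>' \<Phi>''" for N
  proof -
    define E where "E = exp (1::real)"
    define N' where "N' = \<bar>N\<bar>"
    define b where "b = \<epsilon> / 2"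
    have b: "b > 0" using \<epsilon> by (simp add: b_def)
    define Z where "Z = C1 + N' * (1 + 2 * C1)"
    \<comment> \<open>\<open>K \<ge> C\<close> keeps the subtracted layer from spoiling the
      differential inequality; \<open>E * (N' + 1)\<close> makes its concavity
      \<open>b * K^2 / E\<close> beat the gradient cost \<open>b * K * N'\<close> with
      \<open>b * K\<close> to spare; the last entry pays for the remaining constants from that
      surplus. The layer has width \<open>1 / K\<close>, where the exponential is still at least
      \<open>1 / E\<close>.\<close>
    define K where "K = Max {C, 2, E * (N' + 1), (Z + 1) / b}"
    have K: "K \<ge> C" "K \<ge> 2" "K \<ge> E * (N' + 1)" "K \<ge> (Z + 1) / b" by (auto simp: K_def)
    define \<beta> where "\<beta> = (\<lambda>p::real. exp (- K * (p + 1)))"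
    have d\<beta>: "(\<beta> has_real_derivative - K * \<beta> p) (at p within S)" for p S
      unfolding \<beta>_def by (auto intro!: derivative_eq_intros)
    have \<beta>: "\<beta> p > 0" "p \<in> {-1..0} \<Longrightarrow> \<beta> p \<le> 1" for p using K(2) by (auto simp: \<beta>_def)
    have "supersol N b (\<Phi>a 0) (1 / K) (\<lambda>p. \<Phi>a p - b * \<beta> p) (\<lambda>p. \<Phi>a' p + b * (K * \<beta> p)) (\<lambda>p. \<Phi>a'' p - b * (K\<^sup>2 * \<beta> p))"
      unfolding supersol_def
    proof (intro conjI ballI impI)
      show "0 < 1 / K" "1 / K < 1" using K(2) by auto
      show "continuous_on {-1..0} (\<lambda>p. \<Phi>a'' p - b * (K\<^sup>2 * \<beta> p))"
        unfolding \<beta>_def by (intro continuous_intros ca)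
      show "\<Phi>a 0 - b * \<beta> 0 \<le> \<Phi>a 0" using b \<beta>(1)[of 0] by simp
      have "b * (K * \<beta> 0) / Hp 0 ^ 3 > 0" "\<mu> * \<rho>0 * (b * \<beta> 0) > 0"
        using b K(2) \<beta>(1)[of 0] Hp0 \<mu>_pos \<rho>0_pos by simp_all
      then show "(\<Phi>a' 0 + b * (K * \<beta> 0)) / Hp 0 ^ 3 - \<mu> * \<rho>0 * (\<Phi>a 0 - b * \<beta> 0) > 0"
        using a_top by (simp add: add_divide_distrib right_diff_distrib)
    next
      fix p :: real assume p: "p \<in> {-1..0}"
      show "((\<lambda>p. \<Phi>a p - b * \<beta> p) has_real_derivative \<Phi>a' p + b * (K * \<beta> p)) (at p within {-1..0})"
        by (rule derivative_eq_intros da[OF p] d\<beta> refl)+ simp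
      show "((\<lambda>p. \<Phi>a' p + b * (K * \<beta> p)) has_real_derivative \<Phi>a'' p - b * (K\<^sup>2 * \<beta> p)) (at p within {-1..0})"
        by (rule derivative_eq_intros da'[OF p] d\<beta> refl)+ (simp add: power2_eq_square)
      have b\<beta>: "b * \<beta> p \<le> b" using b \<beta>(2)[OF p] by simp
      then show "b \<le> \<Phi>a p - b * \<beta> p" using a_ge[OF p] by (simp add: b_def)
      have "K * (K + g p) \<ge> 0" using gC[OF p] K(1,2) by (intro mult_nonneg_nonneg) linarith+
      then have "b * \<beta> p * (K * (K + g p) + h p) \<ge> 0"
        using h0[OF p] b \<beta>(1)[of p] by (intro mult_nonneg_nonneg) auto
      moreover have "\<Phi>a'' p - b * (K\<^sup>2 * \<beta> p) - g p * (\<Phi>a' p + b * (K * \<beta> p)) + h p * (\<Phi>a p - b * \<beta> p)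
          = (\<Phi>a'' p - g p * \<Phi>a' p + h p * \<Phi>a p) - b * \<beta> p * (K * (K + g p) + h p)"
        by (simp add: algebra_simps power2_eq_square)
      ultimately have "\<Phi>a'' p - b * (K\<^sup>2 * \<beta> p) - g p * (\<Phi>a' p + b * (K * \<beta> p)) + h p * (\<Phi>a p - b * \<beta> p) < 0"
        using a_int[OF p] by linarith
      then show "\<Phi>a'' p - b * (K\<^sup>2 * \<beta> p) - 3 * (Hpp p / Hp p) * (\<Phi>a' p + b * (K * \<beta> p))
          - \<mu> * \<rho>p p * Hp p ^ 3 * (\<Phi>a p - b * \<beta> p) < 0"
        by (simp add: g_def h_def)
      assume pK: "p \<le> -1 + 1 / K"
      then have "K * (p + 1) \<le> 1" using K(2) by (simp add: field_simps)
      then have "1 / E \<le> \<beta> p" by (simp add: E_def \<beta>_def exp_minus[symmetric] inverse_eq_divide[symmetric])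
      then have "b * (K\<^sup>2 * (1 / E)) \<le> b * (K\<^sup>2 * \<beta> p)" using b by (intro mult_left_mono) auto
      moreover have "b * K * (N' + 1) \<le> b * (K\<^sup>2 * (1 / E))"
      proof -
        have "N' + 1 \<le> K / E" using K(3) by (simp add: E_def field_simps)
        then have "b * K * (N' + 1) \<le> b * K * (K / E)" using b K(2) by (intro mult_left_mono) auto
        then show ?thesis by (simp add: power2_eq_square)
      qed
      moreover have "b * K \<ge> Z + 1" using K(4) b by (simp add: field_simps)
      moreover have "N * (1 + \<bar>\<Phi>a' p + b * (K * \<beta> p)\<bar> + (\<Phi>a p - b * \<beta> p)) \<le> N' * (1 + (C1 + b * K) + C1)"
      proof -
        have "b * (K * \<beta> p) \<le> b * K" "b * (K * \<beta> p) \<ge> 0"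
          using b K(2) \<beta>(1)[of p] \<beta>(2)[OF p] by (auto simp: mult_left_le)
        then have 1: "\<bar>\<Phi>a' p + b * (K * \<beta> p)\<bar> \<le> C1 + b * K" using C1(2)[OF p] by linarith
        have 2: "b * \<beta> p > 0" "\<Phi>a p \<le> C1" "\<epsilon> \<le> \<Phi>a p" using b \<beta>(1)[of p] C1(1)[OF p] a_ge[OF p] by auto
        have "N * (1 + \<bar>\<Phi>a' p + b * (K * \<beta> p)\<bar> + (\<Phi>a p - b * \<beta> p))
            \<le> N' * (1 + \<bar>\<Phi>a' p + b * (K * \<beta> p)\<bar> + (\<Phi>a p - b * \<beta> p))"
        proof (rule mult_right_mono)
          have "b * \<beta> p \<le> \<Phi>a p" using b\<beta> 2(3) \<epsilon> b_def by linarith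
          then show "0 \<le> 1 + \<bar>\<Phi>a' p + b * (K * \<beta> p)\<bar> + (\<Phi>a p - b * \<beta> p)" by linarith
        qed (simp add: N'_def)
        also have "\<dots> \<le> N' * (1 + (C1 + b * K) + C1)"
          using 1 2 by (intro mult_left_mono) (auto simp: N'_def)
        finally show ?thesis .
      qed
      moreover have "b * K * (N' + 1) = b * K * N' + b * K" "N' * (1 + (C1 + b * K) + C1) = Z - C1 + b * K * N'"
        by (simp_all add: algebra_simps Z_def)
      ultimately show "\<Phi>a'' p - b * (K\<^sup>2 * \<beta> p) + N * (1 + \<bar>\<Phi>a' p + b * (K * \<beta> p)\<bar> + (\<Phi>a p - b * \<beta> p)) < 0"
        using C1(3)[OF p] by linarith
    qed
    then show ?thesis unfolding b_def by blast
  qed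
  then show thesis using that[of "\<epsilon> / 2" "\<Phi>a 0"] \<epsilon> by auto
qed

end

section \<open>Comparison of two solutions\<close>

lemma has_derivative_strip_affine:
  fixes f :: "real \<Rightarrow> real \<Rightarrow> real"
  assumes "((\<lambda>y. f (fst y) (snd y)) has_derivative (\<lambda>d. a * fst d + b * snd d))
      (at (s * fst z + k, snd z) within strip)"
  shows "((\<lambda>y. f (s * fst y + k) (snd y)) has_derivative (\<lambda>d. (s * a) * fst d + b * snd d)) (at z within strip)"
proof -
  let ?T = "\<lambda>y::real \<times> real. (s * fst y + k, snd y)"
  have T: "(?T has_derivative (\<lambda>d. (s * fst d, snd d))) (at z within strip)"
    by (auto intro!: derivative_eq_intros)
  have "?T ` strip \<subseteq> strip" by (auto simp: strip_def)
  then have "((\<lambda>y. f (fst y) (snd y)) has_derivative (\<lambda>d. a * fst d + b * snd d)) (at (?T z) within ?T ` strip)"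
    using assms has_derivative_subset by blast
  from has_derivative_in_compose[OF T this] show ?thesis
    by (auto simp: mult_ac elim!: has_derivative_eq_rhs)
qed

lemma C2_strip_affine:
  assumes C: "C2_strip w wq wp wqq wqp wpq wpp" and s: "s * s = 1"
  shows "C2_strip (\<lambda>q p. w (s * q + k) p) (\<lambda>q p. s * wq (s * q + k) p) (\<lambda>q p. wp (s * q + k) p)
      (\<lambda>q p. wqq (s * q + k) p) (\<lambda>q p. s * wqp (s * q + k) p) (\<lambda>q p. s * wpq (s * q + k) p)
      (\<lambda>q p. wpp (s * q + k) p)"
  unfolding C2_strip_def
proof (intro conjI ballI)
  fix z :: "real \<times> real" assume "z \<in> strip"
  then have "(s * fst z + k, snd z) \<in> strip" by (simp add: strip_def)
  note d = C[unfolded C2_strip_def, THEN conjunct1, rule_format, OF this]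
  show "((\<lambda>y. w (s * fst y + k) (snd y)) has_derivative
      (\<lambda>d. s * wq (s * fst z + k) (snd z) * fst d + wp (s * fst z + k) (snd z) * snd d)) (at z within strip)"
    using d by (intro has_derivative_strip_affine) simp
  show "((\<lambda>y. wp (s * fst y + k) (snd y)) has_derivative
      (\<lambda>d. s * wpq (s * fst z + k) (snd z) * fst d + wpp (s * fst z + k) (snd z) * snd d)) (at z within strip)"
    using d by (intro has_derivative_strip_affine) simp
  have "((\<lambda>y. wq (s * fst y + k) (snd y)) has_derivative
      (\<lambda>d. s * wqq (s * fst z + k) (snd z) * fst d + wqp (s * fst z + k) (snd z) * snd d)) (at z within strip)"
    using d by (intro has_derivative_strip_affine) simp
  from has_derivative_plane_cmult[OF this, of s]
  show "((\<lambda>y. s * wq (s * fst y + k) (snd y)) has_derivative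
      (\<lambda>d. wqq (s * fst z + k) (snd z) * fst d + s * wqp (s * fst z + k) (snd z) * snd d)) (at z within strip)"
    using s by (simp add: mult.assoc[symmetric])
next
  have c: "continuous_on strip (\<lambda>y. g (s * fst y + k) (snd y))"
    if "g \<in> {w, wq, wp, wqq, wqp, wpq, wpp}" for g
  proof -
    have "continuous_on strip (\<lambda>y. (\<lambda>z. g (fst z) (snd z)) (s * fst y + k, snd y))"
      by (rule continuous_on_compose2[of strip])
        (use C that in \<open>auto simp: C2_strip_def strip_def intro!: continuous_intros\<close>)
    then show ?thesis by simp
  qed
  note cs = c[of w, simplified] c[of wq, simplified] c[of wp, simplified] c[of wqq, simplified]
    c[of wqp, simplified] c[of wpq, simplified] c[of wpp, simplified]
  fix g assume "g \<in> {\<lambda>q p. w (s * q + k) p, \<lambda>q p. s * wq (s * q + k) p, \<lambda>q p. wp (s * q + k) p,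
      \<lambda>q p. wqq (s * q + k) p, \<lambda>q p. s * wqp (s * q + k) p, \<lambda>q p. s * wpq (s * q + k) p,
      \<lambda>q p. wpp (s * q + k) p}"
  then show "continuous_on strip (\<lambda>y. g (fst y) (snd y))"
    by (elim insertE emptyE) (simp_all only: cs continuous_on_mult_left)
qed

context height_problem
begin

text \<open>Every term of the equation and of the surface condition contains an even number of
  \<open>q\<close>-derivatives, so the sign \<open>s\<close> cancels.\<close>

lemma hsol_affine:
  assumes h: "hsol w wq wp wqq wqp wpq wpp" and s: "s = 1 \<or> s = -1"
  shows "hsol (\<lambda>q p. w (s * q + k) p) (\<lambda>q p. s * wq (s * q + k) p) (\<lambda>q p. wp (s * q + k) p)
      (\<lambda>q p. wqq (s * q + k) p) (\<lambda>q p. s * wqp (s * q + k) p) (\<lambda>q p. s * wpq (s * q + k) p)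
      (\<lambda>q p. wpp (s * q + k) p)"
proof -
  have ss: "s * s = 1" using s by auto
  have C: "C2_strip w wq wp wqq wqp wpq wpp" using h by (simp add: hsol_def)
  show ?thesis
    unfolding hsol_def
  proof (intro conjI)
    show "C2_strip (\<lambda>q p. w (s * q + k) p) (\<lambda>q p. s * wq (s * q + k) p) (\<lambda>q p. wp (s * q + k) p)
      (\<lambda>q p. wqq (s * q + k) p) (\<lambda>q p. s * wqp (s * q + k) p) (\<lambda>q p. s * wpq (s * q + k) p)
      (\<lambda>q p. wpp (s * q + k) p)"
      by (rule C2_strip_affine[OF C ss])
  qed (use h s in \<open>auto simp: hsol_def algebra_simps\<close>)
qed

text \<open>The quotient by \<open>P\<close> attains its minimum although the half-strip is
  unbounded: far to the left \<open>w1\<close> is nonnegative and \<open>w2\<close> is small, so the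
  quotient lies above its value at the given negative point. On the lateral line and on the bed the
  difference vanishes. Thus \<open>- m * P\<close> touches the difference from below.\<close>

lemma negative_minimum:
  assumes s1: "hsol w1 w1q w1p w1qq w1qp w1pq w1pp" and s2: "hsol w2 w2q w2p w2qq w2qp w2pq w2pp"
    and w1: "\<And>q p. -1 \<le> p \<Longrightarrow> p \<le> 0 \<Longrightarrow> w1 q p \<ge> 0"
    and dec: "\<And>e. e > 0 \<Longrightarrow> \<exists>Q. \<forall>q\<le>Q. \<forall>p\<in>{-1..0}. \<bar>w2 q p\<bar> < e"
    and lat: "\<And>p. -1 \<le> p \<Longrightarrow> p \<le> 0 \<Longrightarrow> w1 l p = w2 l p"
    and P: "continuous_on strip (\<lambda>z. P (fst z) (snd z))"
    and b: "b > 0" "\<And>q p. q \<le> l \<Longrightarrow> -1 \<le> p \<Longrightarrow> p \<le> 0 \<Longrightarrow> b \<le> P q p"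
    and neg: "q1 \<le> l" "-1 \<le> p1" "p1 \<le> 0" "w1 q1 p1 < w2 q1 p1"
  obtains m q p where "m > 0" "q < l" "-1 < p" "p \<le> 0" "w1 q p - w2 q p = - m * P q p"
    "\<And>q' p'. q' \<le> l \<Longrightarrow> -1 \<le> p' \<Longrightarrow> p' \<le> 0 \<Longrightarrow> 0 \<le> w1 q' p' - w2 q' p' + m * P q' p'"
proof -
  define f where "f = (\<lambda>q p. (w1 q p - w2 q p) / P q p)"
  have Ppos: "P q p > 0" if "q \<le> l" "-1 \<le> p" "p \<le> 0" for q p using b that by force
  define r where "r = - f q1 p1"
  have r: "r > 0" using neg Ppos[of q1 p1] by (simp add: r_def f_def field_simps)
  obtain Q where Q: "\<And>q p. q \<le> Q \<Longrightarrow> p \<in> {-1..0} \<Longrightarrow> \<bar>w2 q p\<bar> < r * b"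
    using dec[of "r * b"] r b(1) by (meson mult_pos_pos)
  have far: "f q p > - r" if "q \<le> Q" "q \<le> l" "-1 \<le> p" "p \<le> 0" for q p
  proof -
    have "w1 q p - w2 q p > - (r * b)" using w1[of p q] Q[of q p] that by auto
    moreover have "r * b \<le> r * P q p" using r b(2)[of q p] that by (intro mult_left_mono) auto
    ultimately have "w1 q p - w2 q p > - r * P q p" by simp
    then show ?thesis using Ppos[of q p] that by (simp add: f_def pos_less_divide_eq)
  qed
  let ?S = "{Q..l} \<times> {-1..0::real}"
  have Q1: "Q \<le> q1" using far[of q1 p1] neg by (force simp: r_def)
  have sub: "?S \<subseteq> strip" by (auto simp: strip_def)
  have "continuous_on ?S (\<lambda>z. f (fst z) (snd z))"
    unfolding f_def using Ppos
    by (intro continuous_intros continuous_on_subset[OF hsol_cont(1)[OF s1] sub]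
        continuous_on_subset[OF hsol_cont(1)[OF s2] sub] continuous_on_subset[OF P sub]) (force simp: less_le)
  moreover have "(q1, p1) \<in> ?S" using Q1 neg by simp
  ultimately obtain z where z: "z \<in> ?S" "\<And>y. y \<in> ?S \<Longrightarrow> f (fst z) (snd z) \<le> f (fst y) (snd y)"
    using continuous_attains_inf[of ?S "\<lambda>z. f (fst z) (snd z)"] compact_Times[OF compact_Icc compact_Icc] by blast
  obtain q p where qp: "z = (q, p)" by (cases z)
  define m where "m = - f q p"
  have fr: "f q p \<le> - r" using z(2)[of "(q1, p1)"] Q1 neg qp by (simp add: r_def)
  have m: "m > 0" using fr r by (simp add: m_def)
  have qp': "q \<le> l" "-1 \<le> p" "p \<le> 0" using z(1) qp by auto
  have eq: "w1 q p - w2 q p = - m * P q p" using Ppos[OF qp'] by (simp add: m_def f_def)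
  then have lt: "w1 q p - w2 q p < 0" using m Ppos[OF qp'] by simp
  show thesis
  proof
    show "m > 0" by fact
    show "q < l" using lat[of p] lt qp' by (cases "q = l") auto
    have "w1 q (-1) = w2 q (-1)" using s1 s2 by (simp add: hsol_def)
    then show "-1 < p" using lt qp' by (cases "p = -1") auto
    show "p \<le> 0" by fact
    show "w1 q p - w2 q p = - m * P q p" by fact
    show "0 \<le> w1 q' p' - w2 q' p' + m * P q' p'" if "q' \<le> l" "-1 \<le> p'" "p' \<le> 0" for q' p'
    proof -
      have "f q' p' \<ge> - m"
      proof (cases "q' \<le> Q")
        case True then show ?thesis using far[OF True that] fr by (simp add: m_def)
      next
        case False then show ?thesis using z(2)[of "(q', p')"] that qp by (simp add: m_def)
      qed
      then show ?thesis using Ppos[OF that] by (simp add: f_def pos_le_divide_eq)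
    qed
  qed
qed

text \<open>Closeness to the trivial flow, for which \<open>x = Hp p\<close> and
  \<open>y = 0\<close>, and of the comparison function to \<Phi>, stated for bare numbers so that a
  sequence of counterexamples can be extracted. \<open>B\<close> and \<open>Pqp\<close> stand for
  sums of two mixed derivatives, hence \<open>2 * \<epsilon>\<close>.\<close>

definition near :: "(real \<Rightarrow> real) \<Rightarrow> (real \<Rightarrow> real) \<Rightarrow> (real \<Rightarrow> real) \<Rightarrow> real \<Rightarrow> real \<Rightarrow> real \<Rightarrow> real \<Rightarrow>
    real \<Rightarrow> real \<Rightarrow> real \<Rightarrow> real \<Rightarrow> real \<Rightarrow> real \<Rightarrow> real \<Rightarrow> real \<Rightarrow> real \<Rightarrow> real \<Rightarrow> bool" where
  "near \<Phi> \<Phi>' \<Phi>'' \<epsilon> p x y A B C u P Pq Pp Pqq Pqp Ppp \<longleftrightarrow>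
     p \<in> {-1..0} \<and> \<bar>x - Hp p\<bar> \<le> \<epsilon> \<and> \<bar>y\<bar> \<le> \<epsilon> \<and> \<bar>A\<bar> \<le> \<epsilon> \<and> \<bar>B\<bar> \<le> 2 * \<epsilon> \<and> \<bar>C\<bar> \<le> \<epsilon> \<and> \<bar>u\<bar> \<le> \<epsilon> \<and>
     \<bar>P - \<Phi> p\<bar> \<le> \<epsilon> \<and> \<bar>Pq\<bar> \<le> \<epsilon> \<and> \<bar>Pp - \<Phi>' p\<bar> \<le> \<epsilon> \<and> \<bar>Pqq\<bar> \<le> \<epsilon> \<and> \<bar>Pqp\<bar> \<le> 2 * \<epsilon> \<and> \<bar>Ppp - \<Phi>'' p\<bar> \<le> \<epsilon>"

lemma near_mono:
  assumes "near \<Phi> \<Phi>' \<Phi>'' \<epsilon> p x y A B C u P Pq Pp Pqq Pqp Ppp" "\<epsilon> \<le> \<epsilon>'"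
  shows "near \<Phi> \<Phi>' \<Phi>'' \<epsilon>' p x y A B C u P Pq Pp Pqq Pqp Ppp"
proof -
  have "2 * \<epsilon> \<le> 2 * \<epsilon>'" using assms(2) by simp
  then show ?thesis using assms(1) unfolding near_def by (meson assms(2) order_trans)
qed

text \<open>The factor \<open>m\<close> is split off exactly, so that the bracket stays meaningful
  as \<open>m\<close> tends to 0; its limit at the trivial flow is minus the linearized operator
  applied to \<Phi>.\<close>

lemma defect_scaled:
  "defect p (x - m * Pp) (y - m * Pq) x y (- m * Pqq) (- m * Pqp) (- m * Ppp) A B C (u - m * P) u =
   m * (- (x - m * Pp)\<^sup>2 * Pqq + (x - m * Pp) * (y - m * Pq) * Pqp - (1 + (y - m * Pq)\<^sup>2) * Ppp
     - Pp * (x - m * Pp + x) * A + (Pp * (y - m * Pq) + x * Pq) * B - Pq * (y - m * Pq + y) * (Hpp p + C)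
     + Pp * ((x - m * Pp)\<^sup>2 + (x - m * Pp) * x + x\<^sup>2) * (Hpp p / Hp p ^ 3)
     + \<mu> * \<rho>p p * ((x - m * Pp) ^ 3 * P + Pp * ((x - m * Pp)\<^sup>2 + (x - m * Pp) * x + x\<^sup>2) * u))"
  unfolding defect_def by algebra

text \<open>Compactness: a failing sequence with \<epsilon> = 1 / n has a subsequence whose depths
  converge to some \<open>p0\<close>. All arguments tend to those of the trivial flow, so the
  bracket of \<open>defect_scaled\<close> would have a nonpositive limit, against the strictness of
  the supersolution at \<open>p0\<close>.\<close>

lemma far_field_interior:
  assumes super: "supersol N b U \<delta> \<Phi> \<Phi>' \<Phi>''" and b: "b > 0"
  shows "\<exists>\<epsilon>>0. \<forall>p x y A B C u P Pq Pp Pqq Pqp Ppp m. near \<Phi> \<Phi>' \<Phi>'' \<epsilon> p x y A B C u P Pq Pp Pqq Pqp Ppp \<longrightarrow>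
       0 < m \<longrightarrow> m * P \<le> \<epsilon> \<longrightarrow>
       0 < defect p (x - m * Pp) (y - m * Pq) x y (- m * Pqq) (- m * Pqp) (- m * Ppp) A B C (u - m * P) u"
proof (rule ccontr)
  assume neg: "\<not> ?thesis"
  have "\<exists>p x y A B C u P Pq Pp Pqq Pqp Ppp m.
      near \<Phi> \<Phi>' \<Phi>'' (1 / Suc n) p x y A B C u P Pq Pp Pqq Pqp Ppp \<and> 0 < m \<and> m * P \<le> 1 / Suc n \<and>
      \<not> 0 < defect p (x - m * Pp) (y - m * Pq) x y (- m * Pqq) (- m * Pqp) (- m * Ppp) A B C (u - m * P) u"
    for n :: nat
  proof -
    have "1 / real (Suc n) > 0" by simp
    with neg show ?thesis by (simp only: not_ex not_all not_imp de_Morgan_conj) blast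
  qed
  then have "\<forall>n::nat. \<exists>p x y A B C u P Pq Pp Pqq Pqp Ppp m.
      near \<Phi> \<Phi>' \<Phi>'' (1 / Suc n) p x y A B C u P Pq Pp Pqq Pqp Ppp \<and> 0 < m \<and> m * P \<le> 1 / Suc n \<and>
      defect p (x - m * Pp) (y - m * Pq) x y (- m * Pqq) (- m * Pqp) (- m * Ppp) A B C (u - m * P) u \<le> 0"
    unfolding not_less by (rule allI)
  then obtain p x y A B C u P Pq Pp Pqq Pqp Ppp m where
    S: "\<And>n::nat. near \<Phi> \<Phi>' \<Phi>'' (1 / Suc n) (p n) (x n) (y n) (A n) (B n) (C n) (u n) (P n) (Pq n) (Pp n) (Pqq n) (Pqp n) (Ppp n)"
    and m: "\<And>n::nat. 0 < m n" "\<And>n. m n * P n \<le> 1 / Suc n"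
    and D: "\<And>n::nat. defect (p n) (x n - m n * Pp n) (y n - m n * Pq n) (x n) (y n) (- m n * Pqq n) (- m n * Pqp n)
       (- m n * Ppp n) (A n) (B n) (C n) (u n - m n * P n) (u n) \<le> 0"
    unfolding choice_iff by blast
  have pin: "p n \<in> {-1..0}" for n using S[of n] by (simp add: near_def)
  then obtain p0 \<sigma> where p0: "p0 \<in> {-1..0}" and \<sigma>: "strict_mono \<sigma>" and lim: "(p \<circ> \<sigma>) \<longlonglongrightarrow> p0"
    using compact_Icc[of "-1::real" 0] unfolding compact_def by blast
  have null: "(\<lambda>n. 1 / real (Suc (\<sigma> n))) \<longlonglongrightarrow> 0"
    using LIMSEQ_subseq_LIMSEQ[OF LIMSEQ_inverse_real_of_nat \<sigma>] by (simp add: comp_def inverse_eq_divide)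
  have null2: "(\<lambda>n. 2 * (1 / real (Suc (\<sigma> n)))) \<longlonglongrightarrow> 0"
    using tendsto_mult_right_zero[OF null] .
  have bnd: "(\<lambda>n. f (\<sigma> n)) \<longlonglongrightarrow> 0" if "\<And>n::nat. \<bar>f n\<bar> \<le> 2 * (1 / Suc n)" for f :: "nat \<Rightarrow> real"
    by (rule tendsto_rabs_zero_cancel, rule tendsto_sandwich[OF _ _ tendsto_const null2])
      (use that in auto)
  have cc: "(\<lambda>n. f (p (\<sigma> n))) \<longlonglongrightarrow> f p0" if "continuous_on {-1..0} f" for f :: "real \<Rightarrow> real"
    using continuous_on_tendsto_compose[OF that lim p0] pin by (simp add: comp_def)
  have c\<Phi>: "continuous_on {-1..0} \<Phi>" "continuous_on {-1..0} \<Phi>'" "continuous_on {-1..0} \<Phi>''"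
    using super by (auto simp: supersol_def intro!: DERIV_continuous_on)
  have shift: "(\<lambda>n. g (\<sigma> n)) \<longlonglongrightarrow> f p0"
    if "continuous_on {-1..0} f" "\<And>n::nat. \<bar>g n - f (p n)\<bar> \<le> 2 * (1 / Suc n)" for f :: "real \<Rightarrow> real" and g
    using tendsto_add[OF bnd[of "\<lambda>n. g n - f (p n)", OF that(2)] cc[OF that(1)]] by simp
  have LB: "\<bar>x n - Hp (p n)\<bar> \<le> 2 * (1 / Suc n)" "\<bar>P n - \<Phi> (p n)\<bar> \<le> 2 * (1 / Suc n)"
    "\<bar>Pp n - \<Phi>' (p n)\<bar> \<le> 2 * (1 / Suc n)" "\<bar>Ppp n - \<Phi>'' (p n)\<bar> \<le> 2 * (1 / Suc n)"
    "\<bar>y n\<bar> \<le> 2 * (1 / Suc n)" "\<bar>A n\<bar> \<le> 2 * (1 / Suc n)" "\<bar>B n\<bar> \<le> 2 * (1 / Suc n)"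
    "\<bar>C n\<bar> \<le> 2 * (1 / Suc n)" "\<bar>u n\<bar> \<le> 2 * (1 / Suc n)" "\<bar>Pq n\<bar> \<le> 2 * (1 / Suc n)"
    "\<bar>Pqq n\<bar> \<le> 2 * (1 / Suc n)" "\<bar>Pqp n\<bar> \<le> 2 * (1 / Suc n)" for n :: nat
  proof -
    have "0 \<le> 1 / real (Suc n)" by simp
    then have up: "t \<le> 1 / real (Suc n) \<Longrightarrow> t \<le> 2 * (1 / real (Suc n))" for t by linarith
    from S[of n] show "\<bar>x n - Hp (p n)\<bar> \<le> 2 * (1 / Suc n)" "\<bar>P n - \<Phi> (p n)\<bar> \<le> 2 * (1 / Suc n)"
      "\<bar>Pp n - \<Phi>' (p n)\<bar> \<le> 2 * (1 / Suc n)" "\<bar>Ppp n - \<Phi>'' (p n)\<bar> \<le> 2 * (1 / Suc n)"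
      "\<bar>y n\<bar> \<le> 2 * (1 / Suc n)" "\<bar>A n\<bar> \<le> 2 * (1 / Suc n)" "\<bar>B n\<bar> \<le> 2 * (1 / Suc n)"
      "\<bar>C n\<bar> \<le> 2 * (1 / Suc n)" "\<bar>u n\<bar> \<le> 2 * (1 / Suc n)" "\<bar>Pq n\<bar> \<le> 2 * (1 / Suc n)"
      "\<bar>Pqq n\<bar> \<le> 2 * (1 / Suc n)" "\<bar>Pqp n\<bar> \<le> 2 * (1 / Suc n)"
      unfolding near_def by (blast intro: up)+
  qed
  note L = shift[OF Hp_cont LB(1)] shift[OF c\<Phi>(1) LB(2)] shift[OF c\<Phi>(2) LB(3)] shift[OF c\<Phi>(3) LB(4)]
    bnd[of y, OF LB(5)] bnd[of A, OF LB(6)] bnd[of B, OF LB(7)] bnd[of C, OF LB(8)] bnd[of u, OF LB(9)]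
    bnd[of Pq, OF LB(10)] bnd[of Pqq, OF LB(11)] bnd[of Pqp, OF LB(12)]
  \<comment> \<open>The touching height \<open>m * P\<close> tends to 0 while \<open>P\<close> stays
    near \<open>\<Phi> \<ge> b\<close>, which forces the multiplier itself to 0.\<close>
  have Lm: "(\<lambda>n. m (\<sigma> n)) \<longlonglongrightarrow> 0"
  proof -
    have \<Phi>b: "\<Phi> p0 \<ge> b" using super p0 by (simp add: supersol_def)
    then have "(\<lambda>n. (1 / real (Suc (\<sigma> n))) / P (\<sigma> n)) \<longlonglongrightarrow> 0 / \<Phi> p0"
      using b by (intro tendsto_divide null L) auto
    moreover have "eventually (\<lambda>n. P (\<sigma> n) > 0) sequentially"
      using order_tendstoD(1)[OF L(2), of 0] \<Phi>b b by auto
    then have "eventually (\<lambda>n. m (\<sigma> n) \<le> (1 / real (Suc (\<sigma> n))) / P (\<sigma> n)) sequentially"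
      by eventually_elim (simp only: pos_le_divide_eq m(2))
    moreover have "eventually (\<lambda>n. 0 \<le> m (\<sigma> n)) sequentially" by (simp add: m(1) less_imp_le)
    ultimately show ?thesis using tendsto_sandwich[OF _ _ tendsto_const] by simp
  qed
  define R where "R = (\<lambda>n. - (x n - m n * Pp n)\<^sup>2 * Pqq n + (x n - m n * Pp n) * (y n - m n * Pq n) * Pqp n - (1 + (y n - m n * Pq n)\<^sup>2) * Ppp n
   - Pp n * (x n - m n * Pp n + x n) * A n + (Pp n * (y n - m n * Pq n) + x n * Pq n) * B n - Pq n * (y n - m n * Pq n + y n) * (Hpp (p n) + C n)
   + Pp n * ((x n - m n * Pp n)\<^sup>2 + (x n - m n * Pp n) * x n + (x n)\<^sup>2) * (Hpp (p n) / Hp (p n) ^ 3)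
   + \<mu> * \<rho>p (p n) * ((x n - m n * Pp n) ^ 3 * P n + Pp n * ((x n - m n * Pp n)\<^sup>2 + (x n - m n * Pp n) * x n + (x n)\<^sup>2) * u n))"
  have "R n \<le> 0" for n
  proof -
    have "m n * R n \<le> 0" using D[of n] unfolding defect_scaled R_def .
    then show ?thesis using m(1)[of n] by (simp add: mult_le_0_iff)
  qed
  moreover have "(\<lambda>n. R (\<sigma> n)) \<longlonglongrightarrow> - (Hp p0 - 0 * \<Phi>' p0)\<^sup>2 * 0 + (Hp p0 - 0 * \<Phi>' p0) * (0 - 0 * 0) * 0 - (1 + (0 - 0 * 0)\<^sup>2) * \<Phi>'' p0
   - \<Phi>' p0 * (Hp p0 - 0 * \<Phi>' p0 + Hp p0) * 0 + (\<Phi>' p0 * (0 - 0 * 0) + Hp p0 * 0) * 0 - 0 * (0 - 0 * 0 + 0) * (Hpp p0 + 0)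
   + \<Phi>' p0 * ((Hp p0 - 0 * \<Phi>' p0)\<^sup>2 + (Hp p0 - 0 * \<Phi>' p0) * Hp p0 + (Hp p0)\<^sup>2) * (Hpp p0 / Hp p0 ^ 3)
   + \<mu> * \<rho>p p0 * ((Hp p0 - 0 * \<Phi>' p0) ^ 3 * \<Phi> p0 + \<Phi>' p0 * ((Hp p0 - 0 * \<Phi>' p0)\<^sup>2 + (Hp p0 - 0 * \<Phi>' p0) * Hp p0 + (Hp p0)\<^sup>2) * 0)"
    unfolding R_def using Hp_pos[OF p0]
    by (intro tendsto_intros L Lm cc Hp_cont Hpp_cont \<rho>p_cont) auto
  ultimately have "- \<Phi>'' p0 + \<Phi>' p0 * (3 * (Hp p0)\<^sup>2) * (Hpp p0 / Hp p0 ^ 3) + \<mu> * \<rho>p p0 * (Hp p0 ^ 3 * \<Phi> p0) \<le> 0"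
    using LIMSEQ_le_const2 by (fastforce simp: power2_eq_square)
  moreover have "\<Phi>' p0 * (3 * (Hp p0)\<^sup>2) * (Hpp p0 / Hp p0 ^ 3) = 3 * (Hpp p0 / Hp p0) * \<Phi>' p0"
    using Hp_pos[OF p0] by (simp add: power2_eq_square power3_eq_cube)
  moreover have "\<Phi>'' p0 - 3 * (Hpp p0 / Hp p0) * \<Phi>' p0 - \<mu> * \<rho>p p0 * Hp p0 ^ 3 * \<Phi> p0 < 0"
    using super p0 by (simp add: supersol_def)
  ultimately show False by (simp add: mult.assoc)
qed

text \<open>Again by a failing sequence: after division by \<open>m\<close> the limit is the surface
  expression of \<Phi>, which is strictly positive. The bounds by \<open>c\<close> make the
  denominators nonzero along the sequence.\<close>

lemma far_field_top:
  assumes super: "supersol N b U \<delta> \<Phi> \<Phi>' \<Phi>''" and b: "b > 0"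
  shows "\<exists>\<epsilon>>0. \<forall>x y P Pq Pp m. \<bar>x - Hp 0\<bar> \<le> \<epsilon> \<longrightarrow> \<bar>y\<bar> \<le> \<epsilon> \<longrightarrow> \<bar>P - \<Phi> 0\<bar> \<le> \<epsilon> \<longrightarrow> \<bar>Pq\<bar> \<le> \<epsilon> \<longrightarrow> \<bar>Pp - \<Phi>' 0\<bar> \<le> \<epsilon> \<longrightarrow>
       0 < m \<longrightarrow> m * P \<le> \<epsilon> \<longrightarrow> c \<le> x \<longrightarrow> c \<le> x - m * Pp \<longrightarrow>
       0 < (1 + (y - m * Pq)\<^sup>2) / (2 * (x - m * Pp)\<^sup>2) - (1 + y\<^sup>2) / (2 * x\<^sup>2) - \<mu> * \<rho>0 * (m * P)"
proof (rule ccontr)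
  assume neg: "\<not> ?thesis"
  have "\<exists>x y P Pq Pp m. \<bar>x - Hp 0\<bar> \<le> 1 / Suc n \<and> \<bar>y\<bar> \<le> 1 / Suc n \<and> \<bar>P - \<Phi> 0\<bar> \<le> 1 / Suc n \<and> \<bar>Pq\<bar> \<le> 1 / Suc n \<and>
     \<bar>Pp - \<Phi>' 0\<bar> \<le> 1 / Suc n \<and> 0 < m \<and> m * P \<le> 1 / Suc n \<and> c \<le> x \<and> c \<le> x - m * Pp \<and>
     \<not> 0 < (1 + (y - m * Pq)\<^sup>2) / (2 * (x - m * Pp)\<^sup>2) - (1 + y\<^sup>2) / (2 * x\<^sup>2) - \<mu> * \<rho>0 * (m * P)" for n :: nat
  proof -
    have "1 / real (Suc n) > 0" by simp
    with neg show ?thesis by (simp only: not_ex not_all not_imp de_Morgan_conj) blast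
  qed
  then have "\<forall>n::nat. \<exists>x y P Pq Pp m. \<bar>x - Hp 0\<bar> \<le> 1 / Suc n \<and> \<bar>y\<bar> \<le> 1 / Suc n \<and> \<bar>P - \<Phi> 0\<bar> \<le> 1 / Suc n \<and> \<bar>Pq\<bar> \<le> 1 / Suc n \<and>
     \<bar>Pp - \<Phi>' 0\<bar> \<le> 1 / Suc n \<and> 0 < m \<and> m * P \<le> 1 / Suc n \<and> c \<le> x \<and> c \<le> x - m * Pp \<and>
     (1 + (y - m * Pq)\<^sup>2) / (2 * (x - m * Pp)\<^sup>2) - (1 + y\<^sup>2) / (2 * x\<^sup>2) - \<mu> * \<rho>0 * (m * P) \<le> 0"
    unfolding not_less by (rule allI)
  then obtain x y P Pq Pp m where
    S: "\<And>n::nat. \<bar>x n - Hp 0\<bar> \<le> 1 / Suc n" "\<And>n. \<bar>y n\<bar> \<le> 1 / Suc n" "\<And>n. \<bar>P n - \<Phi> 0\<bar> \<le> 1 / Suc n"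
      "\<And>n. \<bar>Pq n\<bar> \<le> 1 / Suc n" "\<And>n. \<bar>Pp n - \<Phi>' 0\<bar> \<le> 1 / Suc n"
    and m: "\<And>n. 0 < m n" "\<And>n. m n * P n \<le> 1 / Suc n" and cx: "\<And>n. c \<le> x n" "\<And>n. c \<le> x n - m n * Pp n"
    and D: "\<And>n. (1 + (y n - m n * Pq n)\<^sup>2) / (2 * (x n - m n * Pp n)\<^sup>2) - (1 + (y n)\<^sup>2) / (2 * (x n)\<^sup>2) - \<mu> * \<rho>0 * (m n * P n) \<le> 0"
    unfolding choice_iff by blast
  have null: "(\<lambda>n. 1 / real (Suc n)) \<longlonglongrightarrow> 0"
    using LIMSEQ_inverse_real_of_nat by (simp add: inverse_eq_divide)
  have lim: "g \<longlonglongrightarrow> k" if "\<And>n::nat. \<bar>g n - k\<bar> \<le> 1 / Suc n" for g k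
    using tendsto_sandwich[OF _ _ tendsto_const null, of "\<lambda>n. \<bar>g n - k\<bar>"] that
    by (auto simp: LIM_zero_iff[symmetric, of g] tendsto_rabs_zero_iff)
  have L: "x \<longlonglongrightarrow> Hp 0" "y \<longlonglongrightarrow> 0" "P \<longlonglongrightarrow> \<Phi> 0" "Pq \<longlonglongrightarrow> 0" "Pp \<longlonglongrightarrow> \<Phi>' 0"
    using S by (auto intro!: lim)
  have Lm: "m \<longlonglongrightarrow> 0"
  proof -
    have \<Phi>b: "\<Phi> 0 \<ge> b" using super by (simp add: supersol_def)
    then have "(\<lambda>n. (1 / real (Suc n)) / P n) \<longlonglongrightarrow> 0 / \<Phi> 0"
      using b by (intro tendsto_divide null L) auto
    moreover have "eventually (\<lambda>n. P n > 0) sequentially"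
      using order_tendstoD(1)[OF L(3), of 0] \<Phi>b b by auto
    then have "eventually (\<lambda>n. m n \<le> (1 / real (Suc n)) / P n) sequentially"
      by eventually_elim (simp only: pos_le_divide_eq m(2))
    moreover have "eventually (\<lambda>n. 0 \<le> m n) sequentially" by (simp add: m(1) less_imp_le)
    ultimately show ?thesis using tendsto_sandwich[OF _ _ tendsto_const] by simp
  qed
  define R where "R = (\<lambda>n. Pp n * ((1 + (y n)\<^sup>2) * (x n + (x n - m n * Pp n)) / (2 * (x n - m n * Pp n)\<^sup>2 * (x n)\<^sup>2))
      - Pq n * ((y n + (y n - m n * Pq n)) / (2 * (x n - m n * Pp n)\<^sup>2)) - \<mu> * \<rho>0 * P n)"
  have "R n \<le> 0" for n
  proof -
    have nz: "x n \<noteq> 0" "x n - m n * Pp n \<noteq> 0" using cx[of n] c_pos by auto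
    have gen: "(1 + (Y - k * s)\<^sup>2) / (2 * t\<^sup>2) - (1 + Y\<^sup>2) / (2 * X\<^sup>2) - z * (k * v)
        = k * (r * ((1 + Y\<^sup>2) * (X + t) / (2 * t\<^sup>2 * X\<^sup>2)) - s * ((Y + (Y - k * s)) / (2 * t\<^sup>2)) - z * v)"
      if "X \<noteq> 0" "t \<noteq> 0" "X - t = k * r" for X Y k s t z v r :: real
    proof -
      have "(1 + (Y - k * s)\<^sup>2) / (2 * t\<^sup>2) - (1 + Y\<^sup>2) / (2 * X\<^sup>2)
          = (X - t) * ((1 + Y\<^sup>2) * (X + t) / (2 * t\<^sup>2 * X\<^sup>2)) - (k * s) * ((Y + (Y - k * s)) / (2 * t\<^sup>2))"
        using that(1,2) by (simp add: field_simps power2_eq_square)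
      then show ?thesis unfolding that(3) by (simp add: algebra_simps)
    qed
    have "m n * R n \<le> 0"
      using D[of n] unfolding R_def by (subst (asm) gen[OF nz, of "m n" "Pp n"]) auto
    then show ?thesis using m(1)[of n] by (simp add: mult_le_0_iff)
  qed
  moreover have "R \<longlonglongrightarrow> \<Phi>' 0 * ((1 + 0\<^sup>2) * (Hp 0 + (Hp 0 - 0 * \<Phi>' 0)) / (2 * (Hp 0 - 0 * \<Phi>' 0)\<^sup>2 * (Hp 0)\<^sup>2))
      - 0 * ((0 + (0 - 0 * 0)) / (2 * (Hp 0 - 0 * \<Phi>' 0)\<^sup>2)) - \<mu> * \<rho>0 * \<Phi> 0"
    unfolding R_def using Hp_pos[of 0] by (intro tendsto_intros L Lm) auto
  ultimately have "\<Phi>' 0 * ((1 + 0\<^sup>2) * (Hp 0 + (Hp 0 - 0 * \<Phi>' 0)) / (2 * (Hp 0 - 0 * \<Phi>' 0)\<^sup>2 * (Hp 0)\<^sup>2))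
      - 0 * ((0 + (0 - 0 * 0)) / (2 * (Hp 0 - 0 * \<Phi>' 0)\<^sup>2)) - \<mu> * \<rho>0 * \<Phi> 0 \<le> 0"
    using LIMSEQ_le_const2 by blast
  moreover have "(1 + 0\<^sup>2) * (Hp 0 + (Hp 0 - 0 * \<Phi>' 0)) / (2 * (Hp 0 - 0 * \<Phi>' 0)\<^sup>2 * (Hp 0)\<^sup>2) = 1 / Hp 0 ^ 3"
    using Hp_pos[of 0] by (simp add: field_simps power2_eq_square power3_eq_cube)
  ultimately have "\<Phi>' 0 * (1 / Hp 0 ^ 3) - 0 * ((0 + (0 - 0 * 0)) / (2 * (Hp 0 - 0 * \<Phi>' 0)\<^sup>2)) - \<mu> * \<rho>0 * \<Phi> 0 \<le> 0"
    by (simp only:)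
  then have "\<Phi>' 0 / Hp 0 ^ 3 - \<mu> * \<rho>0 * \<Phi> 0 \<le> 0" by simp
  then show False using super by (simp add: supersol_def)
qed

definition far_field :: "real \<Rightarrow> (real \<Rightarrow> real) \<Rightarrow> (real \<Rightarrow> real) \<Rightarrow> (real \<Rightarrow> real) \<Rightarrow> bool" where
  "far_field \<epsilon> \<Phi> \<Phi>' \<Phi>'' \<longleftrightarrow>
     (\<forall>p x y A B C u P Pq Pp Pqq Pqp Ppp m. near \<Phi> \<Phi>' \<Phi>'' \<epsilon> p x y A B C u P Pq Pp Pqq Pqp Ppp \<longrightarrow>
       0 < m \<longrightarrow> m * P \<le> \<epsilon> \<longrightarrow>
       0 < defect p (x - m * Pp) (y - m * Pq) x y (- m * Pqq) (- m * Pqp) (- m * Ppp) A B C (u - m * P) u \<and>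
       (p = 0 \<longrightarrow> c \<le> x \<longrightarrow> c \<le> x - m * Pp \<longrightarrow>
         0 < (1 + (y - m * Pq)\<^sup>2) / (2 * (x - m * Pp)\<^sup>2) - (1 + y\<^sup>2) / (2 * x\<^sup>2) - \<mu> * \<rho>0 * (m * P)))"

lemma far_field_exists:
  assumes su: "supersol N b U \<delta> \<Phi> \<Phi>' \<Phi>''" and b: "b > 0"
  obtains \<epsilon> where "\<epsilon> > 0" "far_field \<epsilon> \<Phi> \<Phi>' \<Phi>''"
proof -
  obtain \<epsilon>1 where \<epsilon>1: "\<epsilon>1 > 0" and fi: "\<And>p x y A B C u P Pq Pp Pqq Pqp Ppp m.
       near \<Phi> \<Phi>' \<Phi>'' \<epsilon>1 p x y A B C u P Pq Pp Pqq Pqp Ppp \<Longrightarrow> 0 < m \<Longrightarrow> m * P \<le> \<epsilon>1 \<Longrightarrow>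
       0 < defect p (x - m * Pp) (y - m * Pq) x y (- m * Pqq) (- m * Pqp) (- m * Ppp) A B C (u - m * P) u"
    using far_field_interior[OF su b] by blast
  obtain \<epsilon>2 where \<epsilon>2: "\<epsilon>2 > 0" and ft: "\<And>x y P Pq Pp m. \<bar>x - Hp 0\<bar> \<le> \<epsilon>2 \<Longrightarrow> \<bar>y\<bar> \<le> \<epsilon>2 \<Longrightarrow> \<bar>P - \<Phi> 0\<bar> \<le> \<epsilon>2 \<Longrightarrow>
       \<bar>Pq\<bar> \<le> \<epsilon>2 \<Longrightarrow> \<bar>Pp - \<Phi>' 0\<bar> \<le> \<epsilon>2 \<Longrightarrow> 0 < m \<Longrightarrow> m * P \<le> \<epsilon>2 \<Longrightarrow> c \<le> x \<Longrightarrow> c \<le> x - m * Pp \<Longrightarrow>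
       0 < (1 + (y - m * Pq)\<^sup>2) / (2 * (x - m * Pp)\<^sup>2) - (1 + y\<^sup>2) / (2 * x\<^sup>2) - \<mu> * \<rho>0 * (m * P)"
    using far_field_top[OF su b] by blast
  define \<epsilon> where "\<epsilon> = min \<epsilon>1 \<epsilon>2"
  have \<epsilon>: "\<epsilon> \<le> \<epsilon>1" "\<epsilon> \<le> \<epsilon>2" by (auto simp: \<epsilon>_def)
  have "far_field \<epsilon> \<Phi> \<Phi>' \<Phi>''"
    unfolding far_field_def
  proof (intro allI impI conjI)
    fix p x y A B C u P Pq Pp Pqq Pqp Ppp m
    assume n: "near \<Phi> \<Phi>' \<Phi>'' \<epsilon> p x y A B C u P Pq Pp Pqq Pqp Ppp" and m: "0 < m" "m * P \<le> \<epsilon>"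
    show "0 < defect p (x - m * Pp) (y - m * Pq) x y (- m * Pqq) (- m * Pqp) (- m * Ppp) A B C (u - m * P) u"
      by (rule fi[OF near_mono[OF n \<epsilon>(1)] m(1) order_trans[OF m(2) \<epsilon>(1)]])
    assume "p = 0" "c \<le> x" "c \<le> x - m * Pp"
    then show "0 < (1 + (y - m * Pq)\<^sup>2) / (2 * (x - m * Pp)\<^sup>2) - (1 + y\<^sup>2) / (2 * x\<^sup>2) - \<mu> * \<rho>0 * (m * P)"
      using near_mono[OF n \<epsilon>(2)] m(1) order_trans[OF m(2) \<epsilon>(2)] by (intro ft) (simp_all add: near_def)
  qed
  moreover have "\<epsilon> > 0" using \<epsilon>1 \<epsilon>2 by (simp add: \<epsilon>_def)
  ultimately show thesis using that by blast
qed

text \<open>Moving-plane comparison: \<open>P\<close> is a positive comparison function, and every point where the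
  difference could be negative lies either in the far field, where \<open>P\<close> is close to a strict
  supersolution of the linearized problem, or where \<open>P\<close> is a strict supersolution for all
  admissible coefficients.\<close>

lemma comparison:
  assumes s1: "hsol w1 w1q w1p w1qq w1qp w1pq w1pp" and s2: "hsol w2 w2q w2p w2qq w2qp w2pq w2pp"
    and w1: "\<And>q p. -1 \<le> p \<Longrightarrow> p \<le> 0 \<Longrightarrow> w1 q p \<ge> 0"
    and dec: "\<And>e. e > 0 \<Longrightarrow> \<exists>Q. \<forall>q\<le>Q. \<forall>p\<in>{-1..0}. \<bar>w2 q p\<bar> < e"
    and lat: "\<And>p. -1 \<le> p \<Longrightarrow> p \<le> 0 \<Longrightarrow> w1 l p = w2 l p"
    and j: "jet2 P Pq Pp Pqq Pqp Ppq Ppp"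
    and b: "b > 0" "\<And>q p. q \<le> l \<Longrightarrow> -1 \<le> p \<Longrightarrow> p \<le> 0 \<Longrightarrow> b \<le> P q p"
    and far_field: "far_field \<epsilon> \<Phi> \<Phi>' \<Phi>''"
    and cover: "\<And>q p. q < l \<Longrightarrow> -1 < p \<Longrightarrow> p \<le> 0 \<Longrightarrow> w1 q p < w2 q p \<Longrightarrow>
       near \<Phi> \<Phi>' \<Phi>'' \<epsilon> p (Hp p + w2p q p) (w2q q p) (w2qq q p) (w2qp q p + w2pq q p) (w2pp q p) (w2 q p)
         (P q p) (Pq q p) (Pp q p) (Pqq q p) (Pqp q p + Ppq q p) (Ppp q p) \<or>
       p < 0 \<and> (\<forall>x y. c \<le> x \<longrightarrow> x \<le> M \<longrightarrow> \<bar>y\<bar> \<le> M \<longrightarrow>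
         x\<^sup>2 * Pqq q p - x * y * (Pqp q p + Ppq q p) + (1 + y\<^sup>2) * Ppp q p
         + 10 * M ^ 4 * (\<bar>Pp q p\<bar> + \<bar>Pq q p\<bar> + P q p) < 0) \<or>
       p = 0 \<and> Pp q p \<ge> 0 \<and> Pp q p / (2 * M ^ 3) - \<bar>Pq q p\<bar> * (M / c\<^sup>2) - \<mu> * \<rho>0 * P q p > 0"
    and qp: "q1 \<le> l" "-1 \<le> p1" "p1 \<le> 0"
  shows "w2 q1 p1 \<le> w1 q1 p1"
proof (rule ccontr)
  assume "\<not> ?thesis"
  then have neg: "w1 q1 p1 < w2 q1 p1" by simp
  have Pc: "continuous_on strip (\<lambda>z. P (fst z) (snd z))"
    using j unfolding jet2_def continuous_on_eq_continuous_within by (blast intro: has_derivative_continuous)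
  obtain m q p where m: "m > 0" and q: "q < l" and p: "-1 < p" "p \<le> 0" and eq: "w1 q p - w2 q p = - m * P q p"
    and min: "\<And>q' p'. q' \<le> l \<Longrightarrow> -1 \<le> p' \<Longrightarrow> p' \<le> 0 \<Longrightarrow> 0 \<le> w1 q' p' - w2 q' p' + m * P q' p'"
    by (rule negative_minimum[OF s1 s2 w1 dec lat Pc b qp neg]) blast+
  note j' = jet2_cmult[OF j, of "- m"]
  have e: "l - q > 0" using q by simp
  have Pb: "P q p > 0" using b(2)[of q p] b(1) q p by simp
  then have lt: "w1 q p < w2 q p" using eq m by (smt (verit) mult_neg_pos)
  have min': "w1 q p - w2 q p - - m * P q p \<le> w1 q' p' - w2 q' p' - - m * P q' p'"
    if "\<bar>q' - q\<bar> < l - q" "-1 \<le> p'" "p' \<le> 0" for q' p'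
    using min[of q' p'] that eq by simp
  \<comment> \<open>\<open>m * P\<close> is the depth of the difference and is at most
    \<open>w2\<close>, because \<open>w1\<close> is nonnegative; so the smallness of
    \<open>w2\<close> alone controls it.\<close>
  have small: "m * P q p \<le> \<epsilon>"
    if "near \<Phi> \<Phi>' \<Phi>'' \<epsilon> p x y A B C (w2 q p) R Rq Rp Rqq Rqp Rpp" for x y A B C R Rq Rp Rqq Rqp Rpp
    using eq w1[of p q] p that by (auto simp: near_def abs_le_iff)
  show False
  proof (cases "p = 0")
    case False
    then have p0: "p < 0" using p by simp
    note t = touch_interior[OF s1 s2 j' p(1) p0 e min']
    have t1: "w1q q p = w2q q p - m * Pq q p" and t2: "Hp p + w1p q p = Hp p + w2p q p - m * Pp q p"
      using t(1,2) by simp_all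
    have t3: "defect p (Hp p + w1p q p) (w1q q p) (Hp p + w2p q p) (w2q q p)
       (- m * Pqq q p) (- m * (Pqp q p + Ppq q p)) (- m * Ppp q p)
       (w2qq q p) (w2qp q p + w2pq q p) (w2pp q p) (w1 q p) (w2 q p) \<le> 0"
      using t(3) by (simp only: distrib_left)
    from cover[OF q p lt] False consider
      (far) "near \<Phi> \<Phi>' \<Phi>'' \<epsilon> p (Hp p + w2p q p) (w2q q p) (w2qq q p) (w2qp q p + w2pq q p) (w2pp q p) (w2 q p)
         (P q p) (Pq q p) (Pp q p) (Pqq q p) (Pqp q p + Ppq q p) (Ppp q p)"
      | (mid) "\<forall>x y. c \<le> x \<longrightarrow> x \<le> M \<longrightarrow> \<bar>y\<bar> \<le> M \<longrightarrow>
         x\<^sup>2 * Pqq q p - x * y * (Pqp q p + Ppq q p) + (1 + y\<^sup>2) * Ppp q p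
         + 10 * M ^ 4 * (\<bar>Pp q p\<bar> + \<bar>Pq q p\<bar> + P q p) < 0" by blast
    then show False
    proof cases
      case far
      have u: "w1 q p = w2 q p - m * P q p" using eq by simp
      show False using far_field[unfolded far_field_def, rule_format, OF far m small[OF far]] t3 unfolding t1 t2 u by simp
    next
      case mid
      define x y where "x = Hp p + w1p q p" and "y = w1q q p"
      have p': "-1 \<le> p" by (simp add: less_imp_le p)
      note b1 = hsol_bounds[OF s1 p' p(2), of q]
      have "x\<^sup>2 * (- m * Pqq q p) - x * y * (- m * (Pqp q p + Ppq q p)) + (1 + y\<^sup>2) * (- m * Ppp q p)
        - 10 * M ^ 4 * (\<bar>x - (Hp p + w2p q p)\<bar> + \<bar>y - w2q q p\<bar> + max 0 (w2 q p - w1 q p)) \<le> 0"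
        unfolding x_def y_def by (rule order_trans[OF hsol_defect_lower[OF s1 s2 p' p(2)] t3])
      moreover have "\<bar>x - (Hp p + w2p q p)\<bar> = m * \<bar>Pp q p\<bar>" "\<bar>y - w2q q p\<bar> = m * \<bar>Pq q p\<bar>"
        "max 0 (w2 q p - w1 q p) = m * P q p"
        using t1 t2 m eq lt by (simp_all add: x_def y_def abs_mult)
      moreover have "x\<^sup>2 * (- m * Pqq q p) - x * y * (- m * (Pqp q p + Ppq q p)) + (1 + y\<^sup>2) * (- m * Ppp q p)
        - 10 * M ^ 4 * (m * \<bar>Pp q p\<bar> + m * \<bar>Pq q p\<bar> + m * P q p)
        = - m * (x\<^sup>2 * Pqq q p - x * y * (Pqp q p + Ppq q p) + (1 + y\<^sup>2) * Ppp q p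
         + 10 * M ^ 4 * (\<bar>Pp q p\<bar> + \<bar>Pq q p\<bar> + P q p))" by algebra
      ultimately have "- m * (x\<^sup>2 * Pqq q p - x * y * (Pqp q p + Ppq q p) + (1 + y\<^sup>2) * Ppp q p
         + 10 * M ^ 4 * (\<bar>Pp q p\<bar> + \<bar>Pq q p\<bar> + P q p)) \<le> 0" by (simp only:)
      moreover have "x\<^sup>2 * Pqq q p - x * y * (Pqp q p + Ppq q p) + (1 + y\<^sup>2) * Ppp q p
         + 10 * M ^ 4 * (\<bar>Pp q p\<bar> + \<bar>Pq q p\<bar> + P q p) < 0"
        using mid b1(2,8,9) unfolding x_def y_def by blast
      ultimately show False using mult_pos_neg[OF m] by fastforce
    qed
  next
    case True
    from cover[OF q p lt] True consider
      (far) "near \<Phi> \<Phi>' \<Phi>'' \<epsilon> p (Hp p + w2p q p) (w2q q p) (w2qq q p) (w2qp q p + w2pq q p) (w2pp q p) (w2 q p)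
         (P q p) (Pq q p) (Pp q p) (Pqq q p) (Pqp q p + Ppq q p) (Ppp q p)"
      | (mid) "Pp q p \<ge> 0" "Pp q p / (2 * M ^ 3) - \<bar>Pq q p\<bar> * (M / c\<^sup>2) - \<mu> * \<rho>0 * P q p > 0" by blast
    then show False
    proof cases
      case far
      have min0: "w1 q 0 - w2 q 0 - - m * P q 0 \<le> w1 q' p' - w2 q' p' - - m * P q' p'"
        if "\<bar>q' - q\<bar> < l - q" "\<bar>p'\<bar> < l - q" "-1 \<le> p'" "p' \<le> 0" for q' p'
        using min' that True by simp
      note t = touch_top[OF s1 s2 j' e min0]
      have "0 < (1 + (w2q q 0 - m * Pq q 0)\<^sup>2) / (2 * (Hp 0 + w2p q 0 - m * Pp q 0)\<^sup>2) - (1 + (w2q q 0)\<^sup>2) / (2 * (Hp 0 + w2p q 0)\<^sup>2)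
          - \<mu> * \<rho>0 * (m * P q 0)"
        using far_field[unfolded far_field_def, rule_format, OF far m small[OF far]] t(2)
          hsol_bounds(8)[OF s2, of 0 q] True by simp
      moreover have "w1q q 0 = w2q q 0 - m * Pq q 0" using t(1) by simp
      moreover have "w1 q 0 - w2 q 0 = - (m * P q 0)" using eq True by simp
      ultimately show False using t(3) by simp
    next
      case mid
      have min0: "w1 q 0 - w2 q 0 - - m * P q 0 \<le> w1 q' p' - w2 q' p' - - m * P q' p'"
        if "\<bar>q' - q\<bar> < l - q" "\<bar>p'\<bar> < l - q" "-1 \<le> p'" "p' \<le> 0" for q' p'
        using min' that True by simp
      have "- m * Pp q 0 \<le> 0" using mid(1) m True by simp
      note t = touch_top_sign[OF s1 s2 j' e min0 this]
      have "m * (Pp q p / (2 * M ^ 3) - \<bar>Pq q p\<bar> * (M / c\<^sup>2) - \<mu> * \<rho>0 * P q p) \<le> 0"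
      proof -
        have "w1 q 0 - w2 q 0 = - m * P q 0" using eq True by simp
        moreover have "\<bar>- m * Pq q 0\<bar> = m * \<bar>Pq q 0\<bar>" using m by (simp add: abs_mult)
        ultimately have "- (- m * Pp q 0) / (2 * M ^ 3) - m * \<bar>Pq q 0\<bar> * (M / c\<^sup>2) + \<mu> * \<rho>0 * (- m * P q 0) \<le> 0"
          using t by (simp only:)
        then show ?thesis using True by (simp add: algebra_simps)
      qed
      then show False using mid(2) m by (simp add: mult_le_0_iff)
    qed
  qed
qed

end

section \<open>Moving planes\<close>

context height_problem
begin

text \<open>Bookkeeping for \<open>P = \<Phi> + \<sigma> * \<omega> - s / n ^ 3\<close> with
  \<open>\<sigma>' = \<sigma>\<close> and \<open>s' = n^2 * s\<close>. Here \<open>t0\<close>,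
  \<open>t1\<close>, \<open>t2\<close> are \<sigma> times \<omega> and its derivatives, so
  \<open>t0\<close> serves for the value and both pure \<open>q\<close>-derivatives; the powers of
  \<open>n\<close> separate the concavity \<open>n * s\<close> from the slope \<open>s / n\<close>.
  The 35 is 5 from the second-order part and 3 times 10 from the lower-order part.\<close>

lemma perturbed_supersolution_bound:
  assumes x: "c \<le> x" "x \<le> M" "\<bar>y\<bar> \<le> M" and t: "\<bar>t0\<bar> \<le> T" "\<bar>t1\<bar> \<le> T" "\<bar>t2\<bar> \<le> T"
    and n: "n \<ge> 1" and s: "s \<ge> 0"
  shows "x\<^sup>2 * (t0 - n * s) - x * y * (t1 + t1) + (1 + y\<^sup>2) * (f2 + t2)
      + 10 * M ^ 4 * (\<bar>f1 + t1\<bar> + \<bar>t0 - s / n\<bar> + (f0 + t0 - s / n ^ 3))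
      \<le> ((1 + y\<^sup>2) * f2 + 10 * M ^ 4 * (\<bar>f1\<bar> + f0)) + 35 * M ^ 4 * T - s * (c\<^sup>2 * n - 10 * M ^ 4 / n)"
proof -
  have M2: "1 \<le> M\<^sup>2" "M\<^sup>2 \<le> M ^ 4" using M_ge by (auto intro: power_increasing)
  have T: "T \<ge> 0" using t(1) by linarith
  have x2: "c\<^sup>2 \<le> x\<^sup>2" "x\<^sup>2 \<le> M\<^sup>2" using x c_pos by (auto intro: power_mono)
  have y2: "y\<^sup>2 \<le> M\<^sup>2" using x(3) M_ge by (simp add: abs_le_square_iff[symmetric])
  have xy: "\<bar>x * y\<bar> \<le> M\<^sup>2" unfolding abs_mult power2_eq_square using x c_pos M_ge by (intro mult_mono) auto
  have 1: "x\<^sup>2 * t0 \<le> M\<^sup>2 * T"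
  proof -
    have "x\<^sup>2 * t0 \<le> x\<^sup>2 * T" using t(1) by (intro mult_left_mono) auto
    also have "\<dots> \<le> M\<^sup>2 * T" using x2 T by (intro mult_right_mono)
    finally show ?thesis .
  qed
  have 2: "x\<^sup>2 * (n * s) \<ge> c\<^sup>2 * (n * s)" using x2 n s by (intro mult_right_mono) auto
  have 3: "- (x * y * (t1 + t1)) \<le> 2 * (M\<^sup>2 * T)"
  proof -
    have "\<bar>x * y * t1\<bar> \<le> M\<^sup>2 * T" unfolding abs_mult[of "x * y"] using xy t(2) by (intro mult_mono) auto
    then have "- (x * y * t1) \<le> M\<^sup>2 * T" by linarith
    then show ?thesis unfolding distrib_left by linarith
  qed
  have 4: "(1 + y\<^sup>2) * t2 \<le> 2 * (M\<^sup>2 * T)"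
  proof -
    have "(1 + y\<^sup>2) * t2 \<le> (1 + y\<^sup>2) * T" using t(3) by (intro mult_left_mono) auto
    also have "\<dots> \<le> (2 * M\<^sup>2) * T" using y2 M2 T by (intro mult_right_mono) auto
    finally show ?thesis by simp
  qed
  have 5: "\<bar>f1 + t1\<bar> + \<bar>t0 - s / n\<bar> + (f0 + t0 - s / n ^ 3) \<le> (\<bar>f1\<bar> + f0) + 3 * T + s / n"
  proof -
    have "s / n ^ 3 \<ge> 0" "s / n \<ge> 0" using s n by auto
    then show ?thesis using t(1,2) by linarith
  qed
  have 6: "10 * M ^ 4 * (\<bar>f1 + t1\<bar> + \<bar>t0 - s / n\<bar> + (f0 + t0 - s / n ^ 3)) \<le> 10 * M ^ 4 * ((\<bar>f1\<bar> + f0) + 3 * T + s / n)"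
    using 5 by (intro mult_left_mono) auto
  have 7: "M\<^sup>2 * T \<le> M ^ 4 * T" using M2 T by (intro mult_right_mono)
  have "x\<^sup>2 * (t0 - n * s) - x * y * (t1 + t1) + (1 + y\<^sup>2) * (f2 + t2)
      = x\<^sup>2 * t0 - x\<^sup>2 * (n * s) - x * y * (t1 + t1) + (1 + y\<^sup>2) * f2 + (1 + y\<^sup>2) * t2"
    by (simp add: algebra_simps)
  also have "\<dots> \<le> 5 * (M ^ 4 * T) - c\<^sup>2 * (n * s) + (1 + y\<^sup>2) * f2"
    using 1 2 3 4 7 by linarith
  finally have "x\<^sup>2 * (t0 - n * s) - x * y * (t1 + t1) + (1 + y\<^sup>2) * (f2 + t2)
      + 10 * M ^ 4 * (\<bar>f1 + t1\<bar> + \<bar>t0 - s / n\<bar> + (f0 + t0 - s / n ^ 3))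
      \<le> 5 * (M ^ 4 * T) - c\<^sup>2 * (n * s) + (1 + y\<^sup>2) * f2 + 10 * M ^ 4 * ((\<bar>f1\<bar> + f0) + 3 * T + s / n)"
    using 6 by linarith
  also have "\<dots> = ((1 + y\<^sup>2) * f2 + 10 * M ^ 4 * (\<bar>f1\<bar> + f0)) + 35 * M ^ 4 * T - s * (c\<^sup>2 * n - 10 * M ^ 4 / n)"
    by (simp add: algebra_simps)
  finally show ?thesis .
qed

end

text \<open>\<open>super\<close> leaves \<open>N\<close> free for fixed \<open>b\<close> and
  \<open>U\<close>, as the step of the moving plane chooses \<open>N\<close> in terms of them. A
  wave that decays to the right enters through its reflection.\<close>

locale elevation_wave = height_problem +
  fixes w wq wp wqq wqp wpq wpp :: "real \<Rightarrow> real \<Rightarrow> real" and b U :: real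
  assumes sol: "hsol w wq wp wqq wqp wpq wpp"
    and pos: "-1 < p \<Longrightarrow> p \<le> 0 \<Longrightarrow> w q p > 0"
    and decay: "e > 0 \<Longrightarrow> \<exists>Q. \<forall>q\<le>Q. \<forall>p\<in>{-1..0}. \<bar>w q p\<bar> < e \<and> \<bar>wq q p\<bar> < e \<and> \<bar>wp q p\<bar> < e \<and>
        \<bar>wqq q p\<bar> < e \<and> \<bar>wqp q p\<bar> < e \<and> \<bar>wpq q p\<bar> < e \<and> \<bar>wpp q p\<bar> < e"
    and b_pos: "b > 0"
    and super: "\<exists>\<delta> \<Phi> \<Phi>' \<Phi>''. supersol N b U \<delta> \<Phi> \<Phi>' \<Phi>''"
begin

lemma w_nonneg: "-1 \<le> p \<Longrightarrow> p \<le> 0 \<Longrightarrow> w q p \<ge> 0"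
  using pos[of p q] sol by (cases "p = -1") (auto simp: hsol_def)

lemma w_decay: "e > 0 \<Longrightarrow> \<exists>Q. \<forall>q\<le>Q. \<forall>p\<in>{-1..0}. \<bar>w q p\<bar> < e"
  using decay by meson

lemma reflected_sol:
  "hsol (\<lambda>q p. w (2 * l - q) p) (\<lambda>q p. - wq (2 * l - q) p) (\<lambda>q p. wp (2 * l - q) p)
     (\<lambda>q p. wqq (2 * l - q) p) (\<lambda>q p. - wqp (2 * l - q) p) (\<lambda>q p. - wpq (2 * l - q) p)
     (\<lambda>q p. wpp (2 * l - q) p)"
  using hsol_affine[OF sol, of "-1" "2 * l"] by simp

lemma translated_sol:
  "hsol (\<lambda>q p. w (q + k) p) (\<lambda>q p. wq (q + k) p) (\<lambda>q p. wp (q + k) p)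
     (\<lambda>q p. wqq (q + k) p) (\<lambda>q p. wqp (q + k) p) (\<lambda>q p. wpq (q + k) p)
     (\<lambda>q p. wpp (q + k) p)"
  using hsol_affine[OF sol, of 1 k] by simp

lemma w_deriv: "-1 \<le> p \<Longrightarrow> p \<le> 0 \<Longrightarrow> ((\<lambda>t. w t p) has_real_derivative wq q p) (at q)"
  using jet2_partials(1)[OF hsol_jet2[OF sol]] .

lemma w_lipschitz:
  assumes "-1 \<le> p" "p \<le> 0"
  shows "\<bar>w q p - w q' p\<bar> \<le> M * \<bar>q - q'\<bar>"
  using field_differentiable_bound[of UNIV "\<lambda>t. w t p" "\<lambda>t. wq t p" M q q']
    w_deriv[OF assms] hsol_bounds(2)[OF sol assms] by auto

text \<open>For a plane far to the left, every point of comparison lies where \<open>w\<close> and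
  its derivatives are small, so \<Phi> itself serves as comparison function; the reflected wave need
  not be small.\<close>

lemma planes_start: "\<exists>Q. \<forall>l\<le>Q. \<forall>q\<le>l. \<forall>p\<in>{-1..0}. w q p \<le> w (2 * l - q) p"
proof -
  obtain \<delta> \<Phi> \<Phi>' \<Phi>'' where su: "supersol 0 b U \<delta> \<Phi> \<Phi>' \<Phi>''" using super by blast
  obtain \<epsilon> where \<epsilon>: "\<epsilon> > 0" and ff: "far_field \<epsilon> \<Phi> \<Phi>' \<Phi>''"
    using far_field_exists[OF su b_pos] .
  obtain Q where Q: "\<And>q p. q \<le> Q \<Longrightarrow> p \<in> {-1..0} \<Longrightarrow> \<bar>w q p\<bar> < \<epsilon> \<and> \<bar>wq q p\<bar> < \<epsilon> \<and> \<bar>wp q p\<bar> < \<epsilon> \<and>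
        \<bar>wqq q p\<bar> < \<epsilon> \<and> \<bar>wqp q p\<bar> < \<epsilon> \<and> \<bar>wpq q p\<bar> < \<epsilon> \<and> \<bar>wpp q p\<bar> < \<epsilon>"
    using decay[OF \<epsilon>] by meson
  have dA: "((\<lambda>q::real. 1::real) has_real_derivative 0) (at q)" "((\<lambda>q::real. 0::real) has_real_derivative 0) (at q)" for q
    by simp_all
  have d\<Phi>: "p \<in> {-1..0} \<Longrightarrow> (\<Phi> has_real_derivative \<Phi>' p) (at p within {-1..0})"
    "p \<in> {-1..0} \<Longrightarrow> (\<Phi>' has_real_derivative \<Phi>'' p) (at p within {-1..0})" for p
    using su by (auto simp: supersol_def)
  have j: "jet2 (\<lambda>q p. \<Phi> p) (\<lambda>q p. 0) (\<lambda>q p. \<Phi>' p) (\<lambda>q p. 0) (\<lambda>q p. 0) (\<lambda>q p. 0) (\<lambda>q p. \<Phi>'' p)"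
    using jet2_product[OF dA d\<Phi>] by simp
  have "w q1 p1 \<le> w (2 * l - q1) p1" if l: "l \<le> Q" and z: "q1 \<le> l" "-1 \<le> p1" "p1 \<le> 0" for l q1 p1
  proof (rule comparison[OF reflected_sol sol _ w_decay _ j b_pos, where \<epsilon> = \<epsilon> and \<Phi> = \<Phi> and \<Phi>' = \<Phi>' and \<Phi>'' = \<Phi>'' and l = l])
    fix q p :: real assume q: "q < l" and p: "-1 < p" "p \<le> 0"
    have "q \<le> Q" "p \<in> {-1..0}" using q p l by auto
    from Q[OF this] \<epsilon> p
    show "near \<Phi> \<Phi>' \<Phi>'' \<epsilon> p (Hp p + wp q p) (wq q p) (wqq q p) (wqp q p + wpq q p) (wpp q p) (w q p)
         (\<Phi> p) 0 (\<Phi>' p) 0 (0 + 0) (\<Phi>'' p) \<or>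
       p < 0 \<and> (\<forall>x y. c \<le> x \<longrightarrow> x \<le> M \<longrightarrow> \<bar>y\<bar> \<le> M \<longrightarrow>
         x\<^sup>2 * 0 - x * y * (0 + 0) + (1 + y\<^sup>2) * \<Phi>'' p
         + 10 * M ^ 4 * (\<bar>\<Phi>' p\<bar> + \<bar>0\<bar> + \<Phi> p) < 0) \<or>
       p = 0 \<and> \<Phi>' p \<ge> 0 \<and> \<Phi>' p / (2 * M ^ 3) - \<bar>0\<bar> * (M / c\<^sup>2) - \<mu> * \<rho>0 * \<Phi> p > 0"
      unfolding near_def by (intro disjI1 conjI) (simp_all, linarith)
  qed (use z w_nonneg su ff in \<open>auto simp: supersol_def\<close>)
  then show ?thesis by (intro exI[of _ Q]) simp
qed

text \<open>The supersolution is modified by two terms: one that is exponentially localized near the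
  reflection line and steep at the surface compensates the unfavourable zeroth-order term of the
  surface condition, and a small rapidly growing exponential provides concavity in the narrow layer
  next to the line. In the far field both are negligible.\<close>

lemma planes_step:
  assumes strict: "\<And>q p. q < l0 \<Longrightarrow> -1 < p \<Longrightarrow> p \<le> 0 \<Longrightarrow> w q p < w (2 * l0 - q) p"
  shows "\<exists>d>0. \<forall>l\<in>{l0..l0 + d}. \<forall>q\<le>l. \<forall>p\<in>{-1..0}. w q p \<le> w (2 * l - q) p"
proof -
  have M3: "M ^ 3 > 0" "M ^ 4 > 0" using M_ge by auto
  have U: "U > 0" 
  proof -
    obtain \<delta> \<Phi> \<Phi>' \<Phi>'' where "supersol 0 b U \<delta> \<Phi> \<Phi>' \<Phi>''" using super by blast
    then have "b \<le> \<Phi> 0" "\<Phi> 0 \<le> U" by (auto simp: supersol_def)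
    then show ?thesis using b_pos by linarith
  qed
  \<comment> \<open>Makes the added surface slope large enough: next to the line
    \<open>\<sigma> \<ge> C2 / 2\<close>, and the resulting gain after division by
    \<open>2 * M ^ 3\<close> is \<open>\<mu> * \<rho>0 * U + 1\<close>.\<close>
  define C2 where "C2 = 4 * M ^ 3 * (\<mu> * \<rho>0 * U + 1)"
  have C2: "C2 > 0" using M3 \<mu>_pos \<rho>0_pos U by (simp add: C2_def add_pos_pos)
  \<comment> \<open>Gives \<open>|\<sigma> * \<omega>| \<le> C2 / J = b / 4\<close>: a steep
    correction that hardly changes the value of the comparison function.\<close>
  define J where "J = 4 * C2 / b"
  have J: "J > 0" using C2 b_pos by (simp add: J_def)
  define T where "T = C2 * (1 + J)\<^sup>2"
  have T: "T > 0" using C2 J by (simp add: T_def)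
  define Z where "Z = 35 * M ^ 4 * T"
  have Z: "Z > 0" using T M3 by (simp add: Z_def)
  \<comment> \<open>Only now is the strength of the bottom layer chosen; \<open>Z\<close> bounds
    what the surface correction can cost in the interior.\<close>
  obtain \<delta> \<Phi> \<Phi>' \<Phi>'' where su: "supersol (10 * M ^ 4 + Z) b U \<delta> \<Phi> \<Phi>' \<Phi>''" using super by blast
  have \<delta>: "0 < \<delta>" "\<delta> < 1" using su by (auto simp: supersol_def)
  have d\<Phi>: "p \<in> {-1..0} \<Longrightarrow> (\<Phi> has_real_derivative \<Phi>' p) (at p within {-1..0})"
    "p \<in> {-1..0} \<Longrightarrow> (\<Phi>' has_real_derivative \<Phi>'' p) (at p within {-1..0})" for p
    using su by (auto simp: supersol_def)
  have \<Phi>b: "p \<in> {-1..0} \<Longrightarrow> b \<le> \<Phi> p" for p using su by (auto simp: supersol_def)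
  have c\<Phi>: "continuous_on {-1..0} \<Phi>" "continuous_on {-1..0} \<Phi>'" "continuous_on {-1..0} \<Phi>''"
    using su by (auto simp: supersol_def intro!: DERIV_continuous_on)
  have "continuous_on {-1..0} (\<lambda>p. \<bar>\<Phi> p\<bar> + \<bar>\<Phi>' p\<bar> + \<bar>\<Phi>'' p\<bar>)" by (intro continuous_intros c\<Phi>)
  then obtain C3 where "C3 > 0" and C3': "\<And>p. p \<in> {-1..0} \<Longrightarrow> \<bar>\<bar>\<Phi> p\<bar> + \<bar>\<Phi>' p\<bar> + \<bar>\<Phi>'' p\<bar>\<bar> \<le> C3"
    using continuous_on_interval_bound by blast
  have C3: "\<bar>\<Phi>' p\<bar> + \<Phi> p \<le> C3" "\<bar>\<Phi>'' p\<bar> \<le> C3" if "p \<in> {-1..0}" for p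
    using C3'[OF that] by linarith+
  obtain \<epsilon> where \<epsilon>: "\<epsilon> > 0" and ff: "far_field \<epsilon> \<Phi> \<Phi>' \<Phi>''"
    using far_field_exists[OF su b_pos] .
  obtain Q where Q: "\<And>q p. q \<le> Q \<Longrightarrow> p \<in> {-1..0} \<Longrightarrow> \<bar>w q p\<bar> < \<epsilon> \<and> \<bar>wq q p\<bar> < \<epsilon> \<and> \<bar>wp q p\<bar> < \<epsilon> \<and>
        \<bar>wqq q p\<bar> < \<epsilon> \<and> \<bar>wqp q p\<bar> < \<epsilon> \<and> \<bar>wpq q p\<bar> < \<epsilon> \<and> \<bar>wpp q p\<bar> < \<epsilon>"
    using decay[OF \<epsilon>] by meson
  define Q0 where "Q0 = min Q (min (l0 - 1) (l0 + ln (\<epsilon> / (2 * T))))"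
  have Q0: "Q0 \<le> Q" "Q0 \<le> l0 - 1" "Q0 \<le> l0 + ln (\<epsilon> / (2 * T))" by (auto simp: Q0_def)
  define W where "W = 12 * M ^ 4 * C3 + Z"
  \<comment> \<open>In order of the entries: \<open>exp (q - l) \<ge> 1 / 2\<close> in the layer;
    tangential error at the surface below 1; \<open>s / n ^ 3 \<le> b / 4\<close>;
    \<open>n * s \<le> \<epsilon> / 2\<close> in the far field; and concavity that beats
    \<open>W\<close> even with \<open>s\<close> as small as \<open>1 / 3\<close> in the
    layer.\<close>
  define n where "n = Max {2, M / c\<^sup>2 + 1, 4 / b, 2 / \<epsilon>, (3 * W + 10 * M ^ 4 + 1) / c\<^sup>2}"
  have n: "n \<ge> 2" "n \<ge> M / c\<^sup>2 + 1" "n \<ge> 4 / b" "n \<ge> 2 / \<epsilon>" "n \<ge> (3 * W + 10 * M ^ 4 + 1) / c\<^sup>2"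
    by (auto simp: n_def)
  have cn: "c\<^sup>2 * n \<ge> 3 * W + 10 * M ^ 4 + 1" using n(5) c_pos by (simp add: field_simps)
  have W: "W > 0" using Z \<open>C3 > 0\<close> M3 by (simp add: W_def add_pos_pos)
  have Mn: "10 * M ^ 4 / n \<le> 10 * M ^ 4" using n(1) M3 by (simp add: divide_le_eq mult_le_cancel_left1)
  then have gap: "c\<^sup>2 * n - 10 * M ^ 4 / n \<ge> 3 * W + 1" using cn by linarith
  have nsq: "n\<^sup>2 \<ge> 1" "n ^ 3 \<ge> n" using n(1) by (auto simp: power2_eq_square power3_eq_cube mult_ge1_I mult_le_cancel_left1)
  \<comment> \<open>Half of the layer width \<open>1 / n^2\<close>: for a plane shifted by at most
    \<open>r\<close>, every point to the right of \<open>l0 - r\<close> belongs to its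
    layer.\<close>
  define r where "r = 1 / (2 * n\<^sup>2)"
  have r: "r > 0" using n(1) by (simp add: r_def)
  let ?K = "{Q0..l0 - r} \<times> {-1 + \<delta>..0}"
  have "\<exists>\<eta>>0. \<forall>q p. Q0 \<le> q \<longrightarrow> q \<le> l0 - r \<longrightarrow> -1 + \<delta> \<le> p \<longrightarrow> p \<le> 0 \<longrightarrow> w q p + \<eta> \<le> w (2 * l0 - q) p"
  proof (cases "?K = {}")
    case True
    then have "\<not> (Q0 \<le> q \<and> q \<le> l0 - r \<and> -1 + \<delta> \<le> p \<and> p \<le> 0)" for q p by force
    then show ?thesis by (intro exI[of _ 1]) auto
  next
    case False
    have sub: "?K \<subseteq> strip" using \<delta> by (auto simp: strip_def)
    have "continuous_on ?K (\<lambda>z. w (2 * l0 - fst z) (snd z) - w (fst z) (snd z))"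
      using continuous_on_subset[OF hsol_cont(1)[OF reflected_sol[of l0]] sub]
        continuous_on_subset[OF hsol_cont(1)[OF sol] sub]
      by (intro continuous_intros)
    then obtain z where z: "z \<in> ?K" "\<And>y. y \<in> ?K \<Longrightarrow>
        w (2 * l0 - fst z) (snd z) - w (fst z) (snd z) \<le> w (2 * l0 - fst y) (snd y) - w (fst y) (snd y)"
      using continuous_attains_inf[OF compact_Times[OF compact_Icc compact_Icc] False] by blast
    have "w (2 * l0 - fst z) (snd z) - w (fst z) (snd z) > 0"
      using z(1) strict[of "fst z" "snd z"] r \<delta> by (auto simp: mem_Times_iff)
    moreover have "w q p + (w (2 * l0 - fst z) (snd z) - w (fst z) (snd z)) \<le> w (2 * l0 - q) p"
      if "Q0 \<le> q" "q \<le> l0 - r" "-1 + \<delta> \<le> p" "p \<le> 0" for q p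
      using z(2)[of "(q, p)"] that by simp
    ultimately show ?thesis by blast
  qed
  then obtain \<eta> where \<eta>: "\<eta> > 0"
    "\<And>q p. Q0 \<le> q \<Longrightarrow> q \<le> l0 - r \<Longrightarrow> -1 + \<delta> \<le> p \<Longrightarrow> p \<le> 0 \<Longrightarrow> w q p + \<eta> \<le> w (2 * l0 - q) p"
    by blast
  \<comment> \<open>Shifting the plane by \<open>d\<close> moves the reflected point by
    \<open>2 * d\<close>, which by the Lipschitz bound costs at most \<eta> on the compact
    region.\<close>
  define d where "d = min r (\<eta> / (2 * M))"
  have d: "d > 0" "d \<le> r" "d \<le> \<eta> / (2 * M)" using r \<eta>(1) M_ge by (auto simp: d_def)
  have dM: "2 * M * d \<le> \<eta>" using d(3) M_ge by (simp add: field_simps)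
  have "w q1 p1 \<le> w (2 * l - q1) p1"
    if l: "l0 \<le> l" "l \<le> l0 + d" and z: "q1 \<le> l" "-1 \<le> p1" "p1 \<le> 0" for l q1 p1
  proof -
    define \<sigma> where "\<sigma> = (\<lambda>q. C2 * exp (q - l))"
    \<comment> \<open>It vanishes at the surface with slope 1, so \<sigma> times it changes the
      normal derivative there but not the value; the exponential factor bounds it by
      \<open>1 / J\<close> in depth.\<close>
    define \<omega> where "\<omega> = (\<lambda>p::real. p * exp (J * p))"
    define \<omega>' where "\<omega>' = (\<lambda>p::real. (1 + J * p) * exp (J * p))"
    define \<omega>'' where "\<omega>'' = (\<lambda>p::real. (2 * J + J\<^sup>2 * p) * exp (J * p))"
    define s where "s = (\<lambda>q. exp (n\<^sup>2 * (q - l)))"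
    have d\<sigma>: "(\<sigma> has_real_derivative \<sigma> q) (at q)" for q
      unfolding \<sigma>_def by (auto intro!: derivative_eq_intros)
    have d\<omega>: "(\<omega> has_real_derivative \<omega>' p) (at p within S)" for p S
      unfolding \<omega>_def \<omega>'_def by (auto intro!: derivative_eq_intros simp: algebra_simps)
    have d\<omega>': "(\<omega>' has_real_derivative \<omega>'' p) (at p within S)" for p S
      unfolding \<omega>'_def \<omega>''_def by (auto intro!: derivative_eq_intros simp: algebra_simps power2_eq_square)
    have ds: "(s has_real_derivative n\<^sup>2 * s q) (at q)" for q
      unfolding s_def by (auto intro!: derivative_eq_intros)
    have n0: "n > 0" using n(1) by simp
    have ds1: "((\<lambda>q. - (s q / n ^ 3)) has_real_derivative - (s q / n)) (at q)" for q
      using n0 by (auto intro!: derivative_eq_intros ds simp: power2_eq_square power3_eq_cube)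
    have ds2: "((\<lambda>q. - (s q / n)) has_real_derivative - (n * s q)) (at q)" for q
      using n0 by (auto intro!: derivative_eq_intros ds simp: power2_eq_square)
    have dA: "((\<lambda>q::real. 1::real) has_real_derivative 0) (at q within S)" "((\<lambda>q::real. 0::real) has_real_derivative 0) (at q within S)" for q S
      by simp_all
    have j: "jet2 (\<lambda>q p. \<Phi> p + \<sigma> q * \<omega> p - s q / n ^ 3) (\<lambda>q p. \<sigma> q * \<omega> p - s q / n) (\<lambda>q p. \<Phi>' p + \<sigma> q * \<omega>' p)
        (\<lambda>q p. \<sigma> q * \<omega> p - n * s q) (\<lambda>q p. \<sigma> q * \<omega>' p) (\<lambda>q p. \<sigma> q * \<omega>' p) (\<lambda>q p. \<Phi>'' p + \<sigma> q * \<omega>'' p)"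
      using jet2_add[OF jet2_add[OF jet2_product[OF dA d\<Phi>] jet2_product[OF d\<sigma> d\<sigma> d\<omega> d\<omega>']]
          jet2_product[OF ds1 ds2 dA]] by simp
    have \<sigma>: "\<sigma> q > 0" "q \<le> l \<Longrightarrow> \<sigma> q \<le> C2" for q
      using C2 by (auto simp: \<sigma>_def mult_le_cancel_left1)
    have s: "s q > 0" "q \<le> l \<Longrightarrow> s q \<le> 1" for q using nsq by (auto simp: s_def mult_le_0_iff)
    have \<omega>b: "\<bar>\<omega> p\<bar> \<le> (1 + J)\<^sup>2" "\<bar>\<omega>' p\<bar> \<le> (1 + J)\<^sup>2" "\<bar>\<omega>'' p\<bar> \<le> (1 + J)\<^sup>2" "\<bar>\<omega> p\<bar> \<le> 1 / J"
      if p: "p \<in> {-1..0}" for p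
    proof -
      have e: "exp (J * p) \<le> 1" "exp (J * p) > 0" using p J by (auto simp: mult_le_0_iff)
      have J1: "1 \<le> (1 + J)\<^sup>2" "1 + J \<le> (1 + J)\<^sup>2" "2 * J + J\<^sup>2 \<le> (1 + J)\<^sup>2"
        using J by (auto simp: power2_eq_square algebra_simps)
      have g: "\<bar>k * exp (J * p)\<bar> \<le> (1 + J)\<^sup>2" if "\<bar>k\<bar> \<le> (1 + J)\<^sup>2" for k
      proof -
        have "\<bar>k * exp (J * p)\<bar> = \<bar>k\<bar> * exp (J * p)" by (simp add: abs_mult)
        also have "\<dots> \<le> (1 + J)\<^sup>2 * 1" using that e J1(1) by (intro mult_mono) auto
        finally show ?thesis by simp
      qed
      have "\<bar>p\<bar> \<le> 1" using p by auto
      then have "\<bar>p\<bar> \<le> (1 + J)\<^sup>2" using J1(1) by linarith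
      then show "\<bar>\<omega> p\<bar> \<le> (1 + J)\<^sup>2" unfolding \<omega>_def by (rule g)
      have Jp: "\<bar>J * p\<bar> \<le> J" "\<bar>J\<^sup>2 * p\<bar> \<le> J\<^sup>2" using \<open>\<bar>p\<bar> \<le> 1\<close> J by (auto simp: abs_mult mult_left_le)
      have "\<bar>1 + J * p\<bar> \<le> (1 + J)\<^sup>2" using Jp(1) J1(2) by linarith
      then show "\<bar>\<omega>' p\<bar> \<le> (1 + J)\<^sup>2" unfolding \<omega>'_def by (rule g)
      have "\<bar>2 * J + J\<^sup>2 * p\<bar> \<le> (1 + J)\<^sup>2" using Jp(2) J1(3) J by linarith
      then show "\<bar>\<omega>'' p\<bar> \<le> (1 + J)\<^sup>2" unfolding \<omega>''_def by (rule g)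
      have "- (J * p) \<le> exp (- (J * p))" using exp_ge_add_one_self[of "- (J * p)"] by linarith
      then have "- (J * p) * exp (J * p) \<le> exp (- (J * p)) * exp (J * p)" using e by (intro mult_right_mono) auto
      then have "J * \<bar>\<omega> p\<bar> \<le> 1" using p by (simp add: \<omega>_def abs_mult exp_minus)
      then show "\<bar>\<omega> p\<bar> \<le> 1 / J" using J by (simp add: field_simps)
    qed
    have tb: "\<bar>\<sigma> q * k\<bar> \<le> T * exp (q - l)" if "\<bar>k\<bar> \<le> (1 + J)\<^sup>2" for q k
    proof -
      have "\<bar>\<sigma> q * k\<bar> = C2 * exp (q - l) * \<bar>k\<bar>" using C2 by (simp add: \<sigma>_def abs_mult)
      also have "\<dots> \<le> C2 * exp (q - l) * (1 + J)\<^sup>2" using that C2 by (intro mult_left_mono) auto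
      finally show ?thesis by (simp add: T_def mult_ac)
    qed
    have Te: "T * exp (q - l) \<le> T" if "q \<le> l" for q using that T by simp
    show ?thesis
    proof (rule comparison[OF reflected_sol sol _ w_decay _ j, where \<epsilon> = \<epsilon> and \<Phi> = \<Phi> and \<Phi>' = \<Phi>' and \<Phi>'' = \<Phi>'' and l = l and b = "b / 2"])
      show "b / 2 > 0" using b_pos by simp
      fix q p :: real assume q: "q \<le> l" and p: "-1 \<le> p" "p \<le> 0"
      have p': "p \<in> {-1..0}" using p by simp
      have "\<bar>\<sigma> q * \<omega> p\<bar> \<le> C2 * (1 / J)"
        unfolding abs_mult using \<sigma>[of q] q \<omega>b(4)[OF p'] J by (intro mult_mono) auto
      also have "\<dots> = b / 4" using C2 b_pos by (simp add: J_def)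
      finally have 1: "\<bar>\<sigma> q * \<omega> p\<bar> \<le> b / 4" .
      have "s q / n ^ 3 \<le> 1 / n" using s[of q] q n0 nsq by (intro frac_le) auto
      also have "\<dots> \<le> b / 4" using n(3) n0 b_pos by (simp add: field_simps)
      finally show "b / 2 \<le> \<Phi> p + \<sigma> q * \<omega> p - s q / n ^ 3" using 1 \<Phi>b[OF p'] by linarith
    next
      fix q p :: real assume q: "q < l" and p: "-1 < p" "p \<le> 0" and v: "w (2 * l - q) p < w q p"
      have p': "p \<in> {-1..0}" using p by simp
      have t: "\<bar>\<sigma> q * \<omega> p\<bar> \<le> T * exp (q - l)" "\<bar>\<sigma> q * \<omega>' p\<bar> \<le> T * exp (q - l)" "\<bar>\<sigma> q * \<omega>'' p\<bar> \<le> T * exp (q - l)"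
        using tb \<omega>b[OF p'] by blast+
      have t': "\<bar>\<sigma> q * \<omega> p\<bar> \<le> T" "\<bar>\<sigma> q * \<omega>' p\<bar> \<le> T" "\<bar>\<sigma> q * \<omega>'' p\<bar> \<le> T"
        using t Te[of q] q by linarith+
      have s0: "s q \<ge> 0" using s(1)[of q] by simp
      have n1: "n \<ge> 1" using n(1) by simp
      have E: "x\<^sup>2 * (\<sigma> q * \<omega> p - n * s q) - x * y * (\<sigma> q * \<omega>' p + \<sigma> q * \<omega>' p) + (1 + y\<^sup>2) * (\<Phi>'' p + \<sigma> q * \<omega>'' p)
          + 10 * M ^ 4 * (\<bar>\<Phi>' p + \<sigma> q * \<omega>' p\<bar> + \<bar>\<sigma> q * \<omega> p - s q / n\<bar> + (\<Phi> p + \<sigma> q * \<omega> p - s q / n ^ 3))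
          \<le> ((1 + y\<^sup>2) * \<Phi>'' p + 10 * M ^ 4 * (\<bar>\<Phi>' p\<bar> + \<Phi> p)) + Z - s q * (c\<^sup>2 * n - 10 * M ^ 4 / n)"
        if "c \<le> x" "x \<le> M" "\<bar>y\<bar> \<le> M" for x y
        unfolding Z_def by (rule perturbed_supersolution_bound[OF that t' n1 s0])
      have \<Phi>0: "\<bar>\<Phi>' p\<bar> + \<Phi> p \<ge> 0" using \<Phi>b[OF p'] b_pos by linarith
      let ?far = "near \<Phi> \<Phi>' \<Phi>'' \<epsilon> p (Hp p + wp q p) (wq q p) (wqq q p) (wqp q p + wpq q p) (wpp q p) (w q p)
         (\<Phi> p + \<sigma> q * \<omega> p - s q / n ^ 3) (\<sigma> q * \<omega> p - s q / n) (\<Phi>' p + \<sigma> q * \<omega>' p) (\<sigma> q * \<omega> p - n * s q)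
         (\<sigma> q * \<omega>' p + \<sigma> q * \<omega>' p) (\<Phi>'' p + \<sigma> q * \<omega>'' p)"
      let ?mid = "\<forall>x y. c \<le> x \<longrightarrow> x \<le> M \<longrightarrow> \<bar>y\<bar> \<le> M \<longrightarrow>
         x\<^sup>2 * (\<sigma> q * \<omega> p - n * s q) - x * y * (\<sigma> q * \<omega>' p + \<sigma> q * \<omega>' p) + (1 + y\<^sup>2) * (\<Phi>'' p + \<sigma> q * \<omega>'' p)
          + 10 * M ^ 4 * (\<bar>\<Phi>' p + \<sigma> q * \<omega>' p\<bar> + \<bar>\<sigma> q * \<omega> p - s q / n\<bar> + (\<Phi> p + \<sigma> q * \<omega> p - s q / n ^ 3)) < 0"
      let ?top = "\<Phi>' p + \<sigma> q * \<omega>' p \<ge> 0 \<and> (\<Phi>' p + \<sigma> q * \<omega>' p) / (2 * M ^ 3) - \<bar>\<sigma> q * \<omega> p - s q / n\<bar> * (M / c\<^sup>2)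
          - \<mu> * \<rho>0 * (\<Phi> p + \<sigma> q * \<omega> p - s q / n ^ 3) > 0"
      \<comment> \<open>Outside these three regions the point lies in the compact set where the
        inequality for \<open>l0\<close> holds with margin \<eta>, so a shift by at most
        \<open>d\<close> cannot produce a violation.\<close>
      consider "q \<le> Q0" | "p \<le> -1 + \<delta>" | "q \<ge> l - 1 / n\<^sup>2"
      proof -
        have False if "Q0 < q" "-1 + \<delta> < p" "q < l - 1 / n\<^sup>2"
        proof -
          have "q \<le> l0 - r" using that(3) l(2) d(2) by (simp add: r_def field_simps)
          then have "w q p + \<eta> \<le> w (2 * l0 - q) p" using \<eta>(2)[of q p] that p by simp
          moreover have "\<bar>w (2 * l - q) p - w (2 * l0 - q) p\<bar> \<le> M * \<bar>(2 * l - q) - (2 * l0 - q)\<bar>"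
            using p by (intro w_lipschitz) auto
          moreover have "M * \<bar>(2 * l - q) - (2 * l0 - q)\<bar> \<le> M * (2 * d)"
            using l M_ge by (intro mult_left_mono) auto
          ultimately show False using v dM by (simp add: mult_ac)
        qed
        then show ?thesis using that by fastforce
      qed
      then show "?far \<or> p < 0 \<and> ?mid \<or> p = 0 \<and> ?top"
      proof cases
        case 1
        have "q \<le> Q" using 1 Q0(1) by simp
        note q' = Q[OF this p']
        have "exp (q - l) \<le> exp (ln (\<epsilon> / (2 * T)))" using 1 Q0(3) l(1) by (subst exp_le_cancel_iff) linarith
        also have "\<dots> = \<epsilon> / (2 * T)" using \<epsilon> T by simp
        finally have "T * exp (q - l) \<le> T * (\<epsilon> / (2 * T))" using T by (intro mult_left_mono) auto
        then have Te2: "T * exp (q - l) \<le> \<epsilon> / 2" using T by simp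
        have "n * s q \<le> \<epsilon> / 2"
        proof -
          have "n\<^sup>2 * (q - l) \<le> n\<^sup>2 * (- 1)" using 1 Q0(2) l(1) by (intro mult_left_mono) auto
          then have "s q \<le> exp (- n\<^sup>2)" by (simp add: s_def)
          also have "\<dots> \<le> 1 / n\<^sup>2"
          proof -
            have "n\<^sup>2 \<le> exp (n\<^sup>2)" using exp_ge_add_one_self[of "n\<^sup>2"] by linarith
            then show ?thesis using n0 by (simp add: exp_minus field_simps)
          qed
          finally have "n * s q \<le> n * (1 / n\<^sup>2)" using n0 by (intro mult_left_mono) auto
          also have "\<dots> = 1 / n" using n0 by (simp add: power2_eq_square)
          also have "\<dots> \<le> \<epsilon> / 2" using n(4) n0 \<epsilon> by (simp add: field_simps)
          finally show ?thesis .
        qed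
        moreover have "s q / n \<le> n * s q" "s q / n ^ 3 \<le> n * s q" "0 \<le> s q / n" "0 \<le> s q / n ^ 3"
        proof -
          have a: "s q / n \<le> s q" "s q / n ^ 3 \<le> s q" "s q \<le> n * s q"
            using n0 n1 nsq s0 by (auto simp: divide_le_eq mult_le_cancel_left1 mult_le_cancel_right1)
          then show "s q / n \<le> n * s q" "s q / n ^ 3 \<le> n * s q" by linarith+
        qed (use s0 n0 in auto)
        ultimately have sb: "s q / n \<le> \<epsilon> / 2" "s q / n ^ 3 \<le> \<epsilon> / 2" "n * s q \<le> \<epsilon> / 2" "0 \<le> s q / n" "0 \<le> s q / n ^ 3" "0 \<le> n * s q"
          using mult_nonneg_nonneg[OF less_imp_le[OF n0] s0] by linarith+
        have ?far
          unfolding near_def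
        proof (intro conjI)
          show "p \<in> {-1..0}" by fact
          show "\<bar>\<Phi> p + \<sigma> q * \<omega> p - s q / n ^ 3 - \<Phi> p\<bar> \<le> \<epsilon>" "\<bar>\<sigma> q * \<omega> p - s q / n\<bar> \<le> \<epsilon>" "\<bar>\<sigma> q * \<omega> p - n * s q\<bar> \<le> \<epsilon>"
            "\<bar>\<Phi>' p + \<sigma> q * \<omega>' p - \<Phi>' p\<bar> \<le> \<epsilon>" "\<bar>\<Phi>'' p + \<sigma> q * \<omega>'' p - \<Phi>'' p\<bar> \<le> \<epsilon>" "\<bar>\<sigma> q * \<omega>' p + \<sigma> q * \<omega>' p\<bar> \<le> 2 * \<epsilon>"
            using t sb Te2 \<epsilon> by linarith+
          show "\<bar>wqp q p + wpq q p\<bar> \<le> 2 * \<epsilon>" using q' by linarith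
        qed (use q' in auto)
        then show ?thesis by blast
      next
        case 2
        have p0: "p < 0" using 2 \<delta> by linarith
        have neg: "\<Phi>'' p + (10 * M ^ 4 + Z) * (1 + \<bar>\<Phi>' p\<bar> + \<Phi> p) < 0"
          using su p' 2 by (simp add: supersol_def)
        define F where "F = \<bar>\<Phi>' p\<bar> + \<Phi> p"
        have F: "F \<ge> 0" "(10 * M ^ 4 + Z) * (1 + \<bar>\<Phi>' p\<bar> + \<Phi> p) = 10 * M ^ 4 + Z + 10 * M ^ 4 * F + Z * F"
          using \<Phi>0 by (auto simp: F_def algebra_simps)
        have pr: "10 * M ^ 4 * F \<ge> 0" "Z * F \<ge> 0" using F M3 Z by auto
        then have neg'': "\<Phi>'' p < 0" using neg F(2) M3 Z by linarith
        have ?mid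
        proof (intro allI impI)
          fix x y assume "c \<le> x" "x \<le> M" "\<bar>y\<bar> \<le> M"
          note E = E[OF this]
          have "(1 + y\<^sup>2) * \<Phi>'' p \<le> \<Phi>'' p" using neg'' by (simp add: mult_le_cancel_right2)
          moreover have "s q * (c\<^sup>2 * n - 10 * M ^ 4 / n) \<ge> 0" using s0 gap W by (intro mult_nonneg_nonneg) auto
          ultimately have "((1 + y\<^sup>2) * \<Phi>'' p + 10 * M ^ 4 * (\<bar>\<Phi>' p\<bar> + \<Phi> p)) + Z - s q * (c\<^sup>2 * n - 10 * M ^ 4 / n) < 0"
            using neg F pr M3 unfolding F_def[symmetric] by linarith
          with E show "x\<^sup>2 * (\<sigma> q * \<omega> p - n * s q) - x * y * (\<sigma> q * \<omega>' p + \<sigma> q * \<omega>' p) + (1 + y\<^sup>2) * (\<Phi>'' p + \<sigma> q * \<omega>'' p)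
          + 10 * M ^ 4 * (\<bar>\<Phi>' p + \<sigma> q * \<omega>' p\<bar> + \<bar>\<sigma> q * \<omega> p - s q / n\<bar> + (\<Phi> p + \<sigma> q * \<omega> p - s q / n ^ 3)) < 0"
            by (rule le_less_trans)
        qed
        then show ?thesis using p0 by blast
      next
        case 3
        have nq: "n\<^sup>2 * (q - l) \<ge> -1"
        proof -
          have "n\<^sup>2 * (q - l) \<ge> n\<^sup>2 * (- (1 / n\<^sup>2))" using 3 by (intro mult_left_mono) auto
          then show ?thesis using n0 by simp
        qed
        show ?thesis
        proof (cases "p = 0")
          case False
          have s3: "s q \<ge> 1 / 3"
          proof -
            have "(1::real) / 3 \<le> exp (-1)" using exp_le by (simp add: exp_minus field_simps)
            also have "\<dots> \<le> s q" using nq by (simp add: s_def)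
            finally show ?thesis .
          qed
          have ?mid
          proof (intro allI impI)
            fix x y assume xy: "c \<le> x" "x \<le> M" "\<bar>y\<bar> \<le> M"
            note E = E[OF this]
            have "1 + y\<^sup>2 \<le> 2 * M ^ 4"
            proof -
              have "y\<^sup>2 \<le> M\<^sup>2" using xy(3) M_ge by (simp add: abs_le_square_iff[symmetric])
              moreover have "M\<^sup>2 \<le> M ^ 4" "1 \<le> M ^ 4" using M_ge by (auto intro: power_increasing)
              ultimately show ?thesis by linarith
            qed
            then have "(1 + y\<^sup>2) * \<Phi>'' p \<le> 2 * M ^ 4 * C3"
              using C3(2)[OF p'] by (intro order_trans[OF mult_left_mono[of "\<Phi>'' p" C3] mult_right_mono]) (use \<open>C3 > 0\<close> in auto)
            moreover have "10 * M ^ 4 * (\<bar>\<Phi>' p\<bar> + \<Phi> p) \<le> 10 * M ^ 4 * C3" using C3(1)[OF p'] M3 by (intro mult_left_mono) auto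
            moreover have "(1 / 3) * (3 * W + 1) \<le> s q * (c\<^sup>2 * n - 10 * M ^ 4 / n)"
              using s3 gap W by (intro mult_mono) auto
            moreover have "2 * M ^ 4 * C3 + 10 * M ^ 4 * C3 + Z = W" by (simp add: W_def)
            moreover have lin: "a + a' + z - k < 0"
              if "a \<le> A" "a' \<le> A'" "(1 / 3) * (3 * v + 1) \<le> k" "A + A' + z = v" for a A a' A' v k z :: real
              using that by (simp add: algebra_simps)
            ultimately have "((1 + y\<^sup>2) * \<Phi>'' p + 10 * M ^ 4 * (\<bar>\<Phi>' p\<bar> + \<Phi> p)) + Z - s q * (c\<^sup>2 * n - 10 * M ^ 4 / n) < 0"
              by blast
            with E show "x\<^sup>2 * (\<sigma> q * \<omega> p - n * s q) - x * y * (\<sigma> q * \<omega>' p + \<sigma> q * \<omega>' p) + (1 + y\<^sup>2) * (\<Phi>'' p + \<sigma> q * \<omega>'' p)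
          + 10 * M ^ 4 * (\<bar>\<Phi>' p + \<sigma> q * \<omega>' p\<bar> + \<bar>\<sigma> q * \<omega> p - s q / n\<bar> + (\<Phi> p + \<sigma> q * \<omega> p - s q / n ^ 3)) < 0"
              by (rule le_less_trans)
          qed
          then show ?thesis using False p by force
        next
          case True
          have om: "\<omega> p = 0" "\<omega>' p = 1" using True by (auto simp: \<omega>_def \<omega>'_def)
          have "\<Phi>' 0 / Hp 0 ^ 3 > \<mu> * \<rho>0 * \<Phi> 0" "\<Phi> 0 \<le> U" using su by (auto simp: supersol_def)
          moreover have "\<mu> * \<rho>0 * \<Phi> 0 > 0" using \<mu>_pos \<rho>0_pos \<Phi>b[of 0] b_pos by (intro mult_pos_pos) auto
          ultimately have \<Phi>'0: "\<Phi>' 0 > 0" using Hp_pos[of 0] by (smt (verit) zero_less_divide_iff zero_less_power atLeastAtMost_iff)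
          have "q - l \<ge> - (1 / n\<^sup>2)" using 3 by simp
          moreover have "1 / n\<^sup>2 \<le> 1 / 4" using n(1) power_mono[of 2 n 2] by (intro frac_le) auto
          ultimately have "exp (q - l) \<ge> 1 / 2" using exp_ge_add_one_self[of "q - l"] by linarith
          then have "\<sigma> q \<ge> C2 * (1 / 2)" using C2 unfolding \<sigma>_def by (intro mult_left_mono) auto
          then have "(\<Phi>' p + \<sigma> q * \<omega>' p) / (2 * M ^ 3) \<ge> (C2 * (1 / 2)) / (2 * M ^ 3)"
            using True om \<Phi>'0 M3 by (intro divide_right_mono) auto
          also have "(C2 * (1 / 2)) / (2 * M ^ 3) = \<mu> * \<rho>0 * U + 1" using M_ge by (simp add: C2_def)
          finally have A: "\<mu> * \<rho>0 * U + 1 \<le> (\<Phi>' p + \<sigma> q * \<omega>' p) / (2 * M ^ 3)" .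
          have "\<bar>\<sigma> q * \<omega> p - s q / n\<bar> * (M / c\<^sup>2) = s q / n * (M / c\<^sup>2)" using om s0 n0 by simp
          also have "\<dots> \<le> 1 / n * (M / c\<^sup>2)"
            using s(2)[of q] q n0 M_ge by (intro mult_right_mono divide_right_mono) auto
          also have "\<dots> < 1"
          proof -
            have "M / c\<^sup>2 < n" using n(2) by linarith
            then have "(M / c\<^sup>2) / n < 1" using n0 by (simp only: pos_divide_less_eq mult_1)
            then show ?thesis by (simp add: mult_ac)
          qed
          finally have B: "\<bar>\<sigma> q * \<omega> p - s q / n\<bar> * (M / c\<^sup>2) < 1" .
          have "\<Phi> p + \<sigma> q * \<omega> p - s q / n ^ 3 \<le> U"
            using \<open>\<Phi> 0 \<le> U\<close> True om s0 n0 by (simp add: diff_le_eq add_increasing2)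
          then have "\<mu> * \<rho>0 * (\<Phi> p + \<sigma> q * \<omega> p - s q / n ^ 3) \<le> \<mu> * \<rho>0 * U"
            using \<mu>_pos \<rho>0_pos by (intro mult_left_mono) auto
          with A B have "(\<Phi>' p + \<sigma> q * \<omega>' p) / (2 * M ^ 3) - \<bar>\<sigma> q * \<omega> p - s q / n\<bar> * (M / c\<^sup>2)
          - \<mu> * \<rho>0 * (\<Phi> p + \<sigma> q * \<omega> p - s q / n ^ 3) > 0" by linarith
          moreover have "\<Phi>' p + \<sigma> q * \<omega>' p \<ge> 0" using True om \<Phi>'0 \<sigma>(1)[of q] by simp
          ultimately show ?thesis using True by blast
        qed
      qed
    qed (use z w_nonneg ff in auto)
  qed
  then show ?thesis using d(1) by (intro exI[of _ d]) auto
qed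

end

lemma derivative_ge_of_increments:
  fixes g :: "real \<Rightarrow> real"
  assumes "(g has_real_derivative D) (at x)" "h0 > 0"
    and "\<And>h. 0 < h \<Longrightarrow> h \<le> h0 \<Longrightarrow> K * h \<le> g (x + h) - g x"
  shows "K \<le> D"
proof (rule ccontr)
  assume "\<not> K \<le> D"
  moreover have "((\<lambda>t. g t - K * t) has_real_derivative D - K) (at x)"
    using assms(1) by (auto intro!: derivative_eq_intros)
  ultimately obtain d where d: "d > 0" "\<And>h. h > 0 \<Longrightarrow> h < d \<Longrightarrow> g (x + h) - K * (x + h) < g x - K * x"
    using DERIV_neg_dec_right[of "\<lambda>t. g t - K * t" "D - K" x] by auto
  define h where "h = min (d / 2) h0"
  have "0 < h" "h < d" "h \<le> h0" using d(1) assms(2) by (auto simp: h_def)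
  then show False using d(2)[of h] assms(3)[of h] by (simp add: algebra_simps)
qed

lemma disc_bounds:
  fixes q p c1 c2 R :: real
  assumes "(q - c1)\<^sup>2 + (p - c2)\<^sup>2 \<le> R\<^sup>2" "R > 0"
  shows "\<bar>q - c1\<bar> \<le> R" "\<bar>p - c2\<bar> \<le> R"
proof -
  have "(q - c1)\<^sup>2 \<le> R\<^sup>2" "(p - c2)\<^sup>2 \<le> R\<^sup>2"
    using assms(1) zero_le_power2[of "q - c1"] zero_le_power2[of "p - c2"] by linarith+
  then show "\<bar>q - c1\<bar> \<le> R" "\<bar>p - c2\<bar> \<le> R"
    using assms(2) by (simp_all add: abs_le_square_iff[symmetric])
qed

section \<open>Strict inequalities and the alternative between symmetry and front\<close>

context elevation_wave
begin

text \<open>One point of strict inequality suffices: the barrier for the reflected wave against the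
  wave, on discs to the left of the line, spreads positivity of the nonnegative difference.\<close>

lemma reflection_strict:
  assumes ge: "\<And>q p. q \<le> l \<Longrightarrow> -1 \<le> p \<Longrightarrow> p \<le> 0 \<Longrightarrow> w q p \<le> w (2 * l - q) p"
    and ne: "w q1 p1 \<noteq> w (2 * l - q1) p1" "q1 \<le> l" "-1 \<le> p1" "p1 \<le> 0"
    and qp: "q < l" "-1 < p" "p \<le> 0"
  shows "w q p < w (2 * l - q) p"
proof -
  let ?f = "\<lambda>q p. w (2 * l - q) p - w q p"
  have "?f q p > 0"
  proof (rule positivity_propagates[OF \<tau>_pos, where L = l and f = ?f])
    show "continuous_on strip (\<lambda>z. ?f (fst z) (snd z))"
      by (intro continuous_on_diff hsol_cont(1)[OF reflected_sol] hsol_cont(1)[OF sol])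
    show "?f q1 p1 > 0" using ge[of q1 p1] ne by auto
    show "q1 < l" using ne by (cases "q1 = l") auto
    have "w x (-1) = 0" for x using sol by (simp add: hsol_def)
    then show "-1 < p1" using ne by (cases "p1 = -1") auto
    fix c1 c2 r R \<eta> q p :: real
    assume r: "0 < r" "r < R" and c2: "c2 < 0" "-1 < c2 - R" and c1: "c1 + R < l"
      and top: "R\<^sup>2 \<le> (1 + \<tau>\<^sup>2) * c2\<^sup>2" and \<eta>: "\<eta> > 0"
      and core: "\<And>q p. (q - c1)\<^sup>2 + (p - c2)\<^sup>2 \<le> r\<^sup>2 \<Longrightarrow> p \<le> 0 \<Longrightarrow> \<eta> \<le> ?f q p"
      and z: "(q - c1)\<^sup>2 + (p - c2)\<^sup>2 < R\<^sup>2" "p \<le> 0"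
    obtain \<alpha> where \<alpha>: "\<alpha> > 0" and bar: "barrier_bound c1 c2 r R \<alpha>"
      using barrier[OF r c2 top, of c1] by blast
    have "\<eta> * (exp (- \<alpha> * ((q - c1)\<^sup>2 + (p - c2)\<^sup>2)) - exp (- \<alpha> * R\<^sup>2)) \<le> w (2 * l - q) p - w q p"
    proof (rule bar[unfolded barrier_bound_def, rule_format, OF reflected_sol sol \<eta>])
      fix q p assume "(q - c1)\<^sup>2 + (p - c2)\<^sup>2 \<le> R\<^sup>2" "p \<le> 0"
      with disc_bounds[OF this(1)] show "w q p \<le> w (2 * l - q) p"
        using r c1 c2 by (intro ge) auto
    qed (use core z in \<open>fastforce+\<close>)
    moreover have "exp (- \<alpha> * ((q - c1)\<^sup>2 + (p - c2)\<^sup>2)) > exp (- \<alpha> * R\<^sup>2)" using z(1) \<alpha> by simp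
    ultimately show "?f q p > 0" using \<eta> by (smt (verit) mult_pos_pos)
  qed (use ne qp in auto)
  then show ?thesis by simp
qed

text \<open>Since \<open>w\<close> is only twice differentiable, \<open>wq\<close> itself satisfies no classical equation; the barrier
  is applied to the increments \<open>w (q + h) p - w q p\<close>, with constants independent of \<open>h\<close>.\<close>

lemma wq_positive:
  assumes mono: "\<And>q q' p. q \<le> q' \<Longrightarrow> q' \<le> L \<Longrightarrow> -1 \<le> p \<Longrightarrow> p \<le> 0 \<Longrightarrow> w q p \<le> w q' p"
    and qp: "q < L" "-1 < p" "p \<le> 0"
  shows "wq q p > 0"
proof -
  \<comment> \<open>A starting point for the propagation: at the surface \<open>w\<close> rises from
    smaller values far to the left up to its positive value at \<open>L - 1\<close>, so its
    derivative is positive somewhere in between.\<close>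
  have "\<exists>\<xi><L. wq \<xi> 0 > 0"
  proof -
    have "w (L - 1) 0 > 0" using pos by simp
    then obtain Q where Q: "\<forall>q\<le>Q. \<forall>p\<in>{-1..0}. \<bar>w q p\<bar> < w (L - 1) 0" using w_decay by blast
    define a where "a = min Q (L - 2)"
    have "w a 0 < w (L - 1) 0" using Q[rule_format, of a 0] by (simp add: a_def)
    moreover have aL: "a < L - 1" by (simp add: a_def)
    then obtain \<xi> where "a < \<xi>" "\<xi> < L - 1" "w (L - 1) 0 - w a 0 = (L - 1 - a) * wq \<xi> 0"
      using MVT2[of a "L - 1" "\<lambda>t. w t 0" "\<lambda>t. wq t 0"] w_deriv[of 0] by auto
    ultimately have "0 < (L - 1 - a) * wq \<xi> 0" "\<xi> < L" by linarith+
    then show ?thesis using aL by (auto simp: zero_less_mult_iff)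
  qed
  then obtain \<xi> where \<xi>: "\<xi> < L" "wq \<xi> 0 > 0" by blast
  show ?thesis
  proof (rule positivity_propagates[OF \<tau>_pos, where L = L and f = wq and ?q1.0 = \<xi> and ?p1.0 = 0])
    show "continuous_on strip (\<lambda>z. wq (fst z) (snd z))" using hsol_cont(2)[OF sol] .
    fix c1 c2 r R \<eta> q p :: real
    assume r: "0 < r" "r < R" and c2: "c2 < 0" "-1 < c2 - R" and c1: "c1 + R < L"
      and top: "R\<^sup>2 \<le> (1 + \<tau>\<^sup>2) * c2\<^sup>2" and \<eta>: "\<eta> > 0"
      and core: "\<And>q p. (q - c1)\<^sup>2 + (p - c2)\<^sup>2 \<le> r\<^sup>2 \<Longrightarrow> p \<le> 0 \<Longrightarrow> \<eta> \<le> wq q p"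
      and z: "(q - c1)\<^sup>2 + (p - c2)\<^sup>2 < R\<^sup>2" "p \<le> 0"
    have r2: "0 < r / 2" "r / 2 < R" using r by auto
    obtain \<alpha> where \<alpha>: "\<alpha> > 0" and bar: "barrier_bound c1 c2 (r / 2) R \<alpha>"
      using barrier[OF r2 c2 top, of c1] by blast
    \<comment> \<open>The core is halved so that points shifted by at most \<open>r / 2\<close> stay
      in the disc where \<open>\<eta> \<le> wq\<close>; the mean value theorem then gives the margin
      \<open>h * \<eta>\<close> for the increment. The other bound keeps shifted points at or to the
      left of \<open>L\<close>.\<close>
    define h0 where "h0 = min (r / 2) (L - (c1 + R))"
    have h0: "h0 > 0" using r c1 by (simp add: h0_def)
    have pin: "-1 \<le> p" if "(q - c1)\<^sup>2 + (p - c2)\<^sup>2 \<le> R\<^sup>2" for q p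
      using disc_bounds[OF that] r c2 by auto
    have "\<eta> * (exp (- \<alpha> * ((q - c1)\<^sup>2 + (p - c2)\<^sup>2)) - exp (- \<alpha> * R\<^sup>2)) \<le> wq q p"
    proof (rule derivative_ge_of_increments[OF w_deriv h0])
      show "-1 \<le> p" "p \<le> 0" using z pin[of q p] by auto
      fix h assume h: "0 < h" "h \<le> h0"
      have "(h * \<eta>) * (exp (- \<alpha> * ((q - c1)\<^sup>2 + (p - c2)\<^sup>2)) - exp (- \<alpha> * R\<^sup>2)) \<le> w (q + h) p - w q p"
      proof (rule bar[unfolded barrier_bound_def, rule_format, OF translated_sol sol])
        show "h * \<eta> > 0" using h \<eta> by simp
        fix q p assume d: "(q - c1)\<^sup>2 + (p - c2)\<^sup>2 \<le> R\<^sup>2" "p \<le> 0"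
        with disc_bounds[OF this(1)] pin[OF d(1)] show "w q p \<le> w (q + h) p"
          using r c1 h by (intro mono) (auto simp: h0_def)
      next
        fix q p assume d: "(q - c1)\<^sup>2 + (p - c2)\<^sup>2 \<le> (r / 2)\<^sup>2" "p \<le> 0"
        have "(r / 2)\<^sup>2 \<le> R\<^sup>2" using r by (intro power_mono) auto
        then have p: "-1 \<le> p" using pin d(1) by (meson order_trans)
        obtain x where x: "q < x" "x < q + h" "w (q + h) p - w q p = (q + h - q) * wq x p"
          using MVT2[of q "q + h" "\<lambda>t. w t p" "\<lambda>t. wq t p"] w_deriv[OF p d(2)] h by auto
        have a: "\<bar>q - c1\<bar> \<le> r / 2" using disc_bounds[OF d(1)] r by simp
        have "\<bar>x - c1\<bar> \<le> \<bar>q - c1\<bar> + h" using x by auto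
        then have "(x - c1)\<^sup>2 \<le> (\<bar>q - c1\<bar> + h)\<^sup>2" using power_mono[of "\<bar>x - c1\<bar>" "\<bar>q - c1\<bar> + h" 2] by simp
        also have "\<dots> = (q - c1)\<^sup>2 + (2 * \<bar>q - c1\<bar> * h + h\<^sup>2)" by (simp add: power2_sum)
        finally have "(x - c1)\<^sup>2 + (p - c2)\<^sup>2 \<le> (r / 2)\<^sup>2 + (2 * \<bar>q - c1\<bar> * h + h\<^sup>2)" using d(1) by linarith
        also have "2 * \<bar>q - c1\<bar> * h \<le> 2 * (r / 2) * h" using a h by (intro mult_right_mono) auto
        also have "(r / 2)\<^sup>2 + (2 * (r / 2) * h + h\<^sup>2) = (r / 2 + h)\<^sup>2" by (simp add: power2_sum)
        also have "\<dots> \<le> r\<^sup>2" using h r by (intro power_mono) (auto simp: h0_def)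
        finally have "(x - c1)\<^sup>2 + (p - c2)\<^sup>2 \<le> r\<^sup>2" by simp
        then have "\<eta> \<le> wq x p" using core d(2) by blast
        then show "w q p + h * \<eta> \<le> w (q + h) p" using x(3) h by (simp add: algebra_simps)
      qed (use z in auto)
      then show "\<eta> * (exp (- \<alpha> * ((q - c1)\<^sup>2 + (p - c2)\<^sup>2)) - exp (- \<alpha> * R\<^sup>2)) * h \<le> w (q + h) p - w q p"
        by (simp add: mult_ac)
    qed
    moreover have "exp (- \<alpha> * ((q - c1)\<^sup>2 + (p - c2)\<^sup>2)) > exp (- \<alpha> * R\<^sup>2)" using z(1) \<alpha> by simp
    ultimately show "wq q p > 0" using \<eta> by (smt (verit) mult_pos_pos)
  qed (use \<xi> qp in auto)
qed

text \<open>If the plane positions are unbounded, reflection about the midpoint of \<open>q\<close>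
  and \<open>q'\<close> shows that \<open>w\<close> is monotone. Otherwise take their supremum
  \<open>l\<close>: were the reflection about \<open>l\<close> not an equality, it would be strict,
  and \<open>planes_step\<close> would move the plane beyond \<open>l\<close>.\<close>

lemma moving_planes:
  "(\<forall>q q' p. q \<le> q' \<longrightarrow> -1 \<le> p \<longrightarrow> p \<le> 0 \<longrightarrow> w q p \<le> w q' p) \<or>
   (\<exists>l. (\<forall>q p. -1 \<le> p \<longrightarrow> p \<le> 0 \<longrightarrow> w (2 * l - q) p = w q p) \<and>
        (\<forall>q p. q < l \<longrightarrow> -1 < p \<longrightarrow> p \<le> 0 \<longrightarrow> wq q p > 0))"
proof -
  define \<Lambda> where "\<Lambda> = {l. \<forall>l'\<le>l. \<forall>q\<le>l'. \<forall>p\<in>{-1..0}. w q p \<le> w (2 * l' - q) p}"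
  have mono: "w q p \<le> w q' p" if "l \<in> \<Lambda>" "q \<le> q'" "q' \<le> l" "-1 \<le> p" "p \<le> 0" for l q q' p
  proof -
    have "w q p \<le> w (2 * ((q + q') / 2) - q) p"
      using that by (intro that(1)[unfolded \<Lambda>_def, simplified, rule_format]) auto
    moreover have "2 * ((q + q') / 2) - q = q'" by (simp add: field_simps)
    ultimately show ?thesis by (simp only:)
  qed
  obtain Q where "Q \<in> \<Lambda>" using planes_start by (force simp: \<Lambda>_def)
  show ?thesis
  proof (cases "bdd_above \<Lambda>")
    case False
    have "w q p \<le> w q' p" if "q \<le> q'" "-1 \<le> p" "p \<le> 0" for q q' p
    proof -
      obtain l where "l \<in> \<Lambda>" "q' < l" using False by (auto simp: bdd_above_def not_le)
      then show ?thesis using mono[of l q q' p] that by simp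
    qed
    then show ?thesis by blast
  next
    case True
    define l where "l = Sup \<Lambda>"
    have below: "w q p \<le> w (2 * l' - q) p" if "l' < l" "q \<le> l'" "-1 \<le> p" "p \<le> 0" for l' q p
    proof -
      obtain x where "x \<in> \<Lambda>" "l' < x" using less_cSupD[of \<Lambda> l'] \<open>Q \<in> \<Lambda>\<close> \<open>l' < l\<close> unfolding l_def by blast
      then show ?thesis using that by (auto simp: \<Lambda>_def)
    qed
    have at: "w q p \<le> w (2 * l - q) p" if "q \<le> l" "-1 \<le> p" "p \<le> 0" for q p
    proof (rule ccontr)
      assume neg: "\<not> ?thesis"
      then have "q < l" using that(1) by (cases "q = l") auto
      define g where "g = w q p - w (2 * l - q) p"
      have g: "g > 0" using neg by (simp add: g_def)
      \<comment> \<open>A position slightly to the left, where the inequality is known; the shift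
        costs at most half of the supposed violation \<open>g\<close>.\<close>
      define l' where "l' = max q (l - g / (4 * M))"
      have l': "l' < l" "q \<le> l'" "l - l' \<le> g / (4 * M)" using \<open>q < l\<close> g M_ge by (auto simp: l'_def)
      have "\<bar>w (2 * l' - q) p - w (2 * l - q) p\<bar> \<le> M * \<bar>(2 * l' - q) - (2 * l - q)\<bar>"
        using that by (intro w_lipschitz) auto
      also have "\<dots> = 2 * M * (l - l')" using l' by simp
      also have "\<dots> \<le> 2 * M * (g / (4 * M))" using l' M_ge by (intro mult_left_mono) auto
      also have "\<dots> = g / 2" using M_ge by simp
      finally have "w (2 * l' - q) p - w (2 * l - q) p \<le> g / 2" by (rule abs_le_D1)
      moreover have "w q p \<le> w (2 * l' - q) p" by (rule below[OF l'(1,2) that(2,3)])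
      ultimately have "g \<le> g / 2" unfolding g_def by (rule order_trans[OF diff_right_mono, rotated])
      then show False using g by simp
    qed
    have l\<Lambda>: "l \<in> \<Lambda>"
      unfolding \<Lambda>_def using below at by (smt (verit) atLeastAtMost_iff mem_Collect_eq)
    have sym: "w q0 p0 = w (2 * l - q0) p0" if z: "q0 \<le> l" "-1 \<le> p0" "p0 \<le> 0" for q0 p0
    proof (rule ccontr)
      assume ne: "w q0 p0 \<noteq> w (2 * l - q0) p0"
      have "w q p < w (2 * l - q) p" if "q < l" "-1 < p" "p \<le> 0" for q p
        using reflection_strict[OF _ ne z that] at by blast
      then obtain d where d: "d > 0" "\<forall>l'\<in>{l..l + d}. \<forall>q\<le>l'. \<forall>p\<in>{-1..0}. w q p \<le> w (2 * l' - q) p"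
        using planes_step by blast
      have "l + d \<in> \<Lambda>"
        unfolding \<Lambda>_def
      proof (intro CollectI allI impI ballI)
        fix l' q p assume *: "l' \<le> l + d" "q \<le> l'" "p \<in> {-1..0::real}"
        show "w q p \<le> w (2 * l' - q) p"
        proof (cases "l' < l")
          case True then show ?thesis using below[of l' q p] * by simp
        next
          case False
          then have "l' \<in> {l..l + d}" using *(1) by simp
          then show ?thesis using d(2) *(2,3) by blast
        qed
      qed
      then have "l + d \<le> l" unfolding l_def using True by (rule cSup_upper)
      then show False using d(1) by simp
    qed
    have sym': "w (2 * l - q) p = w q p" if "-1 \<le> p" "p \<le> 0" for q p
    proof (cases "q \<le> l")
      case True
      show ?thesis by (rule sym[OF True that, symmetric])
    next
      case False
      then have "2 * l - q \<le> l" by simp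
      from sym[OF this that] show ?thesis by (simp only: diff_diff_eq2 add_diff_cancel_left')
    qed
    moreover have "wq q p > 0" if "q < l" "-1 < p" "p \<le> 0" for q p
      using wq_positive[of l q p] mono[OF l\<Lambda>] that by blast
    ultimately show ?thesis by blast
  qed
qed

end

section \<open>Conjugate flows and fronts\<close>

text \<open>The mean value theorem gives a point where the derivative is the secant slope, and the
  second derivative bounds the deviation from it. In this way convergence of \<open>w\<close> at
  infinity passes to \<open>wq\<close> and \<open>wp\<close> without extracting
  subsequences.\<close>

lemma derivative_interpolation:
  fixes g g' :: "real \<Rightarrow> real"
  assumes ab: "a < b" "p \<in> {a..b}"
    and g: "\<And>x. x \<in> {a..b} \<Longrightarrow> (g has_real_derivative g' x) (at x within {a..b})"
    and g': "\<And>x. x \<in> {a..b} \<Longrightarrow> (g' has_real_derivative g'' x) (at x within {a..b})"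
    and K: "\<And>x. x \<in> {a..b} \<Longrightarrow> \<bar>g'' x\<bar> \<le> K"
  shows "\<bar>g' p\<bar> \<le> \<bar>g b - g a\<bar> / (b - a) + K * (b - a)"
proof -
  have "(g has_real_derivative g' x) (at x)" if "x \<in> {a<..<b}" for x
    using g[of x] that at_within_Icc_at[of a x b] by simp
  moreover have "continuous_on {a..b} g" using g by (rule DERIV_continuous_on)
  ultimately obtain \<xi> where \<xi>: "\<xi> \<in> {a<..<b}" "g b - g a = (b - a) * g' \<xi>"
    using MVT[of a b g] ab
    by (metis (no_types, lifting) DERIV_unique greaterThanLessThan_iff real_differentiable_def)
  have "\<bar>g' p - g' \<xi>\<bar> \<le> K * \<bar>p - \<xi>\<bar>"
    using field_differentiable_bound[of "{a..b}" g' g'' K p \<xi>] g' K ab \<xi> by auto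
  also have "\<dots> \<le> K * (b - a)"
    using ab \<xi> K[of p] by (intro mult_left_mono) auto
  finally have "\<bar>g' p\<bar> \<le> \<bar>g' \<xi>\<bar> + K * (b - a)" by linarith
  also have "\<bar>g' \<xi>\<bar> = \<bar>g b - g a\<bar> / (b - a)" using \<xi>(2) ab by (simp add: abs_mult)
  finally show ?thesis .
qed

lemma tendsto_at_top_Cauchy:
  fixes f :: "real \<Rightarrow> real"
  assumes "\<And>e. e > 0 \<Longrightarrow> \<exists>Q. \<forall>q\<ge>Q. \<forall>q'\<ge>Q. \<bar>f q - f q'\<bar> < e"
  shows "\<exists>l. (f \<longlongrightarrow> l) at_top"
proof -
  have "Cauchy (\<lambda>n. f (real n))"
  proof (rule metric_CauchyI)
    fix e :: real assume "e > 0"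
    then obtain Q where Q: "\<And>q q'. q \<ge> Q \<Longrightarrow> q' \<ge> Q \<Longrightarrow> \<bar>f q - f q'\<bar> < e" using assms by blast
    obtain N :: nat where "real N \<ge> Q" using real_arch_simple by blast
    then show "\<exists>N. \<forall>m\<ge>N. \<forall>n\<ge>N. dist (f (real m)) (f (real n)) < e"
      by (intro exI[of _ N]) (auto simp: dist_real_def intro!: Q)
  qed
  then obtain l where l: "(\<lambda>n. f (real n)) \<longlonglongrightarrow> l" using Cauchy_convergent convergent_def by blast
  have "(f \<longlongrightarrow> l) at_top"
    unfolding tendsto_iff eventually_at_top_linorder
  proof (intro allI impI)
    fix e :: real assume e: "e > 0"
    then obtain Q where Q: "\<And>q q'. q \<ge> Q \<Longrightarrow> q' \<ge> Q \<Longrightarrow> \<bar>f q - f q'\<bar> < e / 2" using assms[of "e / 2"] by auto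
    obtain N where N: "\<And>n. n \<ge> N \<Longrightarrow> dist (f (real n)) l < e / 2"
      using metric_LIMSEQ_D[OF l, of "e / 2"] e by auto
    obtain N' :: nat where N': "real N' \<ge> Q" using real_arch_simple by blast
    have "dist (f q) l < e" if "q \<ge> Q" for q
    proof -
      have "dist (f (real (max N N'))) l < e / 2" by (intro N) simp
      moreover have "\<bar>f q - f (real (max N N'))\<bar> < e / 2" using N' that by (intro Q) auto
      ultimately show ?thesis unfolding dist_real_def by linarith
    qed
    then show "\<exists>Q. \<forall>q\<ge>Q. dist (f q) l < e" by blast
  qed
  then show ?thesis by blast
qed

lemma dominated_convergence_Icc:
  fixes f :: "nat \<Rightarrow> real \<Rightarrow> real"
  assumes "\<And>k. continuous_on {a..b} (f k)" "\<And>k x. x \<in> {a..b} \<Longrightarrow> \<bar>f k x\<bar> \<le> B"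
    and "\<And>x. x \<in> {a..b} \<Longrightarrow> (\<lambda>k. f k x) \<longlonglongrightarrow> g x"
  shows "g integrable_on {a..b}" "(\<lambda>k. integral {a..b} (f k)) \<longlonglongrightarrow> integral {a..b} g"
proof -
  have i: "f k integrable_on {a..b}" for k by (rule integrable_continuous_real[OF assms(1)])
  have n: "norm (f k x) \<le> B" if "x \<in> {a..b}" for k x using assms(2)[OF that] by simp
  show "g integrable_on {a..b}" "(\<lambda>k. integral {a..b} (f k)) \<longlonglongrightarrow> integral {a..b} g"
    using dominated_convergence[OF i integrable_const_ivl n assms(3)] by blast+
qed

text \<open>Increments of \<open>J\<close> over \<open>[n, n + 1]\<close> tend to 0 and are values
  of \<open>J'\<close> at points going to infinity. This turns identities for
  \<open>q\<close>-derivatives into equations for the limiting flow.\<close>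

lemma derivative_limit_zero:
  fixes J J' :: "real \<Rightarrow> real"
  assumes d: "\<And>q. (J has_real_derivative J' q) (at q)"
    and J: "\<And>X. filterlim X at_top sequentially \<Longrightarrow> (\<lambda>n. J (X n)) \<longlonglongrightarrow> 0"
    and J': "\<And>X. filterlim X at_top sequentially \<Longrightarrow> (\<lambda>n. J' (X n)) \<longlonglongrightarrow> l"
  shows "l = 0"
proof -
  have "\<exists>\<xi>. real n < \<xi> \<and> J (real n + 1) - J (real n) = J' \<xi>" for n
    using MVT2[of "real n" "real n + 1" J J'] d by auto
  then obtain \<xi> where \<xi>: "\<And>n. real n < \<xi> n" "\<And>n. J (real n + 1) - J (real n) = J' (\<xi> n)" by metis
  have "filterlim \<xi> at_top sequentially"
    using filterlim_at_top_mono[OF filterlim_real_sequentially] \<xi>(1) by (simp add: less_imp_le)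
  from J'[OF this] have "(\<lambda>n. J (real n + 1) - J (real n)) \<longlonglongrightarrow> l" by (simp add: \<xi>(2))
  moreover have "filterlim (\<lambda>n. real n + 1) at_top sequentially"
    using filterlim_at_top_mono[OF filterlim_real_sequentially, of "\<lambda>n. real n + 1"] by simp
  then have "(\<lambda>n. J (real n + 1) - J (real n)) \<longlonglongrightarrow> 0 - 0"
    by (intro tendsto_diff J filterlim_real_sequentially)
  ultimately show ?thesis using LIMSEQ_unique by fastforce
qed

lemma leibniz_strip:
  fixes f fq :: "real \<Rightarrow> real \<Rightarrow> real"
  assumes d: "\<And>q p. p \<in> {a..b} \<Longrightarrow> ((\<lambda>t. f t p) has_real_derivative fq q p) (at q)"
    and c: "\<And>q. continuous_on {a..b} (f q)"
    and cq: "continuous_on strip (\<lambda>z. fq (fst z) (snd z))" and ab: "-1 \<le> a" "b \<le> 0"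
  shows "((\<lambda>q. integral {a..b} (f q)) has_real_derivative integral {a..b} (fq q)) (at q)"
proof -
  have "((\<lambda>q. integral (cbox a b) (f q)) has_field_derivative integral (cbox a b) (fq q)) (at q within UNIV)"
  proof (rule leibniz_rule_field_derivative)
    show "continuous_on (UNIV \<times> cbox a b) (\<lambda>(x, t). fq x t)"
      unfolding case_prod_beta using ab by (intro continuous_on_subset[OF cq]) (auto simp: strip_def)
  qed (use d c in \<open>auto intro: integrable_continuous_real\<close>)
  then show ?thesis by simp
qed

lemma has_real_derivative_flux:
  fixes x y k :: "real \<Rightarrow> real"
  assumes "(y has_real_derivative y') (at p within S)" "(x has_real_derivative x') (at p within S)"
    "(k has_real_derivative k') (at p within S)" and nz: "x p \<noteq> 0" "k p \<noteq> 0"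
  shows "((\<lambda>t. - (1 + (y t)\<^sup>2) / (2 * (x t)\<^sup>2) + 1 / (2 * (k t)\<^sup>2)) has_real_derivative
      - (y p * y') / (x p)\<^sup>2 + (1 + (y p)\<^sup>2) * x' / x p ^ 3 - k' / k p ^ 3) (at p within S)"
  by (rule derivative_eq_intros assms(1-3) refl | simp add: nz)+
    (use nz in \<open>simp add: field_simps power2_eq_square power3_eq_cube power4_eq_xxxx\<close>)

lemma has_real_derivative_quotient:
  fixes x y :: "real \<Rightarrow> real"
  assumes "(y has_real_derivative y') (at q)" "(x has_real_derivative x') (at q)" and nz: "x q \<noteq> 0"
  shows "((\<lambda>t. y t / x t) has_real_derivative y' / x q - y q * x' / (x q)\<^sup>2) (at q)"
  by (rule derivative_eq_intros assms(1,2) refl | simp add: nz)+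
    (use nz in \<open>simp add: field_simps power2_eq_square\<close>)

section \<open>Divergence form, integral identities and the flow force\<close>

context elevation_wave
begin

text \<open>The bounds for \<open>Hp + wp\<close> are inherited at the undisturbed end, where
  \<open>wp\<close> tends to 0.\<close>

lemma Hp_bounds:
  assumes p: "p \<in> {-1..0}"
  shows "c \<le> Hp p" "Hp p \<le> M"
proof -
  have near: "\<exists>q. \<bar>wp q p\<bar> < e" if "e > 0" for e using decay[OF that] p by blast
  have b: "c \<le> Hp p + wp q p" "Hp p + wp q p \<le> M" for q using hsol_bounds(8,9)[OF sol] p by auto
  show "c \<le> Hp p"
  proof (rule field_le_epsilon)
    fix e :: real assume "e > 0"
    then obtain q where "\<bar>wp q p\<bar> < e" using near by blast
    then show "c \<le> Hp p + e" using b(1)[of q] by linarith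
  qed
  show "Hp p \<le> M"
  proof (rule field_le_epsilon)
    fix e :: real assume "e > 0"
    then obtain q where "\<bar>wp q p\<bar> < e" using near by blast
    then show "Hp p \<le> M + e" using b(2)[of q] by linarith
  qed
qed

lemma slice_cont:
  "continuous_on {-1..0} (w q)" "continuous_on {-1..0} (wq q)" "continuous_on {-1..0} (wp q)"
  "continuous_on {-1..0} (wqq q)" "continuous_on {-1..0} (wqp q)" "continuous_on {-1..0} (wpq q)"
  "continuous_on {-1..0} (wpp q)"
proof -
  have *: "continuous_on {-1..0} (f q)" if "continuous_on strip (\<lambda>z. f (fst z) (snd z))" for f :: "real \<Rightarrow> real \<Rightarrow> real"
  proof -
    have "continuous_on {-1..0} (\<lambda>p. (\<lambda>z. f (fst z) (snd z)) (q, p))"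
      by (rule continuous_on_compose2[OF that]) (auto simp: strip_def intro!: continuous_intros)
    then show ?thesis by simp
  qed
  show "continuous_on {-1..0} (w q)" "continuous_on {-1..0} (wq q)" "continuous_on {-1..0} (wp q)"
    "continuous_on {-1..0} (wqq q)" "continuous_on {-1..0} (wqp q)" "continuous_on {-1..0} (wpq q)"
    "continuous_on {-1..0} (wpp q)"
    using hsol_cont[OF sol] by (auto intro: *)
qed

lemma partials:
  assumes "p \<in> {-1..0}"
  shows "((\<lambda>t. w t p) has_real_derivative wq q p) (at q)"
    "((\<lambda>t. wq t p) has_real_derivative wqq q p) (at q)"
    "((\<lambda>t. wp t p) has_real_derivative wpq q p) (at q)"
    "((\<lambda>t. w q t) has_real_derivative wp q p) (at p within {-1..0})"
    "((\<lambda>t. wq q t) has_real_derivative wqp q p) (at p within {-1..0})"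
    "((\<lambda>t. wp q t) has_real_derivative wpp q p) (at p within {-1..0})"
  using jet2_partials[OF hsol_jet2[OF sol]] assms by auto

text \<open>Writing \<open>w\<close> as the integral of \<open>wp\<close> from the bed and
  differentiating under the integral expresses \<open>wq\<close> as the integral of
  \<open>wpq\<close>, whose \<open>p\<close>-derivative is then read off. The flow force identity
  depends on this symmetry.\<close>

lemma mixed_partials:
  assumes p: "p \<in> {-1..0}"
  shows "wqp q p = wpq q p"
proof -
  have w0: "w q (-1) = 0" for q using sol by (simp add: hsol_def)
  have "wq q p = integral {-1..p} (wpq q)" if p: "p \<in> {-1..0}" for p
  proof -
    have sub: "{-1..p} \<subseteq> {-1..0}" using p by auto
    have ft: "(wp q has_integral w q p - w q (-1)) {-1..p}" for q
    proof (rule fundamental_theorem_of_calculus)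
      show "-1 \<le> p" using p by simp
      fix t assume "t \<in> {-1..p}"
      then have "t \<in> {-1..0}" using p by auto
      from DERIV_subset[OF partials(4)[OF this] sub]
      show "(w q has_vector_derivative wp q t) (at t within {-1..p})"
        by (simp add: has_real_derivative_iff_has_vector_derivative)
    qed
    have "(\<lambda>q. w q p) = (\<lambda>q. integral {-1..p} (wp q))" using integral_unique[OF ft] w0 by auto
    moreover have "((\<lambda>q. integral {-1..p} (wp q)) has_real_derivative integral {-1..p} (wpq q)) (at q)"
      using p partials(3) sub hsol_cont(6)[OF sol]
      by (intro leibniz_strip continuous_on_subset[OF slice_cont(3) sub]) auto
    ultimately have "((\<lambda>q. w q p) has_real_derivative integral {-1..p} (wpq q)) (at q)" by simp
    then show ?thesis using partials(1)[OF p] DERIV_unique by blast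
  qed
  moreover have "((\<lambda>p. integral {-1..p} (wpq q)) has_real_derivative wpq q p) (at p within {-1..0})"
    by (intro integral_has_real_derivative slice_cont p)
  ultimately have "(wq q has_real_derivative wpq q p) (at p within {-1..0})"
    using has_real_derivative_transform[of _ _ p "{-1..0}" "wq q"] p by blast
  then show ?thesis using has_real_derivative_unique_Icc[OF partials(5)[OF p]] p by simp
qed

text \<open>The vertical flux of the height equation in divergence form; \<open>slope\<close> is the
  horizontal flux, and \<open>Gp\<close> and \<open>slopeq\<close> are the derivatives that enter
  the divergence.\<close>

definition G :: "real \<Rightarrow> real \<Rightarrow> real" where
  "G q p = - (1 + (wq q p)\<^sup>2) / (2 * (Hp p + wp q p)\<^sup>2) + 1 / (2 * (Hp p)\<^sup>2)"

definition Gp :: "real \<Rightarrow> real \<Rightarrow> real" where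
  "Gp q p = - (wq q p * wqp q p) / (Hp p + wp q p)\<^sup>2
     + (1 + (wq q p)\<^sup>2) * (Hpp p + wpp q p) / (Hp p + wp q p) ^ 3 - Hpp p / Hp p ^ 3"

definition slope :: "real \<Rightarrow> real \<Rightarrow> real" where
  "slope q p = wq q p / (Hp p + wp q p)"

definition slopeq :: "real \<Rightarrow> real \<Rightarrow> real" where
  "slopeq q p = wqq q p / (Hp p + wp q p) - wq q p * wpq q p / (Hp p + wp q p)\<^sup>2"

lemma hp_pos: "p \<in> {-1..0} \<Longrightarrow> Hp p + wp q p > 0"
  using hsol_bounds(8)[OF sol, of p q] c_pos by auto

lemma G_deriv:
  assumes p: "p \<in> {-1..0}"
  shows "(G q has_real_derivative Gp q p) (at p within {-1..0})"
  unfolding G_def Gp_def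
  by (rule has_real_derivative_flux)
    (use hp_pos[OF p, of q] Hp_pos[OF p] in \<open>auto intro!: DERIV_add partials[OF p] Hp_deriv[OF p]\<close>)

lemma slope_deriv:
  assumes p: "p \<in> {-1..0}"
  shows "((\<lambda>t. slope t p) has_real_derivative slopeq q p) (at q)"
  unfolding slope_def slopeq_def
  by (rule has_real_derivative_quotient)
    (use hp_pos[OF p, of q] in \<open>auto intro!: derivative_eq_intros partials[OF p]\<close>)

lemma slice_cont':
  "continuous_on {-1..0} (G q)" "continuous_on {-1..0} (Gp q)" "continuous_on {-1..0} (slope q)"
  "continuous_on {-1..0} (slopeq q)"
  unfolding G_def Gp_def slope_def slopeq_def using hp_pos[of _ q] Hp_pos
  by (auto intro!: continuous_intros slice_cont Hp_cont Hpp_cont simp: less_le)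

text \<open>Inside the strip this is the nondivergence equation divided by
  \<open>(Hp + wp) ^ 3\<close>; continuity carries it to the bed and the surface.\<close>

lemma divergence_form:
  assumes "p \<in> {-1..0}"
  shows "Gp q p + slopeq q p = \<mu> * \<rho>p p * w q p"
proof -
  let ?f = "\<lambda>p. Gp q p + slopeq q p - \<mu> * \<rho>p p * w q p"
  have "closure {-1<..<0::real} = {-1..0}" by simp
  have "?f p = 0"
  proof (rule continuous_constant_on_closure[of "{-1<..<0}" ?f])
    show "continuous_on (closure {-1<..<0}) ?f"
      by (simp only: \<open>closure {-1<..<0::real} = {-1..0}\<close>) (intro continuous_intros slice_cont slice_cont' \<rho>p_cont)
    show "p \<in> closure {-1<..<0}" using assms by simp
    fix t :: real assume t: "t \<in> {-1<..<0}"
    define x y where "x = Hp t + wp q t" and "y = wq q t"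
    have x: "x > 0" using hp_pos[of t q] t by (simp add: x_def)
    have "x\<^sup>2 * wqq q t - x * y * (wqp q t + wpq q t) + (1 + y\<^sup>2) * (Hpp t + wpp q t)
        - x ^ 3 * (Hpp t / Hp t ^ 3 + \<mu> * \<rho>p t * w q t) = 0"
      using sol t by (simp add: hsol_def x_def y_def)
    then have "(x\<^sup>2 * wqq q t - x * y * (wqp q t + wpq q t) + (1 + y\<^sup>2) * (Hpp t + wpp q t)
        - x ^ 3 * (Hpp t / Hp t ^ 3 + \<mu> * \<rho>p t * w q t)) / x ^ 3 = 0" by simp
    moreover have "(x\<^sup>2 * wqq q t - x * y * (wqp q t + wpq q t) + (1 + y\<^sup>2) * (Hpp t + wpp q t)
        - x ^ 3 * (Hpp t / Hp t ^ 3 + \<mu> * \<rho>p t * w q t)) / x ^ 3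
      = wqq q t / x - y * (wqp q t + wpq q t) / x\<^sup>2 + (1 + y\<^sup>2) * (Hpp t + wpp q t) / x ^ 3
        - (Hpp t / Hp t ^ 3 + \<mu> * \<rho>p t * w q t)"
      using x by (simp add: diff_divide_distrib add_divide_distrib power2_eq_square power3_eq_cube)
    ultimately have "wqq q t / x - y * (wqp q t + wpq q t) / x\<^sup>2 + (1 + y\<^sup>2) * (Hpp t + wpp q t) / x ^ 3
        - (Hpp t / Hp t ^ 3 + \<mu> * \<rho>p t * w q t) = 0" by (simp only:)
    then show "?f t = 0"
      unfolding Gp_def slopeq_def x_def[symmetric] y_def[symmetric]
      by (simp only: distrib_left[of y] add_divide_distrib[of "y * wqp q t"] minus_divide_left[symmetric])
  qed
  then show ?thesis by simp
qed

lemma G_top: "G q 0 = \<mu> * \<rho>0 * w q 0"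
proof -
  have "(1 + (wq q 0)\<^sup>2) / (2 * (Hp 0 + wp q 0)\<^sup>2) - 1 / (2 * (Hp 0)\<^sup>2) + \<mu> * \<rho>0 * w q 0 = 0"
    using sol by (simp add: hsol_def)
  then show ?thesis unfolding G_def minus_divide_left[symmetric] by linarith
qed

lemma G_integral:
  assumes p: "p \<in> {-1..0}"
  shows "integral {p..0} (Gp q) = G q 0 - G q p"
proof -
  have "(Gp q has_integral G q 0 - G q p) {p..0}"
  proof (rule fundamental_theorem_of_calculus)
    show "p \<le> 0" using p by simp
    fix t assume "t \<in> {p..0}"
    then have "t \<in> {-1..0}" using p by auto
    from DERIV_subset[OF G_deriv[OF this], of "{p..0}"] p
    show "(G q has_vector_derivative Gp q t) (at t within {p..0})"
      by (simp add: has_real_derivative_iff_has_vector_derivative)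
  qed
  then show ?thesis by (rule integral_unique)
qed

lemma strip_cont:
  "continuous_on strip (\<lambda>z. Hp (snd z))" "continuous_on strip (\<lambda>z. Hpp (snd z))" "continuous_on strip (\<lambda>z. \<rho>p (snd z))"
  by (auto intro!: continuous_on_compose2[OF Hp_cont] continuous_on_compose2[OF Hpp_cont]
      continuous_on_compose2[OF \<rho>p_cont] continuous_intros simp: strip_def)

lemma strip_cont':
  "continuous_on strip (\<lambda>z. slope (fst z) (snd z))" "continuous_on strip (\<lambda>z. slopeq (fst z) (snd z))"
  "continuous_on strip (\<lambda>z. G (fst z) (snd z))" "continuous_on strip (\<lambda>z. Gp (fst z) (snd z))"
proof -
  have "Hp (snd z) + wp (fst z) (snd z) \<noteq> 0" "Hp (snd z) \<noteq> 0" if "z \<in> strip" for z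
    using that hp_pos[of "snd z" "fst z"] Hp_pos[of "snd z"] by (auto simp: strip_def)
  then show "continuous_on strip (\<lambda>z. slope (fst z) (snd z))" "continuous_on strip (\<lambda>z. slopeq (fst z) (snd z))"
    "continuous_on strip (\<lambda>z. G (fst z) (snd z))" "continuous_on strip (\<lambda>z. Gp (fst z) (snd z))"
    unfolding slope_def slopeq_def G_def Gp_def
    by (auto intro!: continuous_intros strip_cont hsol_cont[OF sol])
qed

text \<open>The divergence form integrated from depth \<open>p\<close> to the surface. For a front
  the integral of \<open>slope\<close> tends to 0, so the right side becomes the once integrated
  equation of the limiting laminar flow.\<close>

lemma slope_integral_deriv:
  assumes p: "p \<in> {-1..0}"
  shows "((\<lambda>q. integral {p..0} (slope q)) has_real_derivative
     integral {p..0} (\<lambda>t. \<mu> * \<rho>p t * w q t) - G q 0 + G q p) (at q)"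
proof -
  have sub: "{p..0} \<subseteq> {-1..0}" using p by auto
  have "((\<lambda>q. integral {p..0} (slope q)) has_real_derivative integral {p..0} (slopeq q)) (at q)"
    using p sub slope_deriv
    by (intro leibniz_strip strip_cont' continuous_on_subset[OF slice_cont'(3) sub]) auto
  moreover have "integral {p..0} (slopeq q) = integral {p..0} (\<lambda>t. \<mu> * \<rho>p t * w q t - Gp q t)"
  proof (rule integral_cong)
    fix t assume "t \<in> {p..0}"
    then show "slopeq q t = \<mu> * \<rho>p t * w q t - Gp q t" using divergence_form[of t q] sub by auto
  qed
  moreover have "integral {p..0} (\<lambda>t. \<mu> * \<rho>p t * w q t - Gp q t)
      = integral {p..0} (\<lambda>t. \<mu> * \<rho>p t * w q t) - integral {p..0} (Gp q)"
    by (intro integral_diff integrable_continuous_real continuous_intros continuous_on_subset[OF slice_cont'(2) sub]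
        continuous_on_subset[OF slice_cont(1) sub] continuous_on_subset[OF \<rho>p_cont sub])
  ultimately have "((\<lambda>q. integral {p..0} (slope q)) has_real_derivative integral {p..0} (slopeq q)) (at q)"
    "integral {p..0} (slopeq q) = integral {p..0} (\<lambda>t. \<mu> * \<rho>p t * w q t) - G q 0 + G q p"
    using G_integral[OF p, of q] by linarith+
  then show ?thesis by (simp only:)
qed

text \<open>The divergence form tested with \<open>w\<close> and integrated by parts in
  \<open>p\<close>; the bed contributes nothing because \<open>w\<close> vanishes there.\<close>

lemma work_integral_deriv:
  "((\<lambda>q. integral {-1..0} (\<lambda>p. w q p * slope q p)) has_real_derivative
     integral {-1..0} (\<lambda>p. wq q p * slope q p + \<mu> * \<rho>p p * (w q p)\<^sup>2 + wp q p * G q p) - w q 0 * G q 0) (at q)"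
proof -
  have "((\<lambda>q. integral {-1..0} (\<lambda>p. w q p * slope q p)) has_real_derivative
      integral {-1..0} (\<lambda>p. wq q p * slope q p + w q p * slopeq q p)) (at q)"
  proof (rule leibniz_strip)
    show "((\<lambda>t. w t p * slope t p) has_real_derivative wq q p * slope q p + w q p * slopeq q p) (at q)"
      if "p \<in> {-1..0}" for q p
      by (rule derivative_eq_intros partials(1)[OF that] slope_deriv[OF that] refl)+ (simp add: mult_ac)
  qed (auto intro!: continuous_intros slice_cont slice_cont' strip_cont' hsol_cont[OF sol])
  moreover have "integral {-1..0} (\<lambda>p. wq q p * slope q p + w q p * slopeq q p)
     = integral {-1..0} (\<lambda>p. (wq q p * slope q p + \<mu> * \<rho>p p * (w q p)\<^sup>2 + wp q p * G q p) - (wp q p * G q p + w q p * Gp q p))"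
  proof (rule integral_cong)
    fix p :: real assume "p \<in> {-1..0}"
    then have e: "slopeq q p = \<mu> * \<rho>p p * w q p - Gp q p" using divergence_form[of p q] by auto
    show "wq q p * slope q p + w q p * slopeq q p
      = (wq q p * slope q p + \<mu> * \<rho>p p * (w q p)\<^sup>2 + wp q p * G q p) - (wp q p * G q p + w q p * Gp q p)"
      unfolding e by (simp add: algebra_simps power2_eq_square)
  qed
  moreover have "\<dots> = integral {-1..0} (\<lambda>p. wq q p * slope q p + \<mu> * \<rho>p p * (w q p)\<^sup>2 + wp q p * G q p)
      - integral {-1..0} (\<lambda>p. wp q p * G q p + w q p * Gp q p)"
    by (intro integral_diff integrable_continuous_real continuous_intros slice_cont slice_cont' \<rho>p_cont)
  moreover have "((\<lambda>p. wp q p * G q p + w q p * Gp q p) has_integral w q 0 * G q 0 - w q (-1) * G q (-1)) {-1..0}"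
  proof (rule fundamental_theorem_of_calculus)
    fix t :: real assume t: "t \<in> {-1..0}"
    have "((\<lambda>p. w q p * G q p) has_real_derivative wp q t * G q t + w q t * Gp q t) (at t within {-1..0})"
      by (rule derivative_eq_intros partials(4)[OF t] G_deriv[OF t] refl)+ (simp add: mult_ac)
    then show "((\<lambda>p. w q p * G q p) has_vector_derivative wp q t * G q t + w q t * Gp q t) (at t within {-1..0})"
      by (simp add: has_real_derivative_iff_has_vector_derivative)
  qed simp
  moreover have "w q (-1) = 0" using sol by (simp add: hsol_def)
  ultimately show ?thesis by (simp add: integral_unique)
qed

text \<open>The invariant that belongs to translations in \<open>q\<close>, normalized so that the
  trivial flow has the integral of \<open>1 / (2 * Hp)\<close> as its value.\<close>

definition flow_force :: "real \<Rightarrow> real" where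
  "flow_force q = integral {-1..0} (\<lambda>p. (1 - (wq q p)\<^sup>2) / (2 * (Hp p + wp q p)) + wp q p / (2 * (Hp p)\<^sup>2)
     + \<mu> * \<rho>p p * (w q p)\<^sup>2 / 2) - \<mu> * \<rho>0 * (w q 0)\<^sup>2 / 2"

lemma flow_force_const: "flow_force q = flow_force q'"
proof -
  have w0: "wq q (-1) = 0" for q
  proof -
    have "w x (-1) = 0" for x using sol by (simp add: hsol_def)
    then have "((\<lambda>t. w t (-1)) has_real_derivative 0) (at q)" by simp
    then show ?thesis using partials(1)[of "-1" q] DERIV_unique by fastforce
  qed
  let ?f = "\<lambda>q p. (1 - (wq q p)\<^sup>2) / (2 * (Hp p + wp q p)) + wp q p / (2 * (Hp p)\<^sup>2) + \<mu> * \<rho>p p * (w q p)\<^sup>2 / 2"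
  \<comment> \<open>By the divergence form the \<open>q\<close>-derivative of the integrand is the
    \<open>p\<close>-derivative of \<open>wq * G\<close>. The bed term vanishes with
    \<open>wq\<close>, and the surface term cancels against the last term of
    \<open>flow_force\<close> by \<open>G_top\<close>.\<close>
  let ?fq = "\<lambda>q p. wqp q p * G q p + wq q p * Gp q p"
  have "(flow_force has_real_derivative 0) (at q)" for q
  proof -
    have "((\<lambda>q. integral {-1..0} (?f q)) has_real_derivative integral {-1..0} (?fq q)) (at q)"
    proof (rule leibniz_strip)
      fix q p :: real assume p: "p \<in> {-1..0}"
      have *: "((\<lambda>t. (1 - (y t)\<^sup>2) / (2 * x t)) has_real_derivative - (y q * y') / x q - (1 - (y q)\<^sup>2) * x' / (2 * (x q)\<^sup>2)) (at q)"
        if "(y has_real_derivative y') (at q)" "(x has_real_derivative x') (at q)" "x q \<noteq> 0" for x y x' y' q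
        by (rule derivative_eq_intros that(1,2) refl | simp add: that(3))+
          (use that(3) in \<open>simp add: field_simps power2_eq_square\<close>)
      have x: "Hp p + wp q p \<noteq> 0" using hp_pos[OF p, of q] by simp
      have "((\<lambda>t. Hp p + wp t p) has_real_derivative wpq q p) (at q)"
        by (auto intro!: derivative_eq_intros partials[OF p])
      note d1 = *[OF partials(2)[OF p] this x]
      have d2: "((\<lambda>t. wp t p / (2 * (Hp p)\<^sup>2)) has_real_derivative wpq q p / (2 * (Hp p)\<^sup>2)) (at q)"
        by (rule DERIV_cdivide[OF partials(3)[OF p]])
      have d3: "((\<lambda>t. \<mu> * \<rho>p p * (w t p)\<^sup>2 / 2) has_real_derivative \<mu> * \<rho>p p * w q p * wq q p) (at q)"
        by (rule derivative_eq_intros partials(1)[OF p] refl)+ simp_all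
      have "((\<lambda>t. ?f t p) has_real_derivative (- (wq q p * wqq q p) / (Hp p + wp q p)
          - (1 - (wq q p)\<^sup>2) * wpq q p / (2 * (Hp p + wp q p)\<^sup>2)) + wpq q p / (2 * (Hp p)\<^sup>2) + \<mu> * \<rho>p p * w q p * wq q p) (at q)"
        by (intro DERIV_add d1 d2 d3)
      moreover have "(- (wq q p * wqq q p) / (Hp p + wp q p)
          - (1 - (wq q p)\<^sup>2) * wpq q p / (2 * (Hp p + wp q p)\<^sup>2)) + wpq q p / (2 * (Hp p)\<^sup>2) + \<mu> * \<rho>p p * w q p * wq q p = ?fq q p"
      proof -
        have gp: "Gp q p = \<mu> * \<rho>p p * w q p - slopeq q p" using divergence_form[OF p, of q] by linarith
        have id: "(- (y * b) / x - (1 - y\<^sup>2) * m / (2 * x\<^sup>2)) + m / k + s * y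
            = m * (- (1 + y\<^sup>2) / (2 * x\<^sup>2) + 1 / k) + y * (s - (b / x - y * m / x\<^sup>2))" if "x \<noteq> 0" for y b x m k s :: real
          using that by (simp add: field_simps power2_eq_square)
        show ?thesis unfolding gp mixed_partials[OF p] G_def slopeq_def by (rule id[OF x])
      qed
      ultimately show "((\<lambda>t. ?f t p) has_real_derivative ?fq q p) (at q)" by (simp only:)
    next
      show "continuous_on strip (\<lambda>z. ?fq (fst z) (snd z))"
        by (intro continuous_intros strip_cont' hsol_cont[OF sol])
      show "continuous_on {-1..0} (?f q)" for q
      proof -
        have "2 * (Hp p + wp q p) \<noteq> 0" "2 * (Hp p)\<^sup>2 \<noteq> 0" if "p \<in> {-1..0}" for p
          using hp_pos[OF that, of q] Hp_pos[OF that] by auto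
        then show ?thesis by (intro continuous_intros slice_cont Hp_cont \<rho>p_cont) auto
      qed
    qed auto
    moreover have "(?fq q has_integral wq q 0 * G q 0 - wq q (-1) * G q (-1)) {-1..0}"
    proof (rule fundamental_theorem_of_calculus)
      fix t :: real assume t: "t \<in> {-1..0}"
      have "((\<lambda>p. wq q p * G q p) has_real_derivative ?fq q t) (at t within {-1..0})"
        by (rule derivative_eq_intros partials(5)[OF t] G_deriv[OF t] refl)+ (simp add: mult_ac)
      then show "((\<lambda>p. wq q p * G q p) has_vector_derivative ?fq q t) (at t within {-1..0})"
        by (simp add: has_real_derivative_iff_has_vector_derivative)
    qed simp
    then have "integral {-1..0} (?fq q) = wq q 0 * G q 0" using w0 by (simp add: integral_unique)
    moreover have "((\<lambda>q. \<mu> * \<rho>0 * (w q 0)\<^sup>2 / 2) has_real_derivative wq q 0 * G q 0) (at q)"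
      unfolding G_top by (rule derivative_eq_intros partials(1)[of 0] refl | simp)+
    ultimately have "((\<lambda>q. integral {-1..0} (?f q) - \<mu> * \<rho>0 * (w q 0)\<^sup>2 / 2) has_real_derivative 0) (at q)"
      using DERIV_diff by fastforce
    then show ?thesis unfolding flow_force_def .
  qed
  then show ?thesis using DERIV_isconst_all by blast
qed

end

context elevation_wave
begin

text \<open>Let \<open>X\<close> be the limit of \<open>Hp + wp\<close>. The conservation of the flow force, the limit equation and the
  limit equation tested with the limit of \<open>w\<close> combine to \<open>(X - Hp)\<^sup>3 / (4 X\<^sup>2 Hp\<^sup>2)\<close> having integral zero, while
  the sign of \<open>\<rho>p\<close> forces \<open>X > Hp\<close>.\<close>

lemma no_front:
  assumes mono: "\<And>q q' p. q \<le> q' \<Longrightarrow> -1 \<le> p \<Longrightarrow> p \<le> 0 \<Longrightarrow> w q p \<le> w q' p"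
  shows False
proof -
  note bd = hsol_bounds[OF sol]
  have cauchy: "\<exists>Q. \<forall>q\<ge>Q. \<forall>q'\<ge>Q. \<bar>w q p - w q' p\<bar> < e" if p: "p \<in> {-1..0}" and e: "e > 0" for p e
  proof -
    let ?s = "Sup (range (\<lambda>q. w q p))"
    have bdd: "bdd_above (range (\<lambda>q. w q p))"
      using bd(1)[of p] p by (intro bdd_aboveI[of _ M]) (auto simp: abs_le_iff)
    obtain Q where Q: "?s - e < w Q p"
      using less_cSupD[of "range (\<lambda>q. w q p)" "?s - e"] e by auto
    have near: "?s - e < w q p \<and> w q p \<le> ?s" if "q \<ge> Q" for q
      using mono[OF that, of p] p Q cSup_upper[OF rangeI bdd] by auto
    show ?thesis
    proof (intro exI[of _ Q] allI impI)
      fix q q' assume "Q \<le> q" "Q \<le> q'"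
      with near[of q] near[of q'] show "\<bar>w q p - w q' p\<bar> < e" by linarith
    qed
  qed
  have "\<exists>l. ((\<lambda>q. w q p) \<longlongrightarrow> l) at_top" if "p \<in> {-1..0}" for p
    using tendsto_at_top_Cauchy[of "\<lambda>q. w q p"] cauchy[OF that] by blast
  then obtain W where W: "\<And>p. p \<in> {-1..0} \<Longrightarrow> ((\<lambda>q. w q p) \<longlongrightarrow> W p) at_top" by metis
  have wq0: "((\<lambda>q. wq q p) \<longlongrightarrow> 0) at_top" if p: "p \<in> {-1..0}" for p
    unfolding tendsto_iff eventually_at_top_linorder
  proof (intro allI impI)
    fix e :: real assume e: "e > 0"
    define t where "t = e / (4 * M)"
    have t: "t > 0" "M * t = e / 4" using e M_ge by (auto simp: t_def)
    obtain Q where Q: "\<And>q q'. q \<ge> Q \<Longrightarrow> q' \<ge> Q \<Longrightarrow> \<bar>w q p - w q' p\<bar> < e * t / 2"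
      using cauchy[OF p, of "e * t / 2"] e t by auto
    have "dist (wq q p) 0 < e" if q: "q \<ge> Q" for q
    proof -
      have "\<bar>wq q p\<bar> \<le> \<bar>w (q + t) p - w q p\<bar> / (q + t - q) + M * (q + t - q)"
      proof (rule derivative_interpolation[where g = "\<lambda>x. w x p" and g' = "\<lambda>x. wq x p" and g'' = "\<lambda>x. wqq x p"])
        show "q < q + t" "q \<in> {q..q + t}" using t(1) by simp_all
        show "\<bar>wqq x p\<bar> \<le> M" for x using bd(4)[of p x] p by simp
      qed (rule has_field_derivative_at_within, rule partials[OF p])+
      moreover have "\<bar>w (q + t) p - w q p\<bar> / (q + t - q) < e / 2"
        using Q[of "q + t" q] q t by (simp add: divide_less_eq mult_ac)
      ultimately show ?thesis using t(2) e by (simp add: dist_real_def)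
    qed
    then show "\<exists>N. \<forall>n\<ge>N. dist (wq n p) 0 < e" by blast
  qed
  have "\<exists>l. ((\<lambda>q. wp q p) \<longlongrightarrow> l) at_top" if p: "p \<in> {-1..0}" for p
  proof (rule tendsto_at_top_Cauchy)
    fix e :: real assume e: "e > 0"
    define t where "t = min (1 / 2) (e / (8 * M))"
    have t: "t > 0" "t \<le> 1 / 2" "2 * M * t \<le> e / 4" using e M_ge by (auto simp: t_def min_def field_simps)
    \<comment> \<open>An interval of length \<open>t\<close> that contains \<open>p\<close> and
      stays in the strip, placed above or below \<open>p\<close> as room permits.\<close>
    define a where "a = (if p \<le> - (1 / 2) then p else p - t)"
    have a: "-1 \<le> a" "a + t \<le> 0" "a \<le> p" "p \<le> a + t" using p t by (auto simp: a_def)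
    have et: "e * t / 4 > 0" using e t by simp
    have ab: "a \<in> {-1..0}" "a + t \<in> {-1..0}" using a t by auto
    obtain Q1 where Q1: "\<And>q q'. q \<ge> Q1 \<Longrightarrow> q' \<ge> Q1 \<Longrightarrow> \<bar>w q a - w q' a\<bar> < e * t / 4"
      using cauchy[OF ab(1) et] by blast
    obtain Q2 where Q2: "\<And>q q'. q \<ge> Q2 \<Longrightarrow> q' \<ge> Q2 \<Longrightarrow> \<bar>w q (a + t) - w q' (a + t)\<bar> < e * t / 4"
      using cauchy[OF ab(2) et] by blast
    have "\<bar>wp q p - wp q' p\<bar> < e" if q: "q \<ge> max Q1 Q2" "q' \<ge> max Q1 Q2" for q q'
    proof -
      have sub: "{a..a + t} \<subseteq> {-1..0}" using a by auto
      have "\<bar>wp q p - wp q' p\<bar> \<le> \<bar>(w q (a + t) - w q' (a + t)) - (w q a - w q' a)\<bar> / (a + t - a) + 2 * M * (a + t - a)"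
      proof (rule derivative_interpolation[where g = "\<lambda>x. w q x - w q' x" and g' = "\<lambda>x. wp q x - wp q' x" and g'' = "\<lambda>x. wpp q x - wpp q' x"])
        fix x assume "x \<in> {a..a + t}"
        then have x: "x \<in> {-1..0}" using sub by auto
        show "((\<lambda>x. w q x - w q' x) has_real_derivative wp q x - wp q' x) (at x within {a..a + t})"
          by (rule DERIV_subset[OF DERIV_diff[OF partials(4)[OF x] partials(4)[OF x]] sub])
        show "((\<lambda>x. wp q x - wp q' x) has_real_derivative wpp q x - wpp q' x) (at x within {a..a + t})"
          by (rule DERIV_subset[OF DERIV_diff[OF partials(6)[OF x] partials(6)[OF x]] sub])
        have "\<bar>wpp q x\<bar> \<le> M" "\<bar>wpp q' x\<bar> \<le> M" using bd(7)[of x] x by auto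
        then show "\<bar>wpp q x - wpp q' x\<bar> \<le> 2 * M" by linarith
      qed (use a t in auto)
      moreover have "\<bar>(w q (a + t) - w q' (a + t)) - (w q a - w q' a)\<bar> < (e / 2) * t"
        using Q1[of q q'] Q2[of q q'] q by linarith
      then have "\<bar>(w q (a + t) - w q' (a + t)) - (w q a - w q' a)\<bar> / (a + t - a) < e / 2"
        using t by (simp add: pos_divide_less_eq)
      moreover have "2 * M * (a + t - a) \<le> e / 4" using t(3) by simp
      ultimately show ?thesis using e by linarith
    qed
    then show "\<exists>Q. \<forall>q\<ge>Q. \<forall>q'\<ge>Q. \<bar>wp q p - wp q' p\<bar> < e" by blast
  qed
  then obtain V where V: "\<And>p. p \<in> {-1..0} \<Longrightarrow> ((\<lambda>q. wp q p) \<longlongrightarrow> V p) at_top" by metis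
  define X where "X = (\<lambda>p. Hp p + V p)"
  define Gi where "Gi = (\<lambda>p. - 1 / (2 * (X p)\<^sup>2) + 1 / (2 * (Hp p)\<^sup>2))"
  have Xb: "c \<le> X p" "X p \<le> M" if p: "p \<in> {-1..0}" for p
  proof -
    have l: "((\<lambda>q. Hp p + wp q p) \<longlongrightarrow> X p) at_top" unfolding X_def by (intro tendsto_intros V[OF p])
    show "c \<le> X p" by (rule tendsto_lowerbound[OF l]) (use bd(8)[of p] p in auto)
    show "X p \<le> M" by (rule tendsto_upperbound[OF l]) (use bd(9)[of p] p in auto)
  qed
  have Xpos: "X p > 0" if "p \<in> {-1..0}" for p using Xb[OF that] c_pos by linarith
  have W0: "W p \<ge> 0" if p: "p \<in> {-1..0}" for p
    by (rule tendsto_lowerbound[OF W[OF p]]) (use w_nonneg[of p] p in auto)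
  have Wtop: "W 0 > 0"
  proof -
    have "w 0 0 \<le> W 0"
      by (rule tendsto_lowerbound[OF W]) (auto intro!: eventually_mono[OF eventually_ge_at_top[of 0]] mono)
    then show ?thesis using pos[of 0 0] by simp
  qed
  have sl: "\<bar>slope q p\<bar> \<le> M / c" if p: "p \<in> {-1..0}" for q p
  proof -
    have b: "\<bar>wq q p\<bar> \<le> M" "c \<le> Hp p + wp q p" using bd(2,8)[of p q] p by auto
    then show ?thesis unfolding slope_def abs_divide using c_pos by (intro frac_le) auto
  qed
  define BG where "BG = (1 + M\<^sup>2) / (2 * c\<^sup>2) + 1 / (2 * c\<^sup>2)"
  have BG: "\<bar>G q p\<bar> \<le> BG" if p: "p \<in> {-1..0}" for q p
  proof -
    have b: "\<bar>wq q p\<bar> \<le> M" "c \<le> Hp p + wp q p" "c \<le> Hp p" using bd(2,8)[of p q] p Hp_bounds[OF p] by auto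
    have y2: "(wq q p)\<^sup>2 \<le> M\<^sup>2" using b(1) M_ge by (simp add: abs_le_square_iff[symmetric])
    have "(1 + (wq q p)\<^sup>2) / (2 * (Hp p + wp q p)\<^sup>2) \<le> (1 + M\<^sup>2) / (2 * c\<^sup>2)"
    proof (rule frac_le)
      show "2 * c\<^sup>2 \<le> 2 * (Hp p + wp q p)\<^sup>2" using b c_pos by (intro mult_left_mono power_mono) auto
    qed (use c_pos y2 in auto)
    moreover have "1 / (2 * (Hp p)\<^sup>2) \<le> 1 / (2 * c\<^sup>2)"
      using b c_pos by (intro frac_le mult_left_mono power_mono mult_pos_pos) auto
    moreover have "0 \<le> (1 + (wq q p)\<^sup>2) / (2 * (Hp p + wp q p)\<^sup>2)" "0 \<le> 1 / (2 * (Hp p)\<^sup>2)" by auto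
    ultimately show ?thesis unfolding G_def BG_def minus_divide_left[symmetric] by linarith
  qed
  have S: "(\<lambda>n. w (Y n) p) \<longlonglongrightarrow> W p" "(\<lambda>n. wq (Y n) p) \<longlonglongrightarrow> 0" "(\<lambda>n. wp (Y n) p) \<longlonglongrightarrow> V p"
    "(\<lambda>n. G (Y n) p) \<longlonglongrightarrow> Gi p" "(\<lambda>n. slope (Y n) p) \<longlonglongrightarrow> 0"
    if Y: "filterlim Y at_top sequentially" and p: "p \<in> {-1..0}" for Y :: "nat \<Rightarrow> real" and p
  proof -
    show 1: "(\<lambda>n. w (Y n) p) \<longlonglongrightarrow> W p" "(\<lambda>n. wq (Y n) p) \<longlonglongrightarrow> 0" "(\<lambda>n. wp (Y n) p) \<longlonglongrightarrow> V p"
      using filterlim_compose[OF W[OF p] Y] filterlim_compose[OF wq0[OF p] Y] filterlim_compose[OF V[OF p] Y] by auto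
    have nz: "Hp p + V p \<noteq> 0" using Xpos[OF p] by (simp add: X_def)
    have "(\<lambda>n. G (Y n) p) \<longlonglongrightarrow> - (1 + 0\<^sup>2) / (2 * (Hp p + V p)\<^sup>2) + 1 / (2 * (Hp p)\<^sup>2)"
      unfolding G_def using nz Hp_pos[OF p] by (intro tendsto_intros 1) auto
    then show "(\<lambda>n. G (Y n) p) \<longlonglongrightarrow> Gi p" by (simp add: Gi_def X_def)
    have "(\<lambda>n. slope (Y n) p) \<longlonglongrightarrow> 0 / (Hp p + V p)"
      unfolding slope_def using nz by (intro tendsto_intros 1) auto
    then show "(\<lambda>n. slope (Y n) p) \<longlonglongrightarrow> 0" by simp
  qed
  have \<rho>w: "\<bar>\<mu> * \<rho>p p * w q p\<bar> \<le> M * M" "\<bar>\<mu> * \<rho>p p * (w q p)\<^sup>2\<bar> \<le> M * M\<^sup>2" if p: "p \<in> {-1..0}" for q p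
  proof -
    have b: "\<bar>w q p\<bar> \<le> M" "\<bar>\<mu> * \<rho>p p\<bar> \<le> M" using bd(1)[of p q] p \<rho>p_bound[OF p] by auto
    show "\<bar>\<mu> * \<rho>p p * w q p\<bar> \<le> M * M" unfolding abs_mult[of "\<mu> * \<rho>p p"] using b by (intro mult_mono) auto
    have "(w q p)\<^sup>2 \<le> M\<^sup>2" using b(1) M_ge by (simp add: abs_le_square_iff[symmetric])
    then show "\<bar>\<mu> * \<rho>p p * (w q p)\<^sup>2\<bar> \<le> M * M\<^sup>2" unfolding abs_mult[of "\<mu> * \<rho>p p"] using b by (intro mult_mono) auto
  qed
  \<comment> \<open>In the limit equation \<open>Gi p\<close> is the surface value minus an integral
    that is nonpositive because \<open>\<rho>p \<le> 0\<close> and \<open>W \<ge> 0\<close>. A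
    positive lower bound for \<open>Gi\<close> means that \<open>X\<close> exceeds
    \<open>Hp\<close>.\<close>
  have conj: "Gi p \<ge> \<mu> * \<rho>0 * W 0" if p: "p \<in> {-1..0}" for p
  proof -
    have sub: "t \<in> {-1..0}" if "t \<in> {p..0}" for t using that p by auto
    have sub': "{p..0} \<subseteq> {-1..0}" using p by auto
    have lim: "(\<lambda>t. \<mu> * \<rho>p t * W t) integrable_on {p..0}"
      "(\<lambda>n. integral {p..0} (\<lambda>t. \<mu> * \<rho>p t * w (Y n) t)) \<longlonglongrightarrow> integral {p..0} (\<lambda>t. \<mu> * \<rho>p t * W t)"
      if Y: "filterlim Y at_top sequentially" for Y :: "nat \<Rightarrow> real"
    proof -
      have "continuous_on {p..0} (\<lambda>t. \<mu> * \<rho>p t * w (Y n) t)" for n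
        by (intro continuous_intros continuous_on_subset[OF slice_cont(1) sub'] continuous_on_subset[OF \<rho>p_cont sub'])
      moreover have "\<bar>\<mu> * \<rho>p t * w (Y n) t\<bar> \<le> M * M" if "t \<in> {p..0}" for n t using \<rho>w(1)[OF sub[OF that]] .
      moreover have "(\<lambda>n. \<mu> * \<rho>p t * w (Y n) t) \<longlonglongrightarrow> \<mu> * \<rho>p t * W t" if "t \<in> {p..0}" for t
        by (intro tendsto_intros S(1)[OF Y sub[OF that]])
      ultimately show "(\<lambda>t. \<mu> * \<rho>p t * W t) integrable_on {p..0}"
        "(\<lambda>n. integral {p..0} (\<lambda>t. \<mu> * \<rho>p t * w (Y n) t)) \<longlonglongrightarrow> integral {p..0} (\<lambda>t. \<mu> * \<rho>p t * W t)"
        using dominated_convergence_Icc[of p 0 "\<lambda>n t. \<mu> * \<rho>p t * w (Y n) t" "M * M" "\<lambda>t. \<mu> * \<rho>p t * W t"] by blast+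
    qed
    have "integral {p..0} (\<lambda>t. \<mu> * \<rho>p t * W t) - \<mu> * \<rho>0 * W 0 + Gi p = 0"
    proof (rule derivative_limit_zero[OF slope_integral_deriv[OF p]])
      fix Y :: "nat \<Rightarrow> real" assume Y: "filterlim Y at_top sequentially"
      have "(\<lambda>n. integral {p..0} (slope (Y n))) \<longlonglongrightarrow> integral {p..0} (\<lambda>t. 0)"
        by (rule dominated_convergence_Icc(2)[where B = "M / c"])
          (use sl S(5)[OF Y] sub continuous_on_subset[OF slice_cont'(3) sub'] in auto)
      then show "(\<lambda>n. integral {p..0} (slope (Y n))) \<longlonglongrightarrow> 0" by simp
      have "(\<lambda>n. G (Y n) 0) \<longlonglongrightarrow> \<mu> * \<rho>0 * W 0"
        unfolding G_top by (intro tendsto_intros S(1)[OF Y]) simp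
      then show "(\<lambda>n. integral {p..0} (\<lambda>t. \<mu> * \<rho>p t * w (Y n) t) - G (Y n) 0 + G (Y n) p)
          \<longlonglongrightarrow> integral {p..0} (\<lambda>t. \<mu> * \<rho>p t * W t) - \<mu> * \<rho>0 * W 0 + Gi p"
        by (intro tendsto_intros lim(2)[OF Y] S(4)[OF Y p])
    qed
    moreover have "integral {p..0} (\<lambda>t. \<mu> * \<rho>p t * W t) \<le> integral {p..0} (\<lambda>t. 0)"
    proof (rule integral_le)
      show "(\<lambda>t. \<mu> * \<rho>p t * W t) integrable_on {p..0}" using lim(1)[OF filterlim_real_sequentially] .
      fix t assume "t \<in> {p..0}"
      then have "\<rho>p t \<le> 0" "W t \<ge> 0" using \<rho>p_le W0 sub by auto
      then show "\<mu> * \<rho>p t * W t \<le> 0" using \<mu>_pos by (simp add: mult_nonpos_nonneg mult_nonneg_nonpos)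
    qed (rule integrable_0)
    ultimately show ?thesis by simp
  qed
  \<comment> \<open>The limit equation tested with \<open>W\<close>. It is derived from
    \<open>work_integral_deriv\<close> before passing to the limit, since \<open>W\<close> and
    \<open>V\<close> are so far only pointwise limits, with no relation between them
    established.\<close>
  let ?f2 = "\<lambda>p. \<mu> * \<rho>p p * (W p)\<^sup>2 + V p * Gi p"
  have I2: "?f2 integrable_on {-1..0}" "integral {-1..0} ?f2 = \<mu> * \<rho>0 * (W 0)\<^sup>2"
  proof -
    define B where "B = M * (M / c) + M * M\<^sup>2 + M * BG"
    have dom: "?f2 integrable_on {-1..0}"
      "(\<lambda>n. integral {-1..0} (\<lambda>p. wq (Y n) p * slope (Y n) p + \<mu> * \<rho>p p * (w (Y n) p)\<^sup>2 + wp (Y n) p * G (Y n) p))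
        \<longlonglongrightarrow> integral {-1..0} ?f2"
      if Y: "filterlim Y at_top sequentially" for Y :: "nat \<Rightarrow> real"
    proof -
      have c: "continuous_on {-1..0} (\<lambda>p. wq (Y n) p * slope (Y n) p + \<mu> * \<rho>p p * (w (Y n) p)\<^sup>2 + wp (Y n) p * G (Y n) p)" for n
        by (intro continuous_intros slice_cont slice_cont' \<rho>p_cont)
      have b: "\<bar>wq (Y n) p * slope (Y n) p + \<mu> * \<rho>p p * (w (Y n) p)\<^sup>2 + wp (Y n) p * G (Y n) p\<bar> \<le> B"
        if p: "p \<in> {-1..0}" for n p
      proof -
        have m: "\<bar>wq (Y n) p\<bar> \<le> M" "\<bar>wp (Y n) p\<bar> \<le> M" using bd(2,3)[of p "Y n"] p by auto
        have "\<bar>wq (Y n) p * slope (Y n) p\<bar> \<le> M * (M / c)" unfolding abs_mult using m sl[OF p] by (intro mult_mono) auto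
        moreover have "\<bar>wp (Y n) p * G (Y n) p\<bar> \<le> M * BG" unfolding abs_mult using m BG[OF p] by (intro mult_mono) auto
        ultimately show ?thesis using \<rho>w(2)[OF p, of "Y n"] unfolding B_def by linarith
      qed
      have l: "(\<lambda>n. wq (Y n) p * slope (Y n) p + \<mu> * \<rho>p p * (w (Y n) p)\<^sup>2 + wp (Y n) p * G (Y n) p) \<longlonglongrightarrow> ?f2 p"
        if p: "p \<in> {-1..0}" for p
      proof -
        have "(\<lambda>n. wq (Y n) p * slope (Y n) p + \<mu> * \<rho>p p * (w (Y n) p)\<^sup>2 + wp (Y n) p * G (Y n) p)
            \<longlonglongrightarrow> 0 * 0 + \<mu> * \<rho>p p * (W p)\<^sup>2 + V p * Gi p"
          by (intro tendsto_intros S[OF Y p])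
        then show ?thesis by simp
      qed
      show "?f2 integrable_on {-1..0}"
        "(\<lambda>n. integral {-1..0} (\<lambda>p. wq (Y n) p * slope (Y n) p + \<mu> * \<rho>p p * (w (Y n) p)\<^sup>2 + wp (Y n) p * G (Y n) p))
        \<longlonglongrightarrow> integral {-1..0} ?f2"
        using dominated_convergence_Icc[OF c b l] by blast+
    qed
    show "?f2 integrable_on {-1..0}" using dom(1)[OF filterlim_real_sequentially] .
    have "integral {-1..0} ?f2 - W 0 * (\<mu> * \<rho>0 * W 0) = 0"
    proof (rule derivative_limit_zero[OF work_integral_deriv])
      fix Y :: "nat \<Rightarrow> real" assume Y: "filterlim Y at_top sequentially"
      have "(\<lambda>n. integral {-1..0} (\<lambda>p. w (Y n) p * slope (Y n) p)) \<longlonglongrightarrow> integral {-1..0} (\<lambda>t::real. 0)"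
      proof (rule dominated_convergence_Icc(2)[where B = "M * (M / c)"])
        show "continuous_on {-1..0} (\<lambda>p. w (Y n) p * slope (Y n) p)" for n by (intro continuous_intros slice_cont slice_cont')
        show "\<bar>w (Y n) p * slope (Y n) p\<bar> \<le> M * (M / c)" if p: "p \<in> {-1..0}" for n p
          unfolding abs_mult using bd(1)[of p "Y n"] p sl[OF p] by (intro mult_mono) auto
        show "(\<lambda>n. w (Y n) p * slope (Y n) p) \<longlonglongrightarrow> 0" if p: "p \<in> {-1..0}" for p
          using tendsto_mult[OF S(1)[OF Y p] S(5)[OF Y p]] by simp
      qed
      then show "(\<lambda>n. integral {-1..0} (\<lambda>p. w (Y n) p * slope (Y n) p)) \<longlonglongrightarrow> 0" by simp
      have W': "(\<lambda>n. w (Y n) 0) \<longlonglongrightarrow> W 0" using S(1)[OF Y] by simp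
      show "(\<lambda>n. integral {-1..0} (\<lambda>p. wq (Y n) p * slope (Y n) p + \<mu> * \<rho>p p * (w (Y n) p)\<^sup>2 + wp (Y n) p * G (Y n) p)
          - w (Y n) 0 * G (Y n) 0) \<longlonglongrightarrow> integral {-1..0} ?f2 - W 0 * (\<mu> * \<rho>0 * W 0)"
        unfolding G_top by (intro tendsto_intros dom(2)[OF Y] W')
    qed
    then show "integral {-1..0} ?f2 = \<mu> * \<rho>0 * (W 0)\<^sup>2" by (simp add: power2_eq_square mult_ac)
  qed
  let ?F = "\<lambda>q p. (1 - (wq q p)\<^sup>2) / (2 * (Hp p + wp q p)) + wp q p / (2 * (Hp p)\<^sup>2) + \<mu> * \<rho>p p * (w q p)\<^sup>2 / 2"
  define B where "B = (1 + M\<^sup>2) / (2 * c) + M / (2 * c\<^sup>2) + M * M\<^sup>2"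
  have Fc: "continuous_on {-1..0} (?F q)" for q
  proof -
    have "2 * (Hp p + wp q p) \<noteq> 0" "2 * (Hp p)\<^sup>2 \<noteq> 0" if "p \<in> {-1..0}" for p
      using hp_pos[OF that, of q] Hp_pos[OF that] by auto
    then show ?thesis by (intro continuous_intros slice_cont Hp_cont \<rho>p_cont) auto
  qed
  have Fb: "\<bar>?F q p\<bar> \<le> B" if p: "p \<in> {-1..0}" for q p
  proof -
    have b: "\<bar>wq q p\<bar> \<le> M" "\<bar>wp q p\<bar> \<le> M" "c \<le> Hp p + wp q p" "c \<le> Hp p" using bd(2,3,8)[of p q] p Hp_bounds[OF p] by auto
    have "(wq q p)\<^sup>2 \<le> M\<^sup>2" using b(1) M_ge by (simp add: abs_le_square_iff[symmetric])
    then have "\<bar>1 - (wq q p)\<^sup>2\<bar> \<le> 1 + M\<^sup>2" using zero_le_power2[of "wq q p"] by (simp add: abs_le_iff add_increasing2)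
    then have "\<bar>(1 - (wq q p)\<^sup>2) / (2 * (Hp p + wp q p))\<bar> \<le> (1 + M\<^sup>2) / (2 * c)"
      unfolding abs_divide using b c_pos by (intro frac_le) auto
    moreover have "\<bar>wp q p / (2 * (Hp p)\<^sup>2)\<bar> \<le> M / (2 * c\<^sup>2)"
      unfolding abs_divide using b c_pos by (intro frac_le) (auto intro!: power_mono)
    ultimately show ?thesis using \<rho>w(2)[OF p, of q] unfolding B_def by linarith
  qed
  let ?f0 = "\<lambda>p. 1 / (2 * Hp p)"
  let ?f1 = "\<lambda>p. 1 / (2 * X p) + V p / (2 * (Hp p)\<^sup>2) + \<mu> * \<rho>p p * (W p)\<^sup>2 / 2"
  have F1: "?f1 integrable_on {-1..0}" "(\<lambda>n. integral {-1..0} (?F (real n))) \<longlonglongrightarrow> integral {-1..0} ?f1"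
  proof -
    have "(\<lambda>n. ?F (real n) p) \<longlonglongrightarrow> ?f1 p" if p: "p \<in> {-1..0}" for p
    proof -
      have nz: "2 * (Hp p + V p) \<noteq> 0" "2 * (Hp p)\<^sup>2 \<noteq> 0" using Xpos[OF p] Hp_pos[OF p] by (auto simp: X_def)
      have "(\<lambda>n. ?F (real n) p) \<longlonglongrightarrow> (1 - 0\<^sup>2) / (2 * (Hp p + V p)) + V p / (2 * (Hp p)\<^sup>2) + \<mu> * \<rho>p p * (W p)\<^sup>2 / 2"
        using nz by (intro tendsto_intros S[OF filterlim_real_sequentially p]) auto
      then show ?thesis by (simp add: X_def)
    qed
    then show "?f1 integrable_on {-1..0}" "(\<lambda>n. integral {-1..0} (?F (real n))) \<longlonglongrightarrow> integral {-1..0} ?f1"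
      using dominated_convergence_Icc[OF Fc Fb, of "\<lambda>n. real n" ?f1] by blast+
  qed
  have dec: "(\<lambda>n. w (- real n) p) \<longlonglongrightarrow> 0" "(\<lambda>n. wq (- real n) p) \<longlonglongrightarrow> 0" "(\<lambda>n. wp (- real n) p) \<longlonglongrightarrow> 0"
    if p: "p \<in> {-1..0}" for p
  proof -
    have "\<exists>N. \<forall>n\<ge>N. \<bar>w (- real n) p\<bar> < e \<and> \<bar>wq (- real n) p\<bar> < e \<and> \<bar>wp (- real n) p\<bar> < e" if "e > 0" for e
    proof -
      obtain Q where Q: "\<forall>q\<le>Q. \<forall>p\<in>{-1..0}. \<bar>w q p\<bar> < e \<and> \<bar>wq q p\<bar> < e \<and> \<bar>wp q p\<bar> < e \<and>
        \<bar>wqq q p\<bar> < e \<and> \<bar>wqp q p\<bar> < e \<and> \<bar>wpq q p\<bar> < e \<and> \<bar>wpp q p\<bar> < e"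
        using decay[OF \<open>e > 0\<close>] by blast
      obtain N :: nat where N: "- Q \<le> real N" using real_arch_simple by blast
      have "- real n \<le> Q" if "n \<ge> N" for n
      proof -
        have "real N \<le> real n" using that by simp
        then show ?thesis using N by linarith
      qed
      then show ?thesis using Q p by blast
    qed
    then show "(\<lambda>n. w (- real n) p) \<longlonglongrightarrow> 0" "(\<lambda>n. wq (- real n) p) \<longlonglongrightarrow> 0" "(\<lambda>n. wp (- real n) p) \<longlonglongrightarrow> 0"
      unfolding LIMSEQ_def dist_real_def diff_zero by blast+
  qed
  have F0: "?f0 integrable_on {-1..0}" "(\<lambda>n. integral {-1..0} (?F (- real n))) \<longlonglongrightarrow> integral {-1..0} ?f0"
  proof -
    have "(\<lambda>n. ?F (- real n) p) \<longlonglongrightarrow> ?f0 p" if p: "p \<in> {-1..0}" for p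
    proof -
      have nz: "2 * (Hp p + 0) \<noteq> 0" "2 * (Hp p)\<^sup>2 \<noteq> 0" using Hp_pos[OF p] by auto
      have "(\<lambda>n. ?F (- real n) p) \<longlonglongrightarrow> (1 - 0\<^sup>2) / (2 * (Hp p + 0)) + 0 / (2 * (Hp p)\<^sup>2) + \<mu> * \<rho>p p * 0\<^sup>2 / 2"
        using nz by (intro tendsto_intros dec[OF p]) auto
      then show ?thesis by simp
    qed
    then show "?f0 integrable_on {-1..0}" "(\<lambda>n. integral {-1..0} (?F (- real n))) \<longlonglongrightarrow> integral {-1..0} ?f0"
      using dominated_convergence_Icc[OF Fc Fb, of "\<lambda>n. - real n" ?f0] by blast+
  qed
  have "(\<lambda>n. flow_force (real n)) \<longlonglongrightarrow> integral {-1..0} ?f1 - \<mu> * \<rho>0 * (W 0)\<^sup>2 / 2"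
    unfolding flow_force_def by (intro tendsto_intros F1(2) S(1)[OF filterlim_real_sequentially]) simp_all
  moreover have "(\<lambda>n. flow_force (- real n)) \<longlonglongrightarrow> integral {-1..0} ?f0 - \<mu> * \<rho>0 * 0\<^sup>2 / 2"
    unfolding flow_force_def by (intro tendsto_intros F0(2) dec) simp_all
  moreover have "(\<lambda>n. flow_force (real n)) = (\<lambda>n. flow_force (- real n))" using flow_force_const by blast
  ultimately have S_eq: "integral {-1..0} ?f1 - \<mu> * \<rho>0 * (W 0)\<^sup>2 / 2 = integral {-1..0} ?f0"
    using LIMSEQ_unique by fastforce
  \<comment> \<open>Subtracting half of \<open>?f2\<close> cancels the terms with
    \<open>\<rho>p\<close>, and by \<open>S_eq\<close> and \<open>I2\<close> the total integral is
    0.\<close>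
  have I: "((\<lambda>p. ?f1 p - ?f0 p - ?f2 p / 2) has_integral
      integral {-1..0} ?f1 - integral {-1..0} ?f0 - integral {-1..0} ?f2 / 2) {-1..0}"
    by (intro has_integral_diff has_integral_divide integrable_integral F1(1) F0(1) I2(1))
  define g0 where "g0 = \<mu> * \<rho>0 * W 0"
  have g0: "g0 > 0" using \<mu>_pos \<rho>0_pos Wtop by (simp add: g0_def)
  \<comment> \<open>A lower bound for the integrand: \<open>Gi \<ge> g0\<close> gives
    \<open>X - Hp \<ge> g0 * c ^ 4 / M\<close>, and the denominator is at most
    \<open>4 * M ^ 4\<close>. Being uniform in \<open>p\<close>, it makes the integral positive
    without continuity of \<open>X\<close>.\<close>
  define k where "k = (g0 * c ^ 4 / M) ^ 3 / (4 * M ^ 4)"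
  have k: "k > 0" using g0 c_pos M_ge by (simp add: k_def)
  have lower: "k \<le> ?f1 p - ?f0 p - ?f2 p / 2" if p: "p \<in> {-1..0}" for p
  proof -
    define x y where "x = X p" and "y = Hp p"
    have b: "c \<le> x" "x \<le> M" "c \<le> y" "y \<le> M" using Xb[OF p] Hp_bounds[OF p] by (auto simp: x_def y_def)
    have xy: "x > 0" "y > 0" using b c_pos by auto
    have v: "V p = x - y" by (simp add: x_def y_def X_def)
    have gi: "Gi p = (x - y) * ((x + y) / (2 * x\<^sup>2 * y\<^sup>2))"
      using xy by (simp add: Gi_def x_def[symmetric] y_def[symmetric] field_simps power2_eq_square)
    have "?f1 p - ?f0 p - ?f2 p / 2 = 1 / (2 * x) + (x - y) / (2 * y\<^sup>2) - 1 / (2 * y) - (x - y) * (- 1 / (2 * x\<^sup>2) + 1 / (2 * y\<^sup>2)) / 2"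
      unfolding v Gi_def x_def[symmetric] y_def[symmetric] by (simp add: field_simps)
    also have "\<dots> = (x - y) ^ 3 / (4 * x\<^sup>2 * y\<^sup>2)"
      using xy by (simp add: field_simps power2_eq_square power3_eq_cube)
    finally have eq: "?f1 p - ?f0 p - ?f2 p / 2 = (x - y) ^ 3 / (4 * x\<^sup>2 * y\<^sup>2)" .
    have c4: "c ^ 4 \<le> x\<^sup>2 * y\<^sup>2"
    proof -
      have "c\<^sup>2 * c\<^sup>2 \<le> x\<^sup>2 * y\<^sup>2" using b c_pos by (intro mult_mono power_mono) auto
      then show ?thesis by (simp add: power2_eq_square power4_eq_xxxx mult.assoc)
    qed
    have M4: "x\<^sup>2 * y\<^sup>2 \<le> M ^ 4"
    proof -
      have "x\<^sup>2 * y\<^sup>2 \<le> M\<^sup>2 * M\<^sup>2" using b xy by (intro mult_mono power_mono) auto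
      then show ?thesis by (simp add: power2_eq_square power4_eq_xxxx mult.assoc)
    qed
    have gle: "g0 \<le> (x - y) * ((x + y) / (2 * x\<^sup>2 * y\<^sup>2))" using conj[OF p] gi by (simp add: g0_def)
    have fpos: "(x + y) / (2 * x\<^sup>2 * y\<^sup>2) > 0" using xy by simp
    have xgy: "x - y > 0"
    proof (rule ccontr)
      assume "\<not> x - y > 0"
      then have "(x - y) * ((x + y) / (2 * x\<^sup>2 * y\<^sup>2)) \<le> 0" using fpos by (intro mult_nonpos_nonneg) auto
      then show False using gle g0 by linarith
    qed
    have "(x + y) / (2 * x\<^sup>2 * y\<^sup>2) \<le> (2 * M) / (2 * c ^ 4)"
      using b c4 c_pos xy by (intro frac_le) (auto simp: mult.assoc)
    then have "(x - y) * ((x + y) / (2 * x\<^sup>2 * y\<^sup>2)) \<le> (x - y) * (M / c ^ 4)" using xgy by (intro mult_left_mono) auto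
    then have "g0 \<le> (x - y) * (M / c ^ 4)" using gle by linarith
    then have "g0 * c ^ 4 / M \<le> x - y" using c_pos M_ge by (simp add: field_simps)
    then have "(g0 * c ^ 4 / M) ^ 3 \<le> (x - y) ^ 3" using g0 c_pos M_ge by (intro power_mono) auto
    then have "k \<le> (x - y) ^ 3 / (4 * (x\<^sup>2 * y\<^sup>2))"
      unfolding k_def using M4 xy xgy M_ge by (intro frac_le) auto
    then show ?thesis unfolding eq by (simp add: mult.assoc)
  qed
  have "((\<lambda>p::real. k) has_integral k) {-1..0}" using has_integral_const_real[of k "-1" 0] by simp
  from has_integral_le[OF this I lower] have "k \<le> integral {-1..0} ?f1 - integral {-1..0} ?f0 - integral {-1..0} ?f2 / 2"
    by blast
  also have "\<dots> = 0" using S_eq I2(2) by simp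
  finally show False using k by simp
qed

end

section \<open>Symmetry\<close>

context elevation_wave
begin

lemma symmetric:
  "\<exists>l. (\<forall>q p. -1 \<le> p \<and> p \<le> 0 \<longrightarrow> w (2 * l - q) p = w q p) \<and>
       (\<forall>q p. -1 < p \<and> p \<le> 0 \<longrightarrow> (q < l \<longrightarrow> wq q p > 0) \<and> (q > l \<longrightarrow> wq q p < 0))"
proof -
  have "\<not> (\<forall>q q' p. q \<le> q' \<longrightarrow> -1 \<le> p \<longrightarrow> p \<le> 0 \<longrightarrow> w q p \<le> w q' p)"
    using no_front by blast
  then obtain l where sym: "\<And>q p. -1 \<le> p \<Longrightarrow> p \<le> 0 \<Longrightarrow> w (2 * l - q) p = w q p"
    and inc: "\<And>q p. q < l \<Longrightarrow> -1 < p \<Longrightarrow> p \<le> 0 \<Longrightarrow> wq q p > 0"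
    using moving_planes by blast
  have "wq q p < 0" if q: "q > l" and p: "-1 < p" "p \<le> 0" for q p
  proof -
    have p': "-1 \<le> p" using p by simp
    have "((\<lambda>t. w (2 * l - t) p) has_real_derivative wq (2 * l - q) p * (- 1)) (at q)"
      using w_deriv[OF p' p(2), of "2 * l - q"] by (intro DERIV_chain2[of "\<lambda>t. w t p"]) (auto intro!: derivative_eq_intros)
    moreover have "(\<lambda>t. w (2 * l - t) p) = (\<lambda>t. w t p)" using sym[OF p' p(2)] by blast
    ultimately have "wq q p = - wq (2 * l - q) p"
      using DERIV_unique w_deriv[OF p' p(2), of q] by fastforce
    then show ?thesis using inc[of "2 * l - q" p] q p by simp
  qed
  then show ?thesis using sym inc by blast
qed

end

section \<open>Reduction of the theorem to the normalized problem\<close>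

lemma (in height_problem) symmetric_of_decay_left:
  assumes sol: "hsol w wq wp wqq wqp wpq wpp"
    and pos: "\<And>q p. -1 < p \<Longrightarrow> p \<le> 0 \<Longrightarrow> w q p > 0"
    and decay: "decays_left [w, wq, wp, wqq, wqp, wpq, wpp]"
    and "b > 0" and super: "\<And>N. \<exists>\<delta> \<Phi> \<Phi>' \<Phi>''. supersol N b U \<delta> \<Phi> \<Phi>' \<Phi>''"
  shows "\<exists>l. (\<forall>q p. -1 \<le> p \<and> p \<le> 0 \<longrightarrow> w (2 * l - q) p = w q p) \<and>
       (\<forall>q p. -1 < p \<and> p \<le> 0 \<longrightarrow> (q < l \<longrightarrow> wq q p > 0) \<and> (q > l \<longrightarrow> wq q p < 0))"
proof -
  interpret elevation_wave Hp Hpp \<rho>p \<rho>0 \<mu> M c w wq wp wqq wqp wpq wpp b U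
  proof
    fix e :: real assume "e > 0"
    then obtain Q where "\<forall>q p. q \<le> Q \<and> -1 \<le> p \<and> p \<le> 0 \<longrightarrow>
        (\<forall>g\<in>set [w, wq, wp, wqq, wqp, wpq, wpp]. \<bar>g q p\<bar> < e)"
      using decay unfolding decays_left_def by blast
    then show "\<exists>Q. \<forall>q\<le>Q. \<forall>p\<in>{-1..0}. \<bar>w q p\<bar> < e \<and> \<bar>wq q p\<bar> < e \<and> \<bar>wp q p\<bar> < e \<and>
        \<bar>wqq q p\<bar> < e \<and> \<bar>wqp q p\<bar> < e \<and> \<bar>wpq q p\<bar> < e \<and> \<bar>wpp q p\<bar> < e"
      by (intro exI[of _ Q]) simp
  qed (use assms in auto)
  show ?thesis by (rule symmetric)
qed

text \<open>The derivatives in \<open>C_k_alpha\<close> are existential witnesses; uniqueness of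
  derivatives on the interval identifies the first of them with the given \<open>f'\<close>. The
  index is shifted so that \<open>k = 0\<close> serves \<rho> and \<open>k = 1\<close> serves
  \<open>H\<close>.\<close>

lemma C_k_alpha_derivative:
  assumes "C_k_alpha (Suc (Suc k)) \<alpha> f"
    and f': "\<And>x. x \<in> {-1..0} \<Longrightarrow> (f has_real_derivative f' x) (at x within {-1..0})"
  obtains f'' where "\<And>x. x \<in> {-1..0} \<Longrightarrow> (f' has_real_derivative f'' x) (at x within {-1..0})"
    "continuous_on {-1..0} f'" "k > 0 \<Longrightarrow> continuous_on {-1..0} f''"
proof -
  obtain D :: "nat \<Rightarrow> real \<Rightarrow> real" where D0: "\<And>x. x \<in> {-1..0} \<Longrightarrow> D 0 x = f x"
    and D: "\<And>j x. j < Suc (Suc k) \<Longrightarrow> x \<in> {-1..0} \<Longrightarrow> (D j has_real_derivative D (Suc j) x) (at x within {-1..0})"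
    using assms(1) unfolding C_k_alpha_def by blast
  have D1: "D 1 x = f' x" if x: "x \<in> {-1..0}" for x
  proof -
    have "(f has_real_derivative D 1 x) (at x within {-1..0})"
      by (rule has_real_derivative_transform[of "D 0"]) (use D[of 0 x] x D0 in simp_all)
    then show ?thesis using has_real_derivative_unique_Icc[OF _ f'[OF x] x] by simp
  qed
  have 2: "(f' has_real_derivative D 2 x) (at x within {-1..0})" if "x \<in> {-1..0}" for x
    by (rule has_real_derivative_transform[of "D 1"]) (use D[of 1 x] D1 that in \<open>simp_all add: numeral_2_eq_2\<close>)
  show thesis
  proof (rule that[of "D 2"])
    show "continuous_on {-1..0} f'" using 2 by (rule DERIV_continuous_on)
    show "continuous_on {-1..0} (D 2)" if "k > 0"
      by (rule DERIV_continuous_on[where D = "D 3"]) (use D[of 2] that in \<open>simp add: numeral_2_eq_2 numeral_3_eq_3\<close>)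
  qed (rule 2)
qed

text \<open>\<open>height_eq\<close> only asserts that the two fluxes have some derivatives
  \<open>A\<close> and \<open>B\<close>; the jets of \<open>w\<close> compute them, uniqueness
  identifies them, and multiplication by \<open>(Hp + wp q p) ^ 3\<close> clears the
  denominators.\<close>

lemma height_eq_nondivergence:
  assumes h: "height_eq H Hp \<rho> \<rho>p w wq wp F" and C2: "C2_strip w wq wp wqq wqp wpq wpp"
    and Hp': "\<And>x. x \<in> {-1..0} \<Longrightarrow> (Hp has_real_derivative Hpp x) (at x within {-1..0})"
    and Hp_pos: "\<And>x. x \<in> {-1..0} \<Longrightarrow> Hp x > 0"
    and p: "-1 < p" "p < 0"
  shows "(Hp p + wp q p)\<^sup>2 * wqq q p - (Hp p + wp q p) * wq q p * (wqp q p + wpq q p)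
        + (1 + (wq q p)\<^sup>2) * (Hpp p + wpp q p)
        - (Hp p + wp q p) ^ 3 * (Hpp p / Hp p ^ 3 + (1 / F\<^sup>2) * \<rho>p p * w q p) = 0"
proof -
  have at: "at p within {-1..0} = at p" using p by (simp add: at_within_Icc_at)
  have p': "-1 \<le> p" "p \<le> 0" "p \<in> {-1..0}" using p by auto
  note d = jet2_partials[OF C2_strip_jet2[OF C2] p'(1,2)]
  obtain c where "c > 0" "c \<le> Hp p + wp q p" using h p unfolding height_eq_def by blast
  then have x: "Hp p + wp q p > 0" by linarith
  have k: "Hp p > 0" using Hp_pos[OF p'(3)] .
  obtain A B where A: "((\<lambda>p'. - (1 + (wq q p')\<^sup>2) / (2 * (Hp p' + wp q p')\<^sup>2) + 1 / (2 * (Hp p')\<^sup>2)) has_real_derivative A) (at p)"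
    and B: "((\<lambda>q'. wq q' p / (Hp p + wp q' p)) has_real_derivative B) (at q)"
    and AB: "A + B - (1 / F\<^sup>2) * \<rho>p p * ((H p + w q p) - H p) = 0"
    using h p unfolding height_eq_def by blast
  have "((\<lambda>p'. Hp p' + wp q p') has_real_derivative Hpp p + wpp q p) (at p within {-1..0})"
    by (rule DERIV_add[OF Hp'[OF p'(3)] d(6)])
  from has_real_derivative_flux[OF d(5) this Hp'[OF p'(3)]] x k
  have A': "A = - (wq q p * wqp q p) / (Hp p + wp q p)\<^sup>2
      + (1 + (wq q p)\<^sup>2) * (Hpp p + wpp q p) / (Hp p + wp q p) ^ 3 - Hpp p / Hp p ^ 3"
    using DERIV_unique[OF A] unfolding at by auto
  have "((\<lambda>q'. Hp p + wp q' p) has_real_derivative wpq q p) (at q)"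
    using d(3) by (auto intro!: derivative_eq_intros)
  from has_real_derivative_quotient[OF d(2) this] x
  have B': "B = wqq q p / (Hp p + wp q p) - wq q p * wpq q p / (Hp p + wp q p)\<^sup>2"
    using DERIV_unique[OF B] by auto
  have id: "x\<^sup>2 * a - x * y * (m + m') + (1 + y\<^sup>2) * r - x ^ 3 * (g + s)
      = x ^ 3 * ((- (y * m) / x\<^sup>2 + (1 + y\<^sup>2) * r / x ^ 3 - g) + (a / x - y * m' / x\<^sup>2) - s)"
    if "x > 0" for x y a m m' r g s :: real
    using that by (simp add: field_simps power2_eq_square power3_eq_cube)
  show ?thesis
    unfolding id[OF x] using AB unfolding A' B' by simp
qed

theorem theorem4p13:
  fixes \<alpha> :: real
    and \<rho> \<rho>p H Hp :: "real \<Rightarrow> real"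
    and w wq wp wqq wqp wpq wpp :: "real \<Rightarrow> real \<Rightarrow> real"
    and F \<mu>cr :: real
  assumes alpha: "0 < \<alpha>" "\<alpha> < 1"
    and rho_reg: "C_k_alpha 2 \<alpha> \<rho>"
    and rho_der: "\<forall>x\<in>{-1..0}. (\<rho> has_real_derivative \<rho>p x) (at x within {-1..0})"
    and rho_pos: "\<forall>x\<in>{-1..0}. \<rho> x > 0"
    and rho_dec: "\<forall>x\<in>{-1..0}. \<rho>p x \<le> 0"
    and H_reg: "C_k_alpha 3 \<alpha> H"
    and H_der: "\<forall>x\<in>{-1..0}. (H has_real_derivative Hp x) (at x within {-1..0})"
    and H_bc: "H (-1) = 0" "H 0 = 1"
    and H_inc: "\<forall>x\<in>{-1..0}. Hp x > 0"
    and mu_cr: "\<mu>cr > 0" "has_eigensolution Hp \<rho> \<rho>p \<mu>cr"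
               "\<forall>\<mu>>0. has_eigensolution Hp \<rho> \<rho>p \<mu> \<longrightarrow> \<mu>cr \<le> \<mu>"
    and w_C2: "C2_strip w wq wp wqq wqp wpq wpp"
    and w_bdd: "C2_bounded [w, wq, wp, wqq, wqp, wpq, wpp]"
    and sol: "height_eq H Hp \<rho> \<rho>p w wq wp F"
    and w_pos: "\<forall>q p. -1 < p \<and> p \<le> 0 \<longrightarrow> w q p > 0"
    and F_super: "F > 1 / sqrt \<mu>cr"
    and decay: "decays_left [w, wq, wp, wqq, wqp, wpq, wpp] \<or>
                decays_right [w, wq, wp, wqq, wqp, wpq, wpp]"
  shows "\<exists>qs. (\<forall>q p. -1 \<le> p \<and> p \<le> 0 \<longrightarrow> w (2 * qs - q) p = w q p) \<and>
              (\<forall>q p. -1 < p \<and> p \<le> 0 \<longrightarrow>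
                 (q < qs \<longrightarrow> wq q p > 0) \<and> (q > qs \<longrightarrow> wq q p < 0))"
proof -
  obtain Hpp where Hp': "\<And>x. x \<in> {-1..0} \<Longrightarrow> (Hp has_real_derivative Hpp x) (at x within {-1..0})"
    and cHp: "continuous_on {-1..0} Hp" and cHpp: "continuous_on {-1..0} Hpp"
    using C_k_alpha_derivative[of 1 \<alpha> H Hp] H_reg H_der by (auto simp: numeral_3_eq_3)
  have c\<rho>: "continuous_on {-1..0} \<rho>p"
    using C_k_alpha_derivative[of 0 \<alpha> \<rho> \<rho>p] rho_reg rho_der by (auto simp: numeral_2_eq_2)
  define \<mu> where "\<mu> = 1 / F\<^sup>2"
  have F: "F > 0" using sol by (simp add: height_eq_def)
  then have \<mu>: "\<mu> > 0" by (simp add: \<mu>_def)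
  \<comment> \<open>Supercriticality in terms of \<mu>: as \<open>\<mu>cr\<close> is the smallest
    positive eigenvalue, none lies in the interval from 0 to \<mu>.\<close>
  have "\<mu> < \<mu>cr"
  proof -
    have "(1 / sqrt \<mu>cr)\<^sup>2 < F\<^sup>2" using F_super mu_cr(1) by (intro power_strict_mono) auto
    then have "1 / \<mu>cr < F\<^sup>2" using mu_cr(1) by (simp add: power_divide)
    then show ?thesis using mu_cr(1) F by (simp add: \<mu>_def field_simps)
  qed
  then have noeig: "\<not> has_eigensolution Hp \<rho> \<rho>p m" if "0 < m" "m \<le> \<mu>" for m
    using mu_cr(3) that by (meson less_le_not_le order_trans)
  obtain B1 where B1: "B1 > 0" "\<And>t. t \<in> {-1..0} \<Longrightarrow> \<bar>Hp t\<bar> \<le> B1" using continuous_on_interval_bound[OF cHp] by blast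
  obtain B2 where B2: "B2 > 0" "\<And>t. t \<in> {-1..0} \<Longrightarrow> \<bar>Hpp t\<bar> \<le> B2" using continuous_on_interval_bound[OF cHpp] by blast
  have "continuous_on {-1..0} (\<lambda>t. Hpp t / Hp t ^ 3)"
    using H_inc by (intro continuous_intros cHp cHpp) (auto simp: less_le)
  then obtain B3 where B3: "B3 > 0" "\<And>t. t \<in> {-1..0} \<Longrightarrow> \<bar>Hpp t / Hp t ^ 3\<bar> \<le> B3" using continuous_on_interval_bound by blast
  have "continuous_on {-1..0} (\<lambda>t. \<mu> * \<rho>p t)" by (intro continuous_intros c\<rho>)
  then obtain B4 where B4: "B4 > 0" "\<And>t. t \<in> {-1..0} \<Longrightarrow> \<bar>\<mu> * \<rho>p t\<bar> \<le> B4" using continuous_on_interval_bound by blast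
  have "\<exists>K\<ge>0. \<forall>g\<in>set gs. \<forall>q p. -1 \<le> p \<longrightarrow> p \<le> 0 \<longrightarrow> \<bar>g q p\<bar> \<le> K" if "C2_bounded gs" for gs
    using that
  proof (induction gs)
    case Nil
    show ?case by (rule exI[of _ 0]) simp
  next
    case (Cons g gs)
    then obtain K where K: "K \<ge> 0" "\<forall>g\<in>set gs. \<forall>q p. -1 \<le> p \<longrightarrow> p \<le> 0 \<longrightarrow> \<bar>g q p\<bar> \<le> K"
      by (auto simp: C2_bounded_def)
    obtain L where "\<forall>z\<in>strip. \<bar>g (fst z) (snd z)\<bar> \<le> L" using Cons.prems by (auto simp: C2_bounded_def)
    then have L: "\<bar>g q p\<bar> \<le> L" if "-1 \<le> p" "p \<le> 0" for q p
      using that by (auto simp: strip_def)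
    show ?case
    proof (intro exI[of _ "max K L"] conjI ballI allI impI)
      fix f q p assume "f \<in> set (g # gs)" "-1 \<le> p" "p \<le> (0::real)"
      then show "\<bar>f q p\<bar> \<le> max K L" using K(2) L[of p q] by (auto simp: le_max_iff_disj)
    qed (use K in auto)
  qed
  from this[OF w_bdd] obtain K where K: "K \<ge> 0"
    "\<And>g q p. g \<in> set [w, wq, wp, wqq, wqp, wpq, wpp] \<Longrightarrow> -1 \<le> p \<Longrightarrow> p \<le> 0 \<Longrightarrow> \<bar>g q p\<bar> \<le> K"
    by blast
  define M where "M = 1 + K + B1 + B2 + B3 + B4"
  have M: "1 \<le> M" "K \<le> M" "K + B1 \<le> M" "B2 \<le> M" "B3 \<le> M" "B4 \<le> M"
    using K(1) B1(1) B2(1) B3(1) B4(1) by (auto simp: M_def)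
  obtain c where c: "c > 0" "\<And>q p. -1 < p \<Longrightarrow> p < 0 \<Longrightarrow> c \<le> Hp p + wp q p"
    using sol unfolding height_eq_def by blast
  \<comment> \<open>The bound is given in the open strip; continuity of \<open>wp\<close> extends it
    to the bed and to the surface, where \<open>touch_top\<close> relies on it.\<close>
  have c': "c \<le> Hp p + wp q p" if "p \<in> {-1..0}" for q p
  proof (rule continuous_ge_on_closure[of "{-1<..<0}" "\<lambda>p. Hp p + wp q p"])
    have "continuous_on {-1..0} (\<lambda>p. (\<lambda>z. wp (fst z) (snd z)) (q, p))"
      by (rule continuous_on_compose2[of strip])
        (use w_C2 in \<open>auto simp: C2_strip_def strip_def intro!: continuous_intros\<close>)
    then show "continuous_on (closure {-1<..<0}) (\<lambda>p. Hp p + wp q p)"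
      using cHp by (simp add: continuous_on_add)
  qed (use that c in auto)
  interpret height_problem Hp Hpp \<rho>p "\<rho> 0" \<mu> M c
  proof
    fix x :: real assume x: "x \<in> {-1..0}"
    show "\<bar>Hpp x\<bar> \<le> M" "\<bar>Hpp x / Hp x ^ 3\<bar> \<le> M" "\<bar>\<mu> * \<rho>p x\<bar> \<le> M"
      using order_trans[OF B2(2)[OF x] M(4)] order_trans[OF B3(2)[OF x] M(5)] order_trans[OF B4(2)[OF x] M(6)] by auto
  qed (use Hp' cHpp c\<rho> H_inc rho_dec rho_pos \<mu> c(1) M(1) in auto)
  have hs: "hsol w wq wp wqq wqp wpq wpp"
    unfolding hsol_def
  proof (intro conjI allI impI)
    show "C2_strip w wq wp wqq wqp wpq wpp" by fact
  next
    fix q p :: real assume p: "-1 \<le> p \<and> p \<le> 0"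
    show "\<bar>w q p\<bar> \<le> M" "\<bar>wq q p\<bar> \<le> M" "\<bar>wp q p\<bar> \<le> M" "\<bar>wqq q p\<bar> \<le> M" "\<bar>wqp q p\<bar> \<le> M" "\<bar>wpq q p\<bar> \<le> M" "\<bar>wpp q p\<bar> \<le> M"
      using K(2)[of w p q] K(2)[of wq p q] K(2)[of wp p q] K(2)[of wqq p q] K(2)[of wqp p q] K(2)[of wpq p q]
        K(2)[of wpp p q] p M(2) by simp_all
    show "c \<le> Hp p + wp q p" using c' p by simp
    have "\<bar>wp q p\<bar> \<le> K" "\<bar>Hp p\<bar> \<le> B1" using K(2)[of wp p q] B1(2)[of p] p by auto
    then show "Hp p + wp q p \<le> M" using M(3) by linarith
  next
    fix q p :: real assume p: "-1 < p \<and> p < 0"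
    show "(Hp p + wp q p)\<^sup>2 * wqq q p - (Hp p + wp q p) * wq q p * (wqp q p + wpq q p)
        + (1 + (wq q p)\<^sup>2) * (Hpp p + wpp q p)
        - (Hp p + wp q p) ^ 3 * (Hpp p / Hp p ^ 3 + \<mu> * \<rho>p p * w q p) = 0"
      unfolding \<mu>_def using height_eq_nondivergence[OF sol w_C2 Hp'] H_inc p by blast
  next
    fix q
    show "(1 + (wq q 0)\<^sup>2) / (2 * (Hp 0 + wp q 0)\<^sup>2) - 1 / (2 * (Hp 0)\<^sup>2) + \<mu> * \<rho> 0 * w q 0 = 0"
      using sol H_bc by (simp add: height_eq_def \<mu>_def)
    show "w q (-1) = 0" using sol H_bc by (simp add: height_eq_def)
  qed
  obtain b U where bU: "b > 0" "\<And>N. \<exists>\<delta> \<Phi> \<Phi>' \<Phi>''. supersol N b U \<delta> \<Phi> \<Phi>' \<Phi>''"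
    using supersolution_exists[of \<rho>] noeig by blast
  from decay show ?thesis
  proof
    assume "decays_left [w, wq, wp, wqq, wqp, wpq, wpp]"
    then show ?thesis using symmetric_of_decay_left[OF hs _ _ bU] w_pos by blast
  next
    assume right: "decays_right [w, wq, wp, wqq, wqp, wpq, wpp]"
    \<comment> \<open>Under reflection in \<open>q\<close>, derivatives with exactly one
      \<open>q\<close> change sign and the others do not. The reflected wave decays to the left, and
      its axis \<open>l\<close> becomes \<open>- l\<close>.\<close>
    let ?r = "\<lambda>f :: real \<Rightarrow> real \<Rightarrow> real. \<lambda>q p. f (- q) p"
    let ?m = "\<lambda>f :: real \<Rightarrow> real \<Rightarrow> real. \<lambda>q p. - f (- q) p"
    have hs': "hsol (?r w) (?m wq) (?r wp) (?r wqq) (?m wqp) (?m wpq) (?r wpp)"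
      using hsol_affine[OF hs, of "-1" 0] by simp
    have "decays_left [?r w, ?m wq, ?r wp, ?r wqq, ?m wqp, ?m wpq, ?r wpp]"
      unfolding decays_left_def
    proof (intro allI impI)
      fix e :: real assume "e > 0"
      then obtain Q where Q: "\<And>q p. q \<ge> Q \<and> -1 \<le> p \<and> p \<le> 0 \<Longrightarrow> (\<forall>g\<in>set [w, wq, wp, wqq, wqp, wpq, wpp]. \<bar>g q p\<bar> < e)"
        using right unfolding decays_right_def by blast
      have "\<forall>g\<in>set [?r w, ?m wq, ?r wp, ?r wqq, ?m wqp, ?m wpq, ?r wpp]. \<bar>g q p\<bar> < e"
        if "q \<le> - Q \<and> -1 \<le> p \<and> p \<le> 0" for q p
        using Q[of "- q" p] that by simp
      then show "\<exists>Q. \<forall>q p. q \<le> Q \<and> -1 \<le> p \<and> p \<le> 0 \<longrightarrow>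
          (\<forall>g\<in>set [?r w, ?m wq, ?r wp, ?r wqq, ?m wqp, ?m wpq, ?r wpp]. \<bar>g q p\<bar> < e)" by blast
    qed
    from symmetric_of_decay_left[OF hs' _ this bU] w_pos obtain l where
      l: "\<And>q p. -1 \<le> p \<and> p \<le> 0 \<Longrightarrow> w (- (2 * l - q)) p = w (- q) p"
        "\<And>q p. -1 < p \<and> p \<le> 0 \<Longrightarrow> (q < l \<longrightarrow> - wq (- q) p > 0) \<and> (q > l \<longrightarrow> - wq (- q) p < 0)"
      by blast
    show ?thesis
    proof (intro exI[of _ "- l"] conjI allI impI)
      fix q p :: real
      show "w (2 * - l - q) p = w q p" if "-1 \<le> p \<and> p \<le> 0"
        using l(1)[OF that, of "- q"] by simp
      show "wq q p > 0" if "-1 < p \<and> p \<le> 0" "q < - l" using l(2)[OF that(1), of "- q"] that by auto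
      show "wq q p < 0" if "-1 < p \<and> p \<le> 0" "q > - l" using l(2)[OF that(1), of "- q"] that by auto
    qed
  qed
qed

end
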